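(* Let $\mathcal{CL} \subset \mathbb{P}^{2}_{\mathbb{C}}$ be a free arrangement of $d$ lines and $k$ smooth conics admitting only ordinary quasi-homogeneous singularities. Then $$\tau(\mathcal{CL}) \geq 3k(k-1) + 3kd + \frac{3(d-1)^2}{4}.$$ Moreover, this bound is sharp, i.e., there exists such an arrangement for which equality holds.
   Context: We work over $\mathbb{C}$. An arrangement of $d$ lines and $k$ smooth conics is the reduced plane curve $C=\{f=0\}\subset\mathbb{P}^2$ which is the union of $d$ distinct lines and $k$ distinct smooth conics; its degree is $m=2k+d$. A singular point $p$ of $C$ is ordinary of multiplicity $r\ge 2$ if exactly $r$ of the component curves pass through $p$ and they meet pairwise transversally there. It is quasi-homogeneous if, in suitable local analytic coordinates centered at $p$, the germ of $C$ at $p$ is defined by a weighted-homogeneous polynomial (with positive weights). The Tjurina number of $C$ at $p$, where $p$ is moved to the origin in affine coordinates and $g\in\mathbb{C}\{x,y\}$ is a local equation of $C$, is $\tau_p(C)=\dim_{\mathbb{C}}\mathbb{C}\{x,y\}/\langle g,g_x,g_y\rangle$. The total Tjurina number is $\tau(C)=\sum_{p\in \mathrm{Sing}(C)}\tau_p(C)$. Let $S=\mathbb{C}[x,y,z]$ and $AR(f)=\{(a,b,c)\in S^3: af_x+bf_y+cf_z=0\}$, a graded $S$-module. The reduced curve $C=\{f=0\}$ is called free if $AR(f)$ is a free graded $S$-module of rank $2$. *)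

theory Defs
  imports "HOL-Analysis.Analysis" "HOL-Computational_Algebra.Computational_Algebra"
begin

section \<open>Polynomials over the complex numbers in two and three variables\<close>

text \<open>
  \<open>S = \<complex>[x,y,z]\<close> is represented as \<open>\<complex>[x][y][z]\<close> and \<open>\<complex>[x,y]\<close> as \<open>\<complex>[x][y]\<close>; the outermost
  polynomial variable is the last one.
\<close>

type_synonym poly2 = "complex poly poly"
type_synonym poly3 = "complex poly poly poly"

definition coeff2 :: "poly2 \<Rightarrow> nat \<Rightarrow> nat \<Rightarrow> complex" where
  "coeff2 h i j = coeff (coeff h j) i"

definition coeff3 :: "poly3 \<Rightarrow> nat \<Rightarrow> nat \<Rightarrow> nat \<Rightarrow> complex" where
  "coeff3 f i j k = coeff (coeff (coeff f k) j) i"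

text \<open>Substitution of elements of a \<open>\<complex>\<close>-algebra with structure map \<open>\<iota>\<close>.\<close>

definition subst2 :: "(complex \<Rightarrow> 'a::comm_ring_1) \<Rightarrow> poly2 \<Rightarrow> 'a \<Rightarrow> 'a \<Rightarrow> 'a" where
  "subst2 \<iota> h X Y = poly (map_poly (\<lambda>r. poly (map_poly \<iota> r) X) h) Y"

definition subst3 :: "(complex \<Rightarrow> 'a::comm_ring_1) \<Rightarrow> poly3 \<Rightarrow> 'a \<Rightarrow> 'a \<Rightarrow> 'a \<Rightarrow> 'a" where
  "subst3 \<iota> f X Y Z = poly (map_poly (\<lambda>q. subst2 \<iota> q X Y) f) Z"

definition eval3 :: "poly3 \<Rightarrow> complex^3 \<Rightarrow> complex" where
  "eval3 f v = subst3 (\<lambda>c. c) f (v$1) (v$2) (v$3)"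

definition homogeneous :: "nat \<Rightarrow> poly3 \<Rightarrow> bool" where
  "homogeneous n f \<longleftrightarrow> (\<forall>i j k. coeff3 f i j k \<noteq> 0 \<longrightarrow> i + j + k = n)"

text \<open>The vector \<open>(f\<^sub>x, f\<^sub>y, f\<^sub>z)\<close>.\<close>

definition gradient :: "poly3 \<Rightarrow> poly3^3" where
  "gradient f = vector [map_poly (map_poly pderiv) f, map_poly pderiv f, pderiv f]"

definition gradient_at :: "poly3 \<Rightarrow> complex^3 \<Rightarrow> complex^3" where
  "gradient_at f v = (\<chi> i. eval3 (gradient f $ i) v)"


section \<open>Plane curves\<close>

definition proj_eq :: "complex^3 \<Rightarrow> complex^3 \<Rightarrow> bool" where
  "proj_eq v w \<longleftrightarrow> v \<noteq> 0 \<and> (\<exists>c. c \<noteq> 0 \<and> w = c *s v)"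

text \<open>
  The complex projective plane. For a point \<open>p\<close>, \<open>rep_P2 p\<close> is a choice of homogeneous
  coordinates of \<open>p\<close>; everything below is independent of this choice.
\<close>

quotient_type P2 = "complex^3" / partial: proj_eq
proof (rule part_equivpI)
  have "proj_eq (axis 1 1) (axis 1 1)"
    unfolding proj_eq_def by (auto simp: axis_eq_0_iff intro: exI[of _ 1])
  then show "\<exists>v. proj_eq v v" ..
  show "symp proj_eq"
  proof (rule sympI)
    fix v w assume "proj_eq v w"
    then obtain c where "v \<noteq> 0" "c \<noteq> 0" "w = c *s v"
      unfolding proj_eq_def by blast
    then show "proj_eq w v"
      unfolding proj_eq_def by (auto simp: vector_smult_assoc intro!: exI[of _ "inverse c"])
  qed
  show "transp proj_eq"
  proof (rule transpI)
    fix u v w assume "proj_eq u v" "proj_eq v w"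
    then obtain a b where "u \<noteq> 0" "a \<noteq> 0" "b \<noteq> 0" "v = a *s u" "w = b *s v"
      unfolding proj_eq_def by blast
    then show "proj_eq u w"
      unfolding proj_eq_def by (auto simp: vector_smult_assoc intro!: exI[of _ "b * a"])
  qed
qed

definition zero_set :: "poly3 \<Rightarrow> P2 set" where
  "zero_set f = {p. eval3 f (rep_P2 p) = 0}"

definition Sing :: "poly3 \<Rightarrow> P2 set" where
  "Sing f = {p \<in> zero_set f. gradient_at f (rep_P2 p) = 0}"

definition line_form :: "poly3 \<Rightarrow> bool" where
  "line_form l \<longleftrightarrow> homogeneous 1 l \<and> l \<noteq> 0"

definition smooth_conic_form :: "poly3 \<Rightarrow> bool" where
  "smooth_conic_form q \<longleftrightarrow> homogeneous 2 q \<and> q \<noteq> 0 \<and> Sing q = {}"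

text \<open>
  An arrangement is given by the set \<open>L\<close> of equations of its lines and the set \<open>Q\<close> of equations of
  its conics. Distinct equations have to define distinct curves. The defining
  equation of the whole arrangement is \<open>\<Prod>(L \<union> Q)\<close>.
\<close>

definition arrangement :: "nat \<Rightarrow> nat \<Rightarrow> poly3 set \<Rightarrow> poly3 set \<Rightarrow> bool" where
  "arrangement d k L Q \<longleftrightarrow>
     finite L \<and> card L = d \<and> (\<forall>l\<in>L. line_form l) \<and> inj_on zero_set L \<and>
     finite Q \<and> card Q = k \<and> (\<forall>q\<in>Q. smooth_conic_form q) \<and> inj_on zero_set Q"


section \<open>The ring of convergent power series in two variables\<close>

text \<open>
  Formal power series \<open>\<complex>[[x,y]]\<close> are represented as \<open>\<complex>[[x]][[y]]\<close>.
\<close>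

type_synonym series2 = "complex fps fps"

definition const2 :: "complex \<Rightarrow> series2" where
  "const2 c = fps_const (fps_const c)"

definition x2 :: series2 where "x2 = fps_const fps_X"

definition y2 :: series2 where "y2 = fps_X"

definition nth2 :: "series2 \<Rightarrow> nat \<Rightarrow> nat \<Rightarrow> complex" where
  "nth2 g i j = fps_nth (fps_nth g j) i"

definition dx2 :: "series2 \<Rightarrow> series2" where
  "dx2 g = Abs_fps (\<lambda>j. fps_deriv (fps_nth g j))"

definition dy2 :: "series2 \<Rightarrow> series2" where
  "dy2 g = fps_deriv g"

text \<open>\<open>\<complex>{x,y}\<close>: the series that converge absolutely on some polydisc around the origin.\<close>

definition conv_series :: "series2 set" where
  "conv_series = {g. \<exists>r>0. (\<lambda>(i, j). norm (nth2 g i j) * r ^ i * r ^ j) summable_on UNIV}"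

text \<open>The ideal of \<open>\<complex>{x,y}\<close> generated by \<open>g\<close>, \<open>g\<^sub>x\<close>, \<open>g\<^sub>y\<close>.\<close>

definition tjurina_ideal :: "series2 \<Rightarrow> series2 set" where
  "tjurina_ideal g = {a * g + b * dx2 g + c * dy2 g | a b c.
     a \<in> conv_series \<and> b \<in> conv_series \<and> c \<in> conv_series}"

text \<open>
  \<open>dim V/I = n\<close>, for complex subspaces \<open>I \<subseteq> V\<close> of \<open>\<complex>[[x,y]]\<close>: there are \<open>b\<^sub>0, \<dots>, b\<^bsub>n-1\<^esub> \<in> V\<close> whose
  classes form a basis of \<open>V/I\<close>.
\<close>

definition has_quotient_dim :: "series2 set \<Rightarrow> series2 set \<Rightarrow> nat \<Rightarrow> bool" where
  "has_quotient_dim V I n \<longleftrightarrow>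
     (\<exists>b :: nat \<Rightarrow> series2. (\<forall>i<n. b i \<in> V) \<and>
        (\<forall>v\<in>V. \<exists>!c :: nat \<Rightarrow> complex.
            (\<forall>i\<ge>n. c i = 0) \<and> v - (\<Sum>i<n. const2 (c i) * b i) \<in> I))"


section \<open>Local invariants of a curve at a point\<close>

text \<open>
  Equation of the curve \<open>f = 0\<close> in a standard affine chart containing \<open>p\<close>, translated so that
  \<open>p\<close> becomes the origin.
\<close>

definition local_equation :: "poly3 \<Rightarrow> P2 \<Rightarrow> series2" where
  "local_equation f p =
     (let v = rep_P2 p in
      if v$3 \<noteq> 0 then subst3 const2 f (const2 (v$1 / v$3) + x2) (const2 (v$2 / v$3) + y2) 1
      else if v$2 \<noteq> 0 then subst3 const2 f (const2 (v$1 / v$2) + x2) 1 y2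
      else subst3 const2 f 1 x2 y2)"

text \<open>
  The value is meaningful when the quotient is finite-dimensional, which is the case for reduced
  curves.
\<close>

definition tjurina :: "poly3 \<Rightarrow> P2 \<Rightarrow> nat" where
  "tjurina f p = (THE n. has_quotient_dim conv_series (tjurina_ideal (local_equation f p)) n)"

text \<open>A reduced curve has finitely many singular points.\<close>

definition total_tjurina :: "poly3 \<Rightarrow> nat" where
  "total_tjurina f = (\<Sum>p\<in>Sing f. tjurina f p)"

text \<open>Transversality at a common smooth point: the tangent lines are distinct.\<close>

definition transversal_at :: "P2 \<Rightarrow> poly3 \<Rightarrow> poly3 \<Rightarrow> bool" where
  "transversal_at p g h \<longleftrightarrow>
     (\<forall>a b. a *s gradient_at g (rep_P2 p) + b *s gradient_at h (rep_P2 p) = 0 \<longrightarrow> a = 0 \<and> b = 0)"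

text \<open>Here \<open>A\<close> is the set of equations of the component curves.\<close>

definition ordinary_point :: "poly3 set \<Rightarrow> nat \<Rightarrow> P2 \<Rightarrow> bool" where
  "ordinary_point A r p \<longleftrightarrow> r \<ge> 2 \<and> card {g \<in> A. p \<in> zero_set g} = r \<and>
     (\<forall>g\<in>A. \<forall>h\<in>A. p \<in> zero_set g \<and> p \<in> zero_set h \<and> g \<noteq> h \<longrightarrow> transversal_at p g h)"

definition weighted_homogeneous :: "poly2 \<Rightarrow> bool" where
  "weighted_homogeneous h \<longleftrightarrow> (\<exists>w1 w2 e :: nat. w1 > 0 \<and> w2 > 0 \<and>
     (\<forall>i j. coeff2 h i j \<noteq> 0 \<longrightarrow> w1 * i + w2 * j = e))"

text \<open>Local analytic coordinates at the origin (inverse function theorem).\<close>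

definition local_coordinates :: "series2 \<Rightarrow> series2 \<Rightarrow> bool" where
  "local_coordinates X Y \<longleftrightarrow> X \<in> conv_series \<and> Y \<in> conv_series \<and> nth2 X 0 0 = 0 \<and> nth2 Y 0 0 = 0 \<and>
     nth2 X 1 0 * nth2 Y 0 1 - nth2 X 0 1 * nth2 Y 1 0 \<noteq> 0"

text \<open>
  The germ of \<open>f = 0\<close> at \<open>p\<close> is defined by \<open>h(X,Y)\<close> when its local equation is \<open>h(X,Y)\<close> up to a unit
  of \<open>\<complex>{x,y}\<close>.
\<close>

definition quasi_homogeneous_at :: "poly3 \<Rightarrow> P2 \<Rightarrow> bool" where
  "quasi_homogeneous_at f p \<longleftrightarrow>
     (\<exists>X Y u h. local_coordinates X Y \<and> u \<in> conv_series \<and> nth2 u 0 0 \<noteq> 0 \<and>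
        weighted_homogeneous h \<and> local_equation f p = u * subst2 const2 h X Y)"

definition only_ordinary_quasi_homogeneous :: "poly3 set \<Rightarrow> bool" where
  "only_ordinary_quasi_homogeneous A \<longleftrightarrow>
     (\<forall>p\<in>Sing (\<Prod>A). (\<exists>r. ordinary_point A r p) \<and> quasi_homogeneous_at (\<Prod>A) p)"


section \<open>Free curves\<close>

text \<open>\<open>S\<^sup>3\<close> as a module over \<open>S\<close>.\<close>

interpretation S3: module "(*s) :: poly3 \<Rightarrow> poly3^3 \<Rightarrow> poly3^3"
  by unfold_locales (simp_all add: vector_add_ldistrib vector_sadd_rdistrib vector_smult_assoc)

definition AR :: "poly3 \<Rightarrow> (poly3^3) set" where
  "AR f = {r. (\<Sum>i\<in>UNIV. r $ i * gradient f $ i) = 0}"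

text \<open>A free graded module is one with a basis of homogeneous elements.\<close>

definition free_curve :: "poly3 \<Rightarrow> bool" where
  "free_curve f \<longleftrightarrow> (\<exists>B. card B = 2 \<and> (\<forall>r\<in>B. \<exists>e. \<forall>i. homogeneous e (r $ i)) \<and>
     S3.independent B \<and> S3.span B = AR f)"

end

theory Submission
  imports Defs "HOL-Computational_Algebra.Field_as_Ring"
begin

text \<open>
  Let \<open>m\<close> be the degree of the curve and \<open>J\<close> the ideal of its partial derivatives. In terms of \<open>m\<close> the
  bound is \<open>3/4 (m - 1)\<^sup>2\<close>. If the curve is free with exponents \<open>e1\<close>, \<open>e2\<close>, the free resolution gives the
  codimension of \<open>J\<close> in the forms of large degree \<open>n\<close> as an explicit polynomial in \<open>n\<close>. This codimension
  turns out to be constant, which forces \<open>e1 + e2 = m - 1\<close> and leaves the value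
  \<open>(m - 1)\<^sup>2 - e1 e2 \<ge> 3/4 (m - 1)\<^sup>2\<close>.

  It remains to bound the codimension by the total Tjurina number, that is, to show that a form \<open>g\<close> of
  large degree lies in \<open>J\<close> as soon as it lies in the local Jacobian ideal at every singular point.
  Transversality makes the components pairwise coprime, so there are finitely many singular points and
  some line \<open>l\<close> avoids them all. Multiplication by \<open>l\<close> is then bijective between the large graded
  pieces of \<open>S/J\<close>, and dividing by \<open>l\<close> turns the coordinates into commuting operators on a
  finite-dimensional space. If \<open>g\<close> is not in \<open>J\<close>, a common eigenvector in the module generated by \<open>g\<close>
  yields a singular point \<open>p\<close> at which every form \<open>H\<close> with \<open>H g \<in> J\<close> vanishes. But there is such an \<open>H\<close>
  with \<open>H(p) \<noteq> 0\<close>: annihilating polynomials of the operators give an \<open>H\<close> that multiplies a power of the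
  maximal ideal of \<open>p\<close> into \<open>J\<close>, and modulo that power the convergent coefficients expressing \<open>g\<close> in the
  local Jacobian ideal can be replaced by polynomials.

  Equality already holds for a single line, which has no singular points.
\<close>

section \<open>Finite-dimensional subspaces\<close>

text \<open>The codimension of \<open>J\<close> is a global quantity attached to polynomials,
  whereas the Tjurina numbers are dimensions over convergent power series; the core is therefore a
  passage from local membership to membership in \<open>J\<close>. What is at stake is an upper
  bound for the codimension, so at each singular point it is enough to have as many linear
  conditions as the Tjurina algebra has dimensions and to show that together they force membership.
  \<open>J\<close> need not be saturated, hence the restriction to large degrees. Saturations take
  the place of quotients and localisations: a power of \<open>l\<close> times \<open>g\<close> lying
  in \<open>J\<close> stands for the vanishing of \<open>g\<close> after inverting \<open>l\<close>.
  The points that would usually come from the Nullstellensatz come from eigenvectors over the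
  complex numbers. The Tjurina ideal contains the local equation itself, while \<open>J\<close> is
  generated by partials only; the Euler relation, available in positive degree, removes this
  difference. The constant 3/4 is 1 - 1/4, since a product is at most a quarter of the square of the
  sum.\<close>

locale vec_space = vector_space scale
  for scale :: "'a::field \<Rightarrow> 'b::ab_group_add \<Rightarrow> 'b"
begin

text \<open>The ambient spaces of polynomials and power series are infinite-dimensional, so
  finiteness is a property of subsets. The spanning set may lie outside \<open>V\<close>, which
  makes the property hereditary at once.\<close>

definition fin_dim :: "'b set \<Rightarrow> bool" where
  "fin_dim V \<longleftrightarrow> (\<exists>B. finite B \<and> V \<subseteq> span B)"

lemma fin_dim_subset: "fin_dim V \<Longrightarrow> W \<subseteq> V \<Longrightarrow> fin_dim W"
  unfolding fin_dim_def by blast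

lemma fin_dim_span: "finite B \<Longrightarrow> fin_dim (span B)"
  unfolding fin_dim_def by blast

lemma fin_dim_independent_finite:
  assumes "fin_dim V" "independent B" "B \<subseteq> V"
  shows "finite B"
  using assms independent_span_bound unfolding fin_dim_def by (meson subset_trans)

lemma fin_dim_basis:
  assumes "fin_dim V"
  obtains B where "B \<subseteq> V" "independent B" "V \<subseteq> span B" "finite B" "card B = dim V"
  using basis_exists[of V] fin_dim_independent_finite[OF assms] by metis

lemma dim_mono_fin_dim:
  assumes "fin_dim W" "V \<subseteq> W"
  shows "dim V \<le> dim W"
proof -
  obtain B where B: "B \<subseteq> W" "independent B" "W \<subseteq> span B" "finite B" "card B = dim W"
    using fin_dim_basis[OF assms(1)] .
  then show ?thesis using dim_le_card[of V B] assms(2) by auto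
qed

lemma independent_Un_direct:
  assumes "independent A" "independent B" "finite A" "finite B" "span A \<inter> span B = {0}"
  shows "independent (A \<union> B)" "A \<inter> B = {}"
proof -
  have "0 \<notin> A" using assms(1) dependent_zero by blast
  moreover have "A \<inter> B \<subseteq> {0}" using assms(5) span_superset[of A] span_superset[of B] by blast
  ultimately show disj: "A \<inter> B = {}" by blast
  show "independent (A \<union> B)"
  proof (rule independent_if_scalars_zero)
    show "finite (A \<union> B)" using assms by blast
    fix f x assume sum0: "(\<Sum>x\<in>A \<union> B. scale (f x) x) = 0" and x: "x \<in> A \<union> B"
    define a where "a = (\<Sum>x\<in>A. scale (f x) x)"
    define b where "b = (\<Sum>x\<in>B. scale (f x) x)"
    have ab: "a + b = 0" using sum0 unfolding a_def b_def sum.union_disjoint[OF assms(3,4) disj] .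
    have "a \<in> span A" "b \<in> span B"
      unfolding a_def b_def by (rule span_sum, rule span_scale, erule span_base)+
    moreover have "a = - b" using ab by (simp add: eq_neg_iff_add_eq_0)
    ultimately have "a \<in> span A \<inter> span B" using span_neg by auto
    then have "a = 0" "b = 0" using assms(5) ab by auto
    then show "f x = 0"
      using x independentD[OF assms(1,3) order_refl, of f x] independentD[OF assms(2,4) order_refl, of f x]
      unfolding a_def b_def by blast
  qed
qed

lemma dim_direct_sum:
  assumes "subspace K" "fin_dim K" "independent B" "finite B" "K \<inter> span B = {0}"
  shows "dim (span (K \<union> B)) = dim K + card B"
proof -
  obtain A where A: "A \<subseteq> K" "independent A" "K \<subseteq> span A" "finite A" "card A = dim K"
    using fin_dim_basis[OF assms(2)] .
  have KA: "span A = K" using A assms(1) span_minimal by blast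
  have ind: "independent (A \<union> B)" "A \<inter> B = {}"
    using independent_Un_direct[OF A(2) assms(3) A(4) assms(4)] KA assms(5) by auto
  have "span (K \<union> B) = span (A \<union> B)"
    unfolding span_Un KA[symmetric] span_span ..
  then have "dim (span (K \<union> B)) = card (A \<union> B)"
    using ind(1) dim_span_eq_card_independent by simp
  also have "\<dots> = dim K + card B" using A assms ind by (simp add: card_Un_disjoint)
  finally show ?thesis .
qed

lemma complement_exists:
  assumes "subspace K" "subspace V" "fin_dim V" "K \<subseteq> V"
  obtains B where "B \<subseteq> V" "finite B" "independent B" "span (K \<union> B) = V" "K \<inter> span B = {0}"
    "dim V = dim K + card B"
proof -
  obtain A where A: "A \<subseteq> K" "independent A" "K \<subseteq> span A" "finite A" "card A = dim K"
    using fin_dim_basis[OF fin_dim_subset[OF assms(3,4)]] .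
  obtain C where C: "A \<subseteq> C" "C \<subseteq> V" "independent C" "V \<subseteq> span C"
    using maximal_independent_subset_extend[of A V] A(1,2) assms(4) by blast
  have finC: "finite C" using fin_dim_independent_finite[OF assms(3) C(3,2)] .
  define B where "B = C - A"
  have B: "B \<subseteq> V" "finite B" "independent B"
    using C finC independent_mono[of C B] by (auto simp: B_def)
  have KA: "span A = K" using A assms(1) span_minimal by blast
  have "span (K \<union> B) = span (A \<union> B)"
    unfolding span_Un KA[symmetric] span_span ..
  also have "A \<union> B = C" using C by (auto simp: B_def)
  also have "span C = V" using C assms(2) span_minimal by blast
  finally have sp: "span (K \<union> B) = V" .
  have int: "K \<inter> span B = {0}"
  proof (intro equalityI subsetI)
    fix x assume x: "x \<in> K \<inter> span B"
    \<comment> \<open>Coordinates with respect to \<open>C\<close> are unique: those of an element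
      of \<open>K\<close> are supported on \<open>A\<close>, those of an element of
      \<open>span B\<close> on \<open>C - A\<close>.\<close>
    have "representation C x = representation A x" "representation C x = representation B x"
      using x KA C(3) A(2) representation_extend[of C x A] representation_extend[of C x B] C(1)
      by (auto simp: B_def)
    then have "representation C x b = 0" for b
      using representation_ne_zero[of A x b] representation_ne_zero[of B x b] by (auto simp: B_def)
    moreover have "x \<in> span C" using x KA span_mono[OF C(1)] by blast
    ultimately show "x \<in> {0}"
      using sum_representation_eq[OF C(3) _ finC order_refl, of x] by simp
  qed (use assms(1) span_zero subspace_0 in auto)
  have "dim V = dim K + card B"
    using dim_direct_sum[OF assms(1) fin_dim_subset[OF assms(3,4)] B(3,2) int] sp by simp
  then show ?thesis using that B sp int by blast
qed

lemma subspace_eq_fin_dim: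
  assumes "subspace K" "subspace V" "fin_dim V" "K \<subseteq> V" "dim V \<le> dim K"
  shows "K = V"
proof -
  obtain B where B: "finite B" "span (K \<union> B) = V" "dim V = dim K + card B"
    using complement_exists[OF assms(1-4)] by metis
  then have "B = {}" using assms(5) by simp
  then show ?thesis using B(2) assms(1) by (simp add: span_eq_iff[THEN iffD2])
qed

lemma dim_sum_Int:
  assumes "subspace A" "subspace B" "fin_dim A" "fin_dim B"
  shows "dim {x + y |x y. x \<in> A \<and> y \<in> B} + dim (A \<inter> B) = dim A + dim B"
proof -
  obtain C where C: "C \<subseteq> A" "finite C" "independent C" "span ((A \<inter> B) \<union> C) = A"
      "(A \<inter> B) \<inter> span C = {0}" "dim A = dim (A \<inter> B) + card C"
    using complement_exists[of "A \<inter> B" A] assms subspace_inter by auto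
  have CA: "span C \<subseteq> A" using C assms by (simp add: span_minimal)
  have "B \<inter> span C = {0}" using C CA by blast
  then have "dim (span (B \<union> C)) = dim B + card C"
    using dim_direct_sum assms C by blast
  moreover have "span (B \<union> C) = {x + y |x y. x \<in> A \<and> y \<in> B}"
  proof -
    have "span (B \<union> C) = span (A \<union> B)"
    proof (intro equalityI span_minimal subspace_span)
      show "B \<union> C \<subseteq> span (A \<union> B)" using C(1) by (auto intro: span_base)
      have "A \<subseteq> span (B \<union> C)"
        by (subst C(4)[symmetric], rule span_mono) auto
      then show "A \<union> B \<subseteq> span (B \<union> C)" by (auto intro: span_base)
    qed
    also have "\<dots> = {x + y |x y. x \<in> A \<and> y \<in> B}"
      using assms(1,2) by (simp add: span_Un span_eq_iff[THEN iffD2])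
    finally show ?thesis .
  qed
  ultimately show ?thesis using C(6) by simp
qed

text \<open>\<open>D + 1\<close> vectors are dependent in a quotient of dimension at most
  \<open>D\<close>. The family is indexed because the indices later become the exponents of an
  annihilating polynomial; a coincidence among its members is itself a relation.\<close>

lemma dependent_modulo:
  assumes "subspace K" "subspace V" "fin_dim V" "K \<subseteq> V" "dim V \<le> dim K + D"
    and w: "\<And>i. i \<le> D \<Longrightarrow> w i \<in> V"
  shows "\<exists>c :: nat \<Rightarrow> 'a. (\<exists>i\<le>D. c i \<noteq> 0) \<and> (\<Sum>i\<le>D. scale (c i) (w i)) \<in> K"
proof (rule ccontr)
  assume contra: "\<not> ?thesis"
  have zero: "c i = 0" if "(\<Sum>i\<le>D. scale (c i) (w i)) \<in> K" "i \<le> D" for c i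
    using contra that by blast
  have inj: "inj_on w {..D}"
  proof (rule inj_onI, rule ccontr)
    fix i j assume ij: "i \<in> {..D}" "j \<in> {..D}" "w i = w j" "i \<noteq> j"
    define c where "c = (\<lambda>k. if k = i then 1 else if k = j then -1 else 0 :: 'a)"
    have "(\<Sum>k\<le>D. scale (c k) (w k)) = (\<Sum>k\<in>{i,j}. scale (c k) (w k))"
      by (rule sum.mono_neutral_right) (use ij in \<open>auto simp: c_def\<close>)
    also have "\<dots> = 0" using ij by (simp add: c_def)
    finally have "(\<Sum>k\<le>D. scale (c k) (w k)) \<in> K" using assms(1) subspace_0 by simp
    from zero[OF this, of i] ij show False by (simp add: c_def)
  qed
  have sumw: "(\<Sum>v\<in>w ` {..D}. scale (f v) v) = (\<Sum>i\<le>D. scale (f (w i)) (w i))" for f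
    using inj by (simp add: sum.reindex)
  have ind: "independent (w ` {..D})"
  proof (rule independent_if_scalars_zero)
    fix f x assume "(\<Sum>x\<in>w ` {..D}. scale (f x) x) = 0" "x \<in> w ` {..D}"
    then show "f x = 0"
      using zero[of "\<lambda>i. f (w i)"] sumw[of f] subspace_0[OF assms(1)] by auto
  qed simp
  have int: "K \<inter> span (w ` {..D}) = {0}"
  proof (intro equalityI subsetI)
    fix x assume x: "x \<in> K \<inter> span (w ` {..D})"
    then obtain f where f: "x = (\<Sum>v\<in>w ` {..D}. scale (f v) v)"
      using span_finite[of "w ` {..D}"] by auto
    then have "f (w i) = 0" if "i \<le> D" for i
      using zero[of "\<lambda>i. f (w i)" i] sumw x that by auto
    then show "x \<in> {0}" using f sumw by simp
  qed (use assms(1) span_zero subspace_0 in auto)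
  have "dim (span (K \<union> w ` {..D})) = dim K + Suc D"
    using dim_direct_sum[OF assms(1) fin_dim_subset[OF assms(3,4)] ind _ int] inj
    by (simp add: card_image)
  moreover have "dim (span (K \<union> w ` {..D})) \<le> dim V"
    using assms w by (intro dim_mono_fin_dim span_minimal) auto
  ultimately show False using assms(5) by simp
qed

lemma dim_kernel_functional:
  assumes "subspace V" "fin_dim V"
    and add: "\<And>x y. x \<in> V \<Longrightarrow> y \<in> V \<Longrightarrow> \<phi> (x + y) = \<phi> x + (\<phi> y :: 'a)"
    and scl: "\<And>c x. x \<in> V \<Longrightarrow> \<phi> (scale c x) = c * \<phi> x"
  shows "subspace {x \<in> V. \<phi> x = 0}" "dim V \<le> dim {x \<in> V. \<phi> x = 0} + 1"
proof -
  let ?K = "{x \<in> V. \<phi> x = 0}"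
  have "\<phi> 0 = 0" using scl[of 0 0] subspace_0[OF assms(1)] by simp
  then show sub: "subspace ?K" using assms(1) add scl by (auto simp: subspace_def)
  have fK: "fin_dim ?K" using fin_dim_subset[OF assms(2)] by auto
  show "dim V \<le> dim ?K + 1"
  proof (cases "\<exists>v\<in>V. \<phi> v \<noteq> 0")
    case True
    then obtain v where v: "v \<in> V" "\<phi> v \<noteq> 0" by blast
    obtain A where A: "A \<subseteq> ?K" "independent A" "?K \<subseteq> span A" "finite A" "card A = dim ?K"
      using fin_dim_basis[OF fK] .
    have "V \<subseteq> span (insert v A)"
    proof
      fix x assume x: "x \<in> V"
      have "x - scale (\<phi> x / \<phi> v) v \<in> ?K"
        using add[of "x - scale (\<phi> x / \<phi> v) v" "scale (\<phi> x / \<phi> v) v"] x v scl assms(1)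
        by (auto simp: subspace_diff subspace_scale)
      then show "x \<in> span (insert v A)" using A(3) by (auto simp: span_insert)
    qed
    then have "dim V \<le> card (insert v A)" using dim_le_card A(4) by blast
    also have "\<dots> \<le> dim ?K + 1" using A by (simp add: card_insert_if)
    finally show ?thesis .
  next
    case False
    then have "?K = V" by auto
    then show ?thesis by simp
  qed
qed

text \<open>Each linear condition lowers the dimension by at most one. Linearity is asked only on
  \<open>V\<close>, since coordinates in a quotient of \<open>V\<close> are controlled only
  there.\<close>

lemma dim_kernel_functionals:
  assumes "subspace V" "fin_dim V" "finite I"
    and add: "\<And>i x y. i \<in> I \<Longrightarrow> x \<in> V \<Longrightarrow> y \<in> V \<Longrightarrow> \<phi> i (x + y) = \<phi> i x + (\<phi> i y :: 'a)"
    and scl: "\<And>i c x. i \<in> I \<Longrightarrow> x \<in> V \<Longrightarrow> \<phi> i (scale c x) = c * \<phi> i x"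
  shows "dim V \<le> dim {x \<in> V. \<forall>i\<in>I. \<phi> i x = 0} + card I"
proof -
  have "subspace {x \<in> V. \<forall>i\<in>I. \<phi> i x = 0} \<and> dim V \<le> dim {x \<in> V. \<forall>i\<in>I. \<phi> i x = 0} + card I"
    using assms(3) add scl
  proof (induction I rule: finite_induct)
    case (insert a I)
    let ?W = "{x \<in> V. \<forall>i\<in>I. \<phi> i x = 0}"
    have IH: "subspace ?W" "dim V \<le> dim ?W + card I" using insert by auto
    have fW: "fin_dim ?W" using fin_dim_subset[OF assms(2)] by auto
    have "subspace {x \<in> ?W. \<phi> a x = 0}" "dim ?W \<le> dim {x \<in> ?W. \<phi> a x = 0} + 1"
      by (rule dim_kernel_functional[OF IH(1) fW]; use insert in auto)+
    moreover have "{x \<in> ?W. \<phi> a x = 0} = {x \<in> V. \<forall>i\<in>insert a I. \<phi> i x = 0}" by auto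
    ultimately show ?case using IH(2) insert(1,2) by auto
  qed (use assms(1) in auto)
  then show ?thesis ..
qed

end

locale vec_space_pair = vs1: vec_space s1 + vs2: vec_space s2
  for s1 :: "'a::field \<Rightarrow> 'b::ab_group_add \<Rightarrow> 'b"
    and s2 :: "'a \<Rightarrow> 'c::ab_group_add \<Rightarrow> 'c"
begin

sublocale vector_space_pair s1 s2 ..

lemma dim_rank_nullity:
  assumes "Vector_Spaces.linear s1 s2 f" "vs1.subspace V" "vs1.fin_dim V"
  shows "vs1.dim V = vs2.dim (f ` V) + vs1.dim {x \<in> V. f x = 0}" "vs2.fin_dim (f ` V)"
proof -
  let ?K = "{x \<in> V. f x = 0}"
  interpret f: Vector_Spaces.linear s1 s2 f by fact
  have subK: "vs1.subspace ?K"
    using assms(2) by (auto simp: vs1.subspace_def f.add f.scale)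
  obtain B where B: "B \<subseteq> V" "finite B" "vs1.independent B" "vs1.span (?K \<union> B) = V"
      "?K \<inter> vs1.span B = {0}" "vs1.dim V = vs1.dim ?K + card B"
    using vs1.complement_exists[OF subK assms(2,3)] by auto
  have BV: "vs1.span B \<subseteq> V" using B assms by (simp add: vs1.span_minimal)
  have inj: "inj_on f (vs1.span B)"
    using B(5) BV by (subst f.inj_on_iff_eq_0) auto
  have ind: "vs2.independent (f ` B)"
    using f.independent_injective_image[OF B(3) inj] .
  have "f ` V = vs2.span (f ` B)"
  proof
    have "vs2.span (f ` (?K \<union> B)) \<subseteq> vs2.span (f ` B)"
      by (rule vs2.span_minimal) (auto intro: vs2.span_base vs2.span_zero)
    then show "f ` V \<subseteq> vs2.span (f ` B)" using B(4) f.span_image by metis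
    show "vs2.span (f ` B) \<subseteq> f ` V" using BV f.span_image by auto
  qed
  moreover have "card (f ` B) = card B"
    using card_image[OF inj_on_subset[OF inj vs1.span_superset]] .
  ultimately show "vs1.dim V = vs2.dim (f ` V) + vs1.dim ?K" "vs2.fin_dim (f ` V)"
    using ind B vs2.dim_span_eq_card_independent vs2.fin_dim_span by auto
qed

lemma dim_image_inj_on:
  assumes "Vector_Spaces.linear s1 s2 f" "vs1.subspace V" "vs1.fin_dim V" "\<And>x. x \<in> V \<Longrightarrow> f x = 0 \<Longrightarrow> x = 0"
  shows "vs2.dim (f ` V) = vs1.dim V"
proof -
  have "{x \<in> V. f x = 0} = {0}"
    using assms linear_0[OF assms(1)] vs1.subspace_0[OF assms(2)] by blast
  moreover have "vs1.dim {0} = 0" using vs1.dim_le_card[of "{0}" "{}"] by simp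
  ultimately show ?thesis using dim_rank_nullity(1)[OF assms(1-3)] by simp
qed

end

section \<open>Ternary forms\<close>

definition const3 :: "complex \<Rightarrow> poly3" where "const3 c = [:[:[:c:]:]:]"
definition X3 :: poly3 where "X3 = [:[:[:0, 1:]:]:]"
definition Y3 :: poly3 where "Y3 = [:[:0, 1:]:]"
definition Z3 :: poly3 where "Z3 = [:0, 1:]"

lemma const3_simps [simp]:
  "const3 0 = 0" "const3 1 = 1" "const3 (a + b) = const3 a + const3 b"
  "const3 (a * b) = const3 a * const3 b" "const3 (- a) = - const3 a"
  "const3 (a - b) = const3 a - const3 b" "const3 a = 0 \<longleftrightarrow> a = 0"
  by (simp_all add: const3_def one_pCons)

lemma const3_power [simp]: "const3 (a ^ n) = const3 a ^ n"
  by (induction n) auto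

lemma const3_of_nat: "const3 (of_nat n) = of_nat n"
  by (induction n) auto

lemma coeff3_simps [simp]:
  "coeff3 0 i j k = 0"
  "coeff3 (f + g) i j k = coeff3 f i j k + coeff3 g i j k"
  "coeff3 (const3 c * f) i j k = c * coeff3 f i j k"
  by (simp_all add: coeff3_def const3_def)

lemma coeff3_sum: "coeff3 (sum F A) i j k = (\<Sum>a\<in>A. coeff3 (F a) i j k)"
  by (induction A rule: infinite_finite_induct) auto

lemma poly3_eqI: "(\<And>i j k. coeff3 f i j k = coeff3 g i j k) \<Longrightarrow> f = g"
  by (auto simp: coeff3_def intro!: poly_eqI)

definition mono3 :: "nat \<Rightarrow> nat \<Rightarrow> nat \<Rightarrow> poly3" where
  "mono3 i j k = X3 ^ i * Y3 ^ j * Z3 ^ k"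

lemma mono3_eq_monom: "mono3 i j k = monom (monom (monom 1 i) j) k"
proof -
  have "X3 ^ i = [:[:monom 1 i:]:]" unfolding X3_def
    by (induction i) (simp_all add: monom_Suc monom_0 flip: one_pCons)
  moreover have "Y3 ^ j = [:monom 1 j:]" unfolding Y3_def
    by (induction j) (simp_all add: monom_Suc monom_0 flip: one_pCons)
  moreover have "Z3 ^ k = monom 1 k" unfolding Z3_def
    by (induction k) (simp_all add: monom_Suc monom_0 flip: one_pCons)
  ultimately show ?thesis by (simp add: mono3_def smult_monom)
qed

lemma coeff3_mono3: "coeff3 (mono3 i j k) a b c = (if a = i \<and> b = j \<and> c = k then 1 else 0)"
  by (auto simp: mono3_eq_monom coeff3_def)

lemma mono3_mult: "mono3 a b c * mono3 i j k = mono3 (a + i) (b + j) (c + k)"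
  by (simp add: mono3_def power_add mult_ac)

lemma poly3_induct [case_names const add X Y Z]:
  assumes "\<And>c. P (const3 c)" "\<And>f g. P f \<Longrightarrow> P g \<Longrightarrow> P (f + g)"
    and "\<And>f. P f \<Longrightarrow> P (X3 * f)" "\<And>f. P f \<Longrightarrow> P (Y3 * f)" "\<And>f. P f \<Longrightarrow> P (Z3 * f)"
  shows "P f"
proof -
  have 1: "P [:[:r:]:]" for r
  proof (induction r)
    case 0 then show ?case using assms(1)[of 0] by (simp add: const3_def)
  next
    case (pCons a r)
    have "[:[:pCons a r:]:] = const3 a + X3 * [:[:r:]:]" by (simp add: const3_def X3_def)
    then show ?case using pCons assms by metis
  qed
  have 2: "P [:q:]" for q
  proof (induction q)
    case 0 then show ?case using 1[of 0] by simp
  next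
    case (pCons a q)
    have "[:pCons a q:] = [:[:a:]:] + Y3 * [:q:]" by (simp add: Y3_def)
    then show ?case using pCons 1 assms by metis
  qed
  show ?thesis
  proof (induction f)
    case 0 then show ?case using 2[of 0] by simp
  next
    case (pCons a f)
    have "pCons a f = [:a:] + Z3 * f" by (simp add: Z3_def)
    then show ?case using pCons 2 assms by metis
  qed
qed

lemma poly3_mono3_induct [case_names add mono]:
  assumes "\<And>f g. P f \<Longrightarrow> P g \<Longrightarrow> P (f + g)" "\<And>c i j k. P (const3 c * mono3 i j k)"
  shows "P f"
proof -
  \<comment> \<open>The claim is generalised over a monomial factor, which absorbs a variable
    multiplied to \<open>f\<close>.\<close>
  have "\<forall>i j k. P (f * mono3 i j k)"
  proof (induction f rule: poly3_induct)
    case (X f)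
    then show ?case by (metis (no_types, lifting) mono3_def mult.assoc mult.left_commute power_Suc)
  next
    case (Y f)
    then show ?case by (metis (no_types, lifting) mono3_def mult.assoc mult.left_commute power_Suc)
  next
    case (Z f)
    then show ?case by (metis (no_types, lifting) mono3_def mult.assoc mult.left_commute power_Suc)
  qed (use assms in \<open>auto simp: distrib_right\<close>)
  then have "P (f * mono3 0 0 0)" by blast
  then show ?thesis by (simp add: mono3_def)
qed

definition scale3 :: "complex \<Rightarrow> poly3 \<Rightarrow> poly3" where "scale3 c f = const3 c * f"

interpretation PS: vec_space scale3
  by unfold_locales (simp_all add: scale3_def algebra_simps)

definition forms :: "nat \<Rightarrow> poly3 set" where "forms n = {f. homogeneous n f}"

lemma forms_subspace: "PS.subspace (forms n)"
  by (auto simp: PS.subspace_def forms_def homogeneous_def scale3_def) (metis add.right_neutral)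

lemma forms_0 [simp]: "0 \<in> forms n"
  and forms_add: "f \<in> forms n \<Longrightarrow> g \<in> forms n \<Longrightarrow> f + g \<in> forms n"
  and forms_diff: "f \<in> forms n \<Longrightarrow> g \<in> forms n \<Longrightarrow> f - g \<in> forms n"
  and forms_const_mult: "f \<in> forms n \<Longrightarrow> const3 c * f \<in> forms n"
  and forms_sum: "(\<And>a. a \<in> A \<Longrightarrow> F a \<in> forms n) \<Longrightarrow> sum F A \<in> forms n"
  using forms_subspace[of n] PS.subspace_0 PS.subspace_add PS.subspace_diff
    PS.subspace_scale PS.subspace_sum unfolding scale3_def by metis+

lemma mono3_forms: "i + j + k = n \<Longrightarrow> mono3 i j k \<in> forms n"
  by (auto simp: forms_def homogeneous_def coeff3_mono3)

lemma mono3_forms_iff: "mono3 i j k \<in> forms n \<longleftrightarrow> i + j + k = n"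
  by (auto simp: forms_def homogeneous_def coeff3_mono3)

definition exps :: "nat \<Rightarrow> (nat \<times> nat \<times> nat) set" where
  "exps n = {(i, j, k). i + j + k = n}"

lemma exps_eq: "exps n = (\<lambda>(i, j). (i, j, n - i - j)) ` (SIGMA i:{..n}. {..n - i})"
  by (force simp: exps_def image_iff)

lemma finite_exps [simp]: "finite (exps n)"
  by (simp add: exps_eq)

lemma card_exps: "2 * card (exps n) = (n + 1) * (n + 2)"
proof -
  have "inj_on (\<lambda>(i, j). (i, j, n - i - j)) (SIGMA i:{..n}. {..n - i})"
    by (auto simp: inj_on_def)
  then have "card (exps n) = (\<Sum>i\<le>n. Suc (n - i))"
    by (simp add: exps_eq card_image)
  also have "\<dots> = (\<Sum>i\<le>n. Suc i)"
    by (rule sum.reindex_bij_witness[of _ "\<lambda>i. n - i" "\<lambda>i. n - i"]) auto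
  finally have "card (exps n) = (\<Sum>i\<le>n. Suc i)" .
  moreover have "2 * (\<Sum>i\<le>n. Suc i) = (n + 1) * (n + 2)" by (induction n) auto
  ultimately show ?thesis by simp
qed

definition hcomp :: "nat \<Rightarrow> poly3 \<Rightarrow> poly3" where
  "hcomp n f = (\<Sum>(i, j, k)\<in>exps n. const3 (coeff3 f i j k) * mono3 i j k)"

lemma coeff3_hcomp: "coeff3 (hcomp n f) a b c = (if a + b + c = n then coeff3 f a b c else 0)"
proof -
  have "coeff3 (hcomp n f) a b c
      = (\<Sum>e\<in>exps n. if e = (a, b, c) then coeff3 f a b c else 0)"
    unfolding hcomp_def coeff3_sum by (intro sum.cong) (auto simp: coeff3_mono3 split: if_splits)
  also have "\<dots> = (if (a, b, c) \<in> exps n then coeff3 f a b c else 0)" by simp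
  finally show ?thesis by (simp add: exps_def)
qed

lemma hcomp_forms: "hcomp n f \<in> forms n"
  by (auto simp: forms_def homogeneous_def coeff3_hcomp split: if_splits)

lemma hcomp_id: "f \<in> forms n \<Longrightarrow> hcomp n f = f"
  by (rule poly3_eqI) (auto simp: coeff3_hcomp forms_def homogeneous_def)

lemma hcomp_add: "hcomp n (f + g) = hcomp n f + hcomp n g"
  by (rule poly3_eqI) (auto simp: coeff3_hcomp)

lemma forms_induct [consumes 1, case_names zero add mono]:
  assumes "f \<in> forms n" "P 0" "\<And>f g. P f \<Longrightarrow> P g \<Longrightarrow> P (f + g)"
    and "\<And>c i j k. i + j + k = n \<Longrightarrow> P (const3 c * mono3 i j k)"
  shows "P f"
proof -
  have "P (\<Sum>e\<in>A. case e of (i, j, k) \<Rightarrow> const3 (coeff3 f i j k) * mono3 i j k)"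
    if "finite A" "A \<subseteq> exps n" for A
    using that
  proof (induction A rule: finite_induct)
    case (insert e A)
    obtain i j k where e: "e = (i, j, k)" by (cases e)
    then have "P (const3 (coeff3 f i j k) * mono3 i j k)"
      using insert.prems assms(4) by (auto simp: exps_def)
    moreover have "P (\<Sum>e\<in>A. case e of (i, j, k) \<Rightarrow> const3 (coeff3 f i j k) * mono3 i j k)"
      using insert by simp
    ultimately show ?case using assms(3) by (simp only: sum.insert[OF insert.hyps]) (simp only: e split)
  qed (simp add: assms(2))
  from this[OF finite_exps order_refl] show ?thesis
    unfolding hcomp_def[symmetric] hcomp_id[OF assms(1)] .
qed

lemma forms_mult:
  assumes "f \<in> forms n" "g \<in> forms m"
  shows "f * g \<in> forms (n + m)"
  using assms(1)
proof (induction f rule: forms_induct)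
  case (mono c i j k)
  show ?case using assms(2)
  proof (induction g rule: forms_induct)
    case (mono c' i' j' k')
    have "const3 c * mono3 i j k * (const3 c' * mono3 i' j' k')
        = const3 (c * c') * mono3 (i + i') (j + j') (k + k')"
      by (simp add: mono3_mult[symmetric] mult_ac)
    also have "\<dots> \<in> forms (n + m)"
      using mono \<open>i + j + k = n\<close> by (intro forms_const_mult mono3_forms) auto
    finally show ?case .
  qed (auto simp: distrib_left intro: forms_add)
qed (auto simp: distrib_right intro: forms_add)

lemma forms_const: "const3 c \<in> forms 0"
  using forms_const_mult[OF mono3_forms[of 0 0 0 0], of c] by (simp add: mono3_def)

lemma forms_1: "1 \<in> forms 0"
  using forms_const[of 1] by simp

lemma forms_power: "f \<in> forms n \<Longrightarrow> f ^ k \<in> forms (k * n)"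
  by (induction k) (auto simp: forms_1 intro: forms_mult)

lemma forms_linear_power: "f \<in> forms 1 \<Longrightarrow> f ^ k \<in> forms k"
  using forms_power[of f 1 k] by simp

lemma X3_forms: "X3 \<in> forms 1" and Y3_forms: "Y3 \<in> forms 1" and Z3_forms: "Z3 \<in> forms 1"
  using mono3_forms[of 1 0 0 1] mono3_forms[of 0 1 0 1] mono3_forms[of 0 0 1 1]
  by (simp_all add: mono3_def)

lemma forms_prod:
  assumes "finite A" "\<And>a. a \<in> A \<Longrightarrow> F a \<in> forms (e a)"
  shows "prod F A \<in> forms (sum e A)"
  using assms by (induction A rule: finite_induct) (auto simp: forms_1 intro: forms_mult)

lemma forms_degree_unique: "f \<in> forms n \<Longrightarrow> f \<in> forms m \<Longrightarrow> f \<noteq> 0 \<Longrightarrow> n = m"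
  unfolding forms_def homogeneous_def using poly3_eqI[of f 0] by force

text \<open>Coefficients in a relation between forms can be replaced by their components of the
  right degree. This makes membership of a form in an ideal generated by forms homogeneous
  throughout.\<close>

lemma hcomp_mult:
  assumes "g \<in> forms e"
  shows "hcomp n (a * g) = (if e \<le> n then hcomp (n - e) a * g else 0)"
  using assms
proof (induction g rule: forms_induct)
  case zero
  then show ?case by (auto intro: poly3_eqI simp: coeff3_hcomp)
next
  case (mono c i j k)
  show ?case
  proof (induction a rule: poly3_mono3_induct)
    case (mono c' i' j' k')
    have eq: "const3 c' * mono3 i' j' k' * (const3 c * mono3 i j k)
        = const3 (c * c') * mono3 (i' + i) (j' + j) (k' + k)"
      by (simp add: mono3_mult[symmetric] mult_ac)
    have H: "hcomp n (const3 d * mono3 p q r) = (if p + q + r = n then const3 d * mono3 p q r else 0)"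
      for n d p q r
      by (rule poly3_eqI) (auto simp: coeff3_hcomp coeff3_mono3)
    show ?case using \<open>i + j + k = e\<close> unfolding eq H
      by (auto simp: mono3_mult[symmetric] mult_ac)
  qed (simp add: distrib_right hcomp_add)
qed (simp add: distrib_left hcomp_add)

lemma forms_span: "forms n = PS.span ((\<lambda>(i, j, k). mono3 i j k) ` exps n)"
proof (intro equalityI subsetI)
  fix f assume "f \<in> forms n"
  then show "f \<in> PS.span ((\<lambda>(i, j, k). mono3 i j k) ` exps n)"
  proof (induction f rule: forms_induct)
    case (mono c i j k)
    then show ?case unfolding scale3_def[symmetric]
      by (intro PS.span_scale PS.span_base) (force simp: exps_def)
  qed (auto intro: PS.span_zero PS.span_add)
next
  fix f assume "f \<in> PS.span ((\<lambda>(i, j, k). mono3 i j k) ` exps n)"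
  moreover have "(\<lambda>(i, j, k). mono3 i j k) ` exps n \<subseteq> forms n"
    by (auto simp: exps_def mono3_forms_iff)
  ultimately show "f \<in> forms n" using PS.span_minimal[OF _ forms_subspace] by blast
qed

lemma forms_fin_dim: "PS.fin_dim (forms n)"
  unfolding forms_span by (rule PS.fin_dim_span) simp

lemma dim_forms: "2 * PS.dim (forms n) = (n + 1) * (n + 2)"
proof -
  let ?m = "\<lambda>(i, j, k). mono3 i j k"
  have inj: "inj_on ?m (exps n)"
  proof (clarsimp simp: inj_on_def)
    fix i j k i' j' k' assume "mono3 i j k = mono3 i' j' k'"
    then have "coeff3 (mono3 i' j' k') i j k = 1" by (metis coeff3_mono3)
    then show "i = i' \<and> j = j' \<and> k = k'" by (simp add: coeff3_mono3 split: if_splits)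
  qed
  have "PS.independent (?m ` exps n)"
  proof (rule PS.independent_if_scalars_zero)
    fix f x assume 0: "(\<Sum>x\<in>?m ` exps n. scale3 (f x) x) = 0" and x: "x \<in> ?m ` exps n"
    then obtain i j k where ijk: "(i, j, k) \<in> exps n" "x = mono3 i j k" by auto
    have "0 = coeff3 (\<Sum>x\<in>?m ` exps n. scale3 (f x) x) i j k" by (simp add: 0)
    also have "\<dots> = (\<Sum>e\<in>exps n. if e = (i, j, k) then f (mono3 i j k) else 0)"
      unfolding sum.reindex[OF inj] coeff3_sum
      by (intro sum.cong) (auto simp: scale3_def coeff3_mono3 split: if_splits)
    also have "\<dots> = f x" using ijk by simp
    finally show "f x = 0" by simp
  qed simp
  then have "PS.dim (forms n) = card (?m ` exps n)"
    unfolding forms_span by (rule PS.dim_span_eq_card_independent)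
  then show ?thesis using card_exps[of n] card_image[OF inj] by simp
qed

section \<open>Evaluation and partial derivatives\<close>

definition ring_hom_on_UNIV :: "('a::comm_ring_1 \<Rightarrow> 'b::comm_ring_1) \<Rightarrow> bool" where
  "ring_hom_on_UNIV \<phi> \<longleftrightarrow> \<phi> 0 = 0 \<and> \<phi> 1 = 1 \<and> (\<forall>a b. \<phi> (a + b) = \<phi> a + \<phi> b) \<and>
     (\<forall>a b. \<phi> (a * b) = \<phi> a * \<phi> b)"

lemma ring_homD:
  assumes "ring_hom_on_UNIV \<phi>"
  shows "\<phi> 0 = 0" "\<phi> 1 = 1" "\<phi> (a + b) = \<phi> a + \<phi> b" "\<phi> (a * b) = \<phi> a * \<phi> b"
    "\<phi> (- a) = - \<phi> a" "\<phi> (a - b) = \<phi> a - \<phi> b" "\<phi> (a ^ n) = \<phi> a ^ n"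
proof -
  show h: "\<phi> 0 = 0" "\<phi> 1 = 1" "\<phi> (a + b) = \<phi> a + \<phi> b" "\<phi> (a * b) = \<phi> a * \<phi> b" for a b
    using assms by (auto simp: ring_hom_on_UNIV_def)
  show m: "\<phi> (- a) = - \<phi> a" for a
    using h(3)[of a "- a"] h(1) by (simp add: eq_neg_iff_add_eq_0 add.commute)
  show "\<phi> (a - b) = \<phi> a - \<phi> b" using h(3)[of a "- b"] m by simp
  show "\<phi> (a ^ n) = \<phi> a ^ n" by (induction n) (auto simp: h)
qed

lemma ring_hom_sum:
  assumes "ring_hom_on_UNIV \<phi>"
  shows "\<phi> (sum F A) = (\<Sum>a\<in>A. \<phi> (F a))"
  by (induction A rule: infinite_finite_induct) (auto simp: ring_homD[OF assms])

lemma map_poly_add: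
  assumes "\<phi> 0 = 0" "\<And>a b. \<phi> (a + b) = \<phi> a + \<phi> b"
  shows "map_poly \<phi> (p + q) = map_poly \<phi> p + map_poly \<phi> q"
  by (rule poly_eqI) (simp add: coeff_map_poly assms)

lemma additive_sum:
  assumes "\<phi> 0 = 0" "\<And>a b. \<phi> (a + b) = \<phi> a + (\<phi> b :: 'b::comm_monoid_add)"
  shows "\<phi> (sum F A) = (\<Sum>a\<in>A. \<phi> (F a))"
  by (induction A rule: infinite_finite_induct) (auto simp: assms)

lemma ring_hom_poly_map_poly:
  assumes "ring_hom_on_UNIV \<phi>"
  shows "ring_hom_on_UNIV (\<lambda>p. poly (map_poly \<phi> p) x)"
proof -
  note h = ring_homD[OF assms]
  have "map_poly \<phi> (p * q) = map_poly \<phi> p * map_poly \<phi> q" for p q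
    by (rule poly_eqI) (simp add: coeff_map_poly coeff_mult ring_hom_sum[OF assms] h)
  then show ?thesis
    by (simp add: ring_hom_on_UNIV_def h map_poly_add)
qed

lemma ring_hom_poly_map_poly_pCons:
  assumes "ring_hom_on_UNIV \<phi>"
  shows "poly (map_poly \<phi> [:c:]) x = \<phi> c" "poly (map_poly \<phi> [:0, 1:]) x = x"
  by (simp_all add: map_poly_pCons ring_homD[OF assms])

text \<open>One substitution serves twice: with complex numbers it is evaluation at a vector, with
  power series it is the passage to a local equation. In both cases it is determined by the images
  of constants and variables.\<close>

lemma subst3_hom:
  assumes "ring_hom_on_UNIV \<iota>"
  shows "ring_hom_on_UNIV (\<lambda>f. subst3 \<iota> f x y z)"
    and "subst3 \<iota> (const3 c) x y z = \<iota> c"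
    and "subst3 \<iota> X3 x y z = x" "subst3 \<iota> Y3 x y z = y" "subst3 \<iota> Z3 x y z = z"
proof -
  note 1 = ring_hom_poly_map_poly[OF assms, of x]
  note 2 = ring_hom_poly_map_poly[OF 1, of y]
  note 3 = ring_hom_poly_map_poly[OF 2, of z]
  note e = ring_hom_poly_map_poly_pCons
  show "ring_hom_on_UNIV (\<lambda>f. subst3 \<iota> f x y z)"
    using 3 by (simp add: subst3_def subst2_def)
  show "subst3 \<iota> (const3 c) x y z = \<iota> c" "subst3 \<iota> X3 x y z = x" "subst3 \<iota> Y3 x y z = y"
    "subst3 \<iota> Z3 x y z = z"
    unfolding subst3_def subst2_def const3_def X3_def Y3_def Z3_def
    by (simp_all only: e[OF assms] e[OF 1] e[OF 2])
qed

lemma ring_hom_id: "ring_hom_on_UNIV (\<lambda>c. c)"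
  by (simp add: ring_hom_on_UNIV_def)

lemma ring_hom_const2: "ring_hom_on_UNIV const2"
  by (auto simp: ring_hom_on_UNIV_def const2_def simp flip: fps_const_add fps_const_mult)

lemma eval3_hom: "ring_hom_on_UNIV (\<lambda>f. eval3 f v)"
  unfolding eval3_def by (rule subst3_hom(1)[OF ring_hom_id])

lemma eval3_simps [simp]:
  "eval3 0 v = 0" "eval3 1 v = 1" "eval3 (f + g) v = eval3 f v + eval3 g v"
  "eval3 (f * g) v = eval3 f v * eval3 g v" "eval3 (- f) v = - eval3 f v"
  "eval3 (f - g) v = eval3 f v - eval3 g v" "eval3 (f ^ n) v = eval3 f v ^ n"
  "eval3 (const3 c) v = c" "eval3 X3 v = v $ 1" "eval3 Y3 v = v $ 2" "eval3 Z3 v = v $ 3"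
  using ring_homD[OF eval3_hom] subst3_hom[OF ring_hom_id] by (auto simp: eval3_def)

lemma eval3_sum: "eval3 (sum F A) v = (\<Sum>a\<in>A. eval3 (F a) v)"
  by (rule ring_hom_sum[OF eval3_hom])

lemma eval3_prod: "eval3 (prod F A) v = (\<Prod>a\<in>A. eval3 (F a) v)"
  by (induction A rule: infinite_finite_induct) auto

lemma eval3_scale:
  assumes "f \<in> forms n"
  shows "eval3 f (c *s v) = c ^ n * eval3 f v"
  using assms
proof (induction f rule: forms_induct)
  case (mono d i j k)
  then show ?case by (auto simp: mono3_def power_mult_distrib power_add)
qed (auto simp: distrib_left)

definition is_derivation :: "('a::comm_ring_1 \<Rightarrow> 'a) \<Rightarrow> bool" where
  "is_derivation D \<longleftrightarrow> (\<forall>a b. D (a + b) = D a + D b) \<and> (\<forall>a b. D (a * b) = D a * b + a * D b)"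

lemma derivationD:
  assumes "is_derivation D"
  shows "D (a + b) = D a + D b" "D (a * b) = D a * b + a * D b" "D 0 = 0" "D 1 = 0"
  using assms unfolding is_derivation_def
  by (auto dest: spec[of _ 0]) (metis add_cancel_right_right mult.right_neutral mult_1)+

lemma derivation_map_poly:
  assumes "is_derivation D"
  shows "is_derivation (map_poly D)"
  unfolding is_derivation_def
proof (intro conjI allI poly_eqI)
  note d = derivationD[OF assms]
  fix p q :: "'a poly" and n
  show "coeff (map_poly D (p + q)) n = coeff (map_poly D p + map_poly D q) n"
    by (simp add: coeff_map_poly d)
  show "coeff (map_poly D (p * q)) n = coeff (map_poly D p * q + p * map_poly D q) n"
    by (simp add: coeff_map_poly coeff_mult d additive_sum[of D, OF d(3,1)] sum.distrib)
qed

lemma derivation_pderiv: "is_derivation (pderiv :: 'a::idom poly \<Rightarrow> _)"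
  by (simp add: is_derivation_def pderiv_add pderiv_mult algebra_simps)

abbreviation "dX \<equiv> map_poly (map_poly pderiv) :: poly3 \<Rightarrow> poly3"
abbreviation "dY \<equiv> map_poly pderiv :: poly3 \<Rightarrow> poly3"
abbreviation "dZ \<equiv> pderiv :: poly3 \<Rightarrow> poly3"

lemma derivation_partials: "is_derivation dX" "is_derivation dY" "is_derivation dZ"
  by (intro derivation_map_poly derivation_pderiv)+

lemma gradient_nth [simp]:
  "gradient f $ 1 = dX f" "gradient f $ 2 = dY f" "gradient f $ 3 = dZ f"
  by (simp_all add: gradient_def)

lemma partials_simps [simp]:
  "dX (const3 c) = 0" "dX X3 = 1" "dX Y3 = 0" "dX Z3 = 0"
  "dY (const3 c) = 0" "dY X3 = 0" "dY Y3 = 1" "dY Z3 = 0"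
  "dZ (const3 c) = 0" "dZ X3 = 0" "dZ Y3 = 0" "dZ Z3 = 1"
  by (simp_all add: const3_def X3_def Y3_def Z3_def map_poly_pCons pderiv_pCons one_pCons)

text \<open>The chain rule: both sides agree on constants and variables and obey the same product
  rule. It is applied with \<open>D\<close> a partial derivative of power series and \<theta> a
  dehomogenisation.\<close>

lemma derivation_comp_poly3:
  assumes "is_derivation D" "ring_hom_on_UNIV \<theta>" "\<And>c. D (\<theta> (const3 c)) = 0"
  shows "D (\<theta> f) = \<theta> (dX f) * D (\<theta> X3) + \<theta> (dY f) * D (\<theta> Y3) + \<theta> (dZ f) * D (\<theta> Z3)"
proof (induction f rule: poly3_induct)
  case (const c)
  then show ?case by (simp add: assms(3) ring_homD[OF assms(2)])
qed (simp_all add: ring_homD[OF assms(2)] derivationD[OF assms(1)] derivationD[OF derivation_partials(1)]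
    derivationD[OF derivation_partials(2)] derivationD[OF derivation_partials(3)] algebra_simps)

text \<open>For \<open>n = 0\<close> the truncated \<open>n - 1\<close> is harmless, because the
  partial derivatives vanish.\<close>

lemma partials_forms:
  assumes "f \<in> forms n"
  shows "dX f \<in> forms (n - 1)" "dY f \<in> forms (n - 1)" "dZ f \<in> forms (n - 1)"
  using assms
  by (force simp: forms_def homogeneous_def coeff3_def coeff_map_poly coeff_pderiv of_nat_poly
      simp del: of_nat_Suc)+

lemma euler_identity:
  assumes "f \<in> forms n"
  shows "X3 * dX f + Y3 * dY f + Z3 * dZ f = of_nat n * f"
  using assms
proof (induction f rule: forms_induct)
  case (mono c i j k)
  \<comment> \<open>The Euler operator is a derivation fixing each variable, so a monomial of degree
    \<open>n\<close> is an eigenvector with eigenvalue \<open>n\<close>.\<close>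
  define E where "E = (\<lambda>f. X3 * dX f + Y3 * dY f + Z3 * dZ f)"
  have E: "is_derivation E"
    using derivation_partials by (simp add: E_def is_derivation_def algebra_simps)
  have pow: "E (a ^ r) = of_nat r * a ^ r" if "E a = a" for a r
    by (induction r) (simp_all add: derivationD[OF E] that algebra_simps)
  have "E X3 = X3" "E Y3 = Y3" "E Z3 = Z3" "E (const3 c) = 0" by (simp_all add: E_def)
  then have "E (const3 c * mono3 i j k) = (of_nat i + of_nat j + of_nat k) * (const3 c * mono3 i j k)"
    by (simp add: derivationD[OF E] pow mono3_def algebra_simps)
  then show ?case using mono by (simp add: E_def flip: of_nat_add)
next
  case (add f g)
  have "X3 * dX (f + g) + Y3 * dY (f + g) + Z3 * dZ (f + g)
      = (X3 * dX f + Y3 * dY f + Z3 * dZ f) + (X3 * dX g + Y3 * dY g + Z3 * dZ g)"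
    by (simp add: derivationD(1)[OF derivation_partials(1)] derivationD(1)[OF derivation_partials(2)]
      derivationD(1)[OF derivation_partials(3)] algebra_simps)
  then show ?case unfolding add distrib_left .
qed simp

section \<open>Ideals and saturation\<close>

interpretation PP: vec_space_pair scale3 scale3 ..

lemma linear_mult: "Vector_Spaces.linear scale3 scale3 (\<lambda>g. w * g)"
  by (simp add: Vector_Spaces.linear_iff PS.vector_space_axioms scale3_def algebra_simps)

definition is_ideal :: "poly3 set \<Rightarrow> bool" where
  "is_ideal K \<longleftrightarrow> 0 \<in> K \<and> (\<forall>f\<in>K. \<forall>g\<in>K. f + g \<in> K) \<and> (\<forall>f\<in>K. \<forall>a. a * f \<in> K)"

lemma idealD:
  assumes "is_ideal K"
  shows "0 \<in> K" "f \<in> K \<Longrightarrow> g \<in> K \<Longrightarrow> f + g \<in> K" "f \<in> K \<Longrightarrow> a * f \<in> K" "f \<in> K \<Longrightarrow> f * a \<in> K"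
    "f \<in> K \<Longrightarrow> - f \<in> K" "f \<in> K \<Longrightarrow> g \<in> K \<Longrightarrow> f - g \<in> K"
proof -
  show h: "0 \<in> K" "f \<in> K \<Longrightarrow> g \<in> K \<Longrightarrow> f + g \<in> K" "f \<in> K \<Longrightarrow> a * f \<in> K" for f g a
    using assms by (auto simp: is_ideal_def)
  then show "f \<in> K \<Longrightarrow> f * a \<in> K" by (metis mult.commute)
  show m: "f \<in> K \<Longrightarrow> - f \<in> K" for f using h(3)[of f "-1"] by simp
  show "f \<in> K \<Longrightarrow> g \<in> K \<Longrightarrow> f - g \<in> K" using h(2)[of f "- g"] m by simp
qed

lemma ideal_subspace: "is_ideal K \<Longrightarrow> PS.subspace K"
  by (auto simp: PS.subspace_def scale3_def idealD)

lemma ideal_sum: "is_ideal K \<Longrightarrow> (\<And>a. a \<in> A \<Longrightarrow> F a \<in> K) \<Longrightarrow> sum F A \<in> K"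
  using PS.subspace_sum[OF ideal_subspace] by blast

text \<open>For an ideal \<open>K\<close>, the preimage of its extension after inverting
  \<open>w\<close>. Modulo it multiplication by \<open>w\<close> is injective, so quotients such as
  \<open>u / w\<close> can act without leaving the polynomial ring.\<close>

definition saturation :: "poly3 \<Rightarrow> poly3 set \<Rightarrow> poly3 set" where
  "saturation w K = {f. \<exists>j. w ^ j * f \<in> K}"

lemma saturation_superset: "K \<subseteq> saturation w K"
  by (auto simp: saturation_def intro: exI[of _ 0])

lemma saturation_cancel: "w * f \<in> saturation w K \<Longrightarrow> f \<in> saturation w K"
  unfolding saturation_def by (auto simp: mult.assoc[symmetric] power_Suc2[symmetric] simp del: power_Suc)

lemma saturation_cancel_power: "w ^ j * f \<in> saturation w K \<Longrightarrow> f \<in> saturation w K"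
  by (induction j) (auto simp: mult.assoc dest: saturation_cancel)

lemma saturation_ideal:
  assumes "is_ideal K"
  shows "is_ideal (saturation w K)"
  unfolding is_ideal_def
proof (intro conjI ballI allI)
  note i = idealD[OF assms]
  show "0 \<in> saturation w K" using i(1) saturation_superset by blast
  fix f assume "f \<in> saturation w K"
  then obtain j where j: "w ^ j * f \<in> K" by (auto simp: saturation_def)
  show "a * f \<in> saturation w K" for a
    using i(3)[OF j, of a] by (auto simp: saturation_def mult_ac)
  fix g assume "g \<in> saturation w K"
  then obtain k where k: "w ^ k * g \<in> K" by (auto simp: saturation_def)
  have "w ^ (j + k) * (f + g) = w ^ k * (w ^ j * f) + w ^ j * (w ^ k * g)"
    by (simp add: power_add algebra_simps)
  also have "\<dots> \<in> K" by (rule i(2)[OF i(3)[OF j] i(3)[OF k]])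
  finally show "f + g \<in> saturation w K" by (auto simp: saturation_def)
qed

text \<open>For \<open>degree \<rho> \<le> e\<close> this is \<open>w ^ e\<close> times the value of
  \<rho> at \<open>u / w\<close>: the polynomial \<rho> of the operator \<open>u / w\<close>,
  cleared of denominators.\<close>

definition homog :: "complex poly \<Rightarrow> poly3 \<Rightarrow> poly3 \<Rightarrow> nat \<Rightarrow> poly3" where
  "homog \<rho> u w e = (\<Sum>i\<le>e. const3 (coeff \<rho> i) * (u ^ i * w ^ (e - i)))"

lemma homog_forms:
  assumes "u \<in> forms 1" "w \<in> forms 1"
  shows "homog \<rho> u w e \<in> forms e"
  unfolding homog_def
proof (intro forms_sum forms_const_mult)
  fix i assume "i \<in> {..e}"
  then show "u ^ i * w ^ (e - i) \<in> forms e"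
    using forms_mult[OF forms_linear_power[OF assms(1)] forms_linear_power[OF assms(2)], of i "e - i"]
    by simp
qed

lemma homog_Suc:
  assumes "degree \<rho> \<le> e"
  shows "homog \<rho> u w (Suc e) = w * homog \<rho> u w e"
proof -
  have "homog \<rho> u w (Suc e) = (\<Sum>i\<le>e. const3 (coeff \<rho> i) * (u ^ i * w ^ (Suc e - i)))"
    using assms by (simp add: homog_def coeff_eq_0)
  also have "\<dots> = w * homog \<rho> u w e"
    unfolding homog_def sum_distrib_left by (intro sum.cong) (auto simp: Suc_diff_le mult_ac)
  finally show ?thesis .
qed

lemma homog_root_factor:
  assumes "degree \<rho> \<le> e"
  shows "homog ([:- c, 1:] * \<rho>) u w (Suc e) = (u - const3 c * w) * homog \<rho> u w e"
proof -
  have "homog ([:- c, 1:] * \<rho>) u w (Suc e)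
      = homog (pCons 0 \<rho>) u w (Suc e) - const3 c * homog \<rho> u w (Suc e)"
    unfolding homog_def sum_distrib_left sum_subtractf[symmetric]
    by (intro sum.cong) (auto simp: algebra_simps)
  also have "homog (pCons 0 \<rho>) u w (Suc e) = u * homog \<rho> u w e"
    unfolding homog_def sum.atMost_Suc_shift sum_distrib_left by (simp add: mult_ac)
  finally show ?thesis using homog_Suc[OF assms] by (simp add: algebra_simps)
qed

text \<open>An annihilating polynomial of \<open>u / w\<close>: the \<open>D + 1\<close> forms
  \<open>w ^ N * (u ^ i * w ^ (D - i))\<close> are dependent modulo \<open>K\<close>, and a relation
  between them has the coefficients of \<rho>. The factor \<open>w ^ N\<close> reaches the degree
  where the codimension is known and is then absorbed by the saturation.\<close>

lemma homog_in_saturation: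
  assumes "is_ideal K" "u \<in> forms 1" "w \<in> forms 1"
    and "PS.dim (forms (N + D)) \<le> PS.dim (K \<inter> forms (N + D)) + D"
  shows "\<exists>\<rho>. \<rho> \<noteq> 0 \<and> degree \<rho> \<le> D \<and> homog \<rho> u w D \<in> saturation w K"
proof -
  let ?v = "\<lambda>i. w ^ N * (u ^ i * w ^ (D - i))"
  have v: "?v i \<in> forms (N + D)" if "i \<le> D" for i
    using forms_mult[OF forms_linear_power[OF assms(3), of N]
        forms_mult[OF forms_linear_power[OF assms(2), of i] forms_linear_power[OF assms(3), of "D - i"]]] that
    by simp
  obtain c where c: "\<exists>i\<le>D. c i \<noteq> 0" "(\<Sum>i\<le>D. scale3 (c i) (?v i)) \<in> K \<inter> forms (N + D)"
    using PS.dependent_modulo[OF PS.subspace_inter[OF ideal_subspace[OF assms(1)] forms_subspace]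
        forms_subspace forms_fin_dim _ assms(4), of ?v] v by blast
  define \<rho> where "\<rho> = (\<Sum>i\<le>D. monom (c i) i)"
  have coeff: "coeff \<rho> i = (if i \<le> D then c i else 0)" for i
    by (simp add: \<rho>_def coeff_sum)
  have "w ^ N * homog \<rho> u w D = (\<Sum>i\<le>D. scale3 (c i) (?v i))"
    unfolding homog_def sum_distrib_left by (intro sum.cong) (auto simp: coeff scale3_def mult_ac)
  then have "homog \<rho> u w D \<in> saturation w K" using c(2) unfolding saturation_def by (metis (mono_tags, lifting) IntD1 mem_Collect_eq)
  moreover have "\<rho> \<noteq> 0" using c(1) coeff by (metis coeff_0)
  moreover have "degree \<rho> \<le> D" by (rule degree_le) (auto simp: coeff)
  ultimately show ?thesis by blast
qed

text \<open>The usual construction of an eigenvector: \<rho> splits over the complex numbers, and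
  its linear factors are removed one at a time; the last product that does not kill \<open>g\<close>
  modulo \<open>T\<close> yields the eigenvector. When \<open>e\<close> exceeds the degree of
  \<rho>, the surplus factor \<open>w\<close> is cancelled.\<close>

lemma eigenvalue_step:
  assumes T: "is_ideal T" and cancel: "\<And>f. w * f \<in> T \<Longrightarrow> f \<in> T" and g: "g \<notin> T"
    and "\<rho> \<noteq> 0" "degree \<rho> \<le> e" "homog \<rho> u w e * g \<in> T"
  shows "\<exists>c G. G * g \<notin> T \<and> (u - const3 c * w) * (G * g) \<in> T"
  using assms(4-)
proof (induction e arbitrary: \<rho>)
  case 0
  then have "degree \<rho> = 0" by simp
  then obtain c where "\<rho> = [:c:]" by (rule degree_eq_zeroE)
  then have "\<rho> = [:c:]" "c \<noteq> 0" using 0 by auto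
  then have "const3 c * g \<in> T" using 0 by (simp add: homog_def)
  then have "const3 (inverse c) * (const3 c * g) \<in> T" by (rule idealD(3)[OF T])
  moreover have "const3 (inverse c) * (const3 c * g) = g"
    using \<open>c \<noteq> 0\<close> by (simp flip: mult.assoc const3_simps(4))
  ultimately show ?case using g by simp
next
  case (Suc e)
  show ?case
  proof (cases "degree \<rho> \<le> e")
    case True
    then have "homog \<rho> u w e * g \<in> T"
      using Suc.prems(3) cancel[of "homog \<rho> u w e * g"] unfolding homog_Suc[OF True] by (simp add: mult.assoc)
    then show ?thesis using Suc True by blast
  next
    case False
    then have "\<not> constant (poly \<rho>)" using False by (simp add: constant_degree)
    then obtain c where "poly \<rho> c = 0" using fundamental_theorem_of_algebra by blast
    then obtain \<psi> where \<psi>: "\<rho> = [:- c, 1:] * \<psi>" using poly_eq_0_iff_dvd by (metis dvdE)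
    have \<psi>0: "\<psi> \<noteq> 0" using Suc.prems \<psi> by auto
    then have deg: "degree \<psi> \<le> e" using Suc.prems(2) unfolding \<psi> by (subst (asm) degree_mult_eq) auto
    have eq: "homog \<rho> u w (Suc e) * g = (u - const3 c * w) * (homog \<psi> u w e * g)"
      unfolding \<psi> homog_root_factor[OF deg] by (simp add: mult.assoc)
    show ?thesis
    proof (cases "homog \<psi> u w e * g \<in> T")
      case True
      then show ?thesis using Suc.IH \<psi>0 deg by blast
    next
      case False
      then show ?thesis using Suc.prems(3) eq by metis
    qed
  qed
qed

lemma ideal_diff_mult:
  assumes "is_ideal I" "a - a' \<in> I" "b - b' \<in> I"
  shows "a * b - a' * b' \<in> I"
proof -
  have "a * b - a' * b' = (a - a') * b + a' * (b - b')" by (simp add: algebra_simps)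
  then show ?thesis using idealD(2)[OF assms(1) idealD(4)[OF assms(1,2)] idealD(3)[OF assms(1,3)]] by (simp only:)
qed

lemma ideal_diff_power:
  assumes "is_ideal I" "a - a' \<in> I"
  shows "a ^ n - a' ^ n \<in> I"
  by (induction n) (use assms in \<open>auto simp: idealD(1) intro: ideal_diff_mult\<close>)

text \<open>Modulo \<open>I\<close> the variables are multiples of \<open>w\<close> by the
  coordinates of \<open>p\<close>, so a form is its value at \<open>p\<close> times a power of
  \<open>w\<close>.\<close>

lemma forms_mod_point_ideal:
  fixes p :: "complex^3"
  assumes I: "is_ideal I" and "F \<in> forms n"
    and p: "X3 - const3 (p $ 1) * w \<in> I" "Y3 - const3 (p $ 2) * w \<in> I" "Z3 - const3 (p $ 3) * w \<in> I"
  shows "F - const3 (eval3 F p) * w ^ n \<in> I"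
  using assms(2)
proof (induction F rule: forms_induct)
  case zero
  then show ?case using idealD(1)[OF I] by simp
next
  case (add f g)
  have "f + g - const3 (eval3 (f + g) p) * w ^ n
      = (f - const3 (eval3 f p) * w ^ n) + (g - const3 (eval3 g p) * w ^ n)"
    by (simp add: algebra_simps)
  then show ?case using idealD(2)[OF I add] by (simp only:)
next
  case (mono c i j k)
  have "const3 c * mono3 i j k - const3 c * ((const3 (p $ 1) * w) ^ i * (const3 (p $ 2) * w) ^ j * (const3 (p $ 3) * w) ^ k) \<in> I"
    unfolding mono3_def
    by (intro ideal_diff_mult ideal_diff_power p I) (simp add: idealD(1)[OF I])
  also have "const3 c * ((const3 (p $ 1) * w) ^ i * (const3 (p $ 2) * w) ^ j * (const3 (p $ 3) * w) ^ k)
      = const3 (eval3 (const3 c * mono3 i j k) p) * w ^ n"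
    using mono by (auto simp: mono3_def power_mult_distrib power_add mult_ac)
  finally show ?case .
qed

lemma colon_ideal: "is_ideal T \<Longrightarrow> is_ideal {f. f * h \<in> T}"
  by (auto simp: is_ideal_def distrib_right mult.assoc)

text \<open>The multiplications by linear forms, divided by \<open>w\<close>, are commuting operators on the
  finite-dimensional graded pieces of large degree; \<open>p\<close> is read off a common eigenvector.\<close>

lemma common_zero:
  assumes K: "is_ideal K" and w: "w \<in> forms 1"
    and dim: "PS.dim (forms (N + D)) \<le> PS.dim (K \<inter> forms (N + D)) + D"
    and g: "g \<notin> saturation w K"
  shows "\<exists>p. eval3 w p = 1 \<and> (\<forall>n. \<forall>F\<in>forms n. F * g \<in> saturation w K \<longrightarrow> eval3 F p = 0)"
proof -
  let ?T = "saturation w K"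
  note T = saturation_ideal[OF K, of w]
  have step: "\<exists>c G. G * h \<notin> ?T \<and> (u - const3 c * w) * (G * h) \<in> ?T" if h: "h \<notin> ?T" and u: "u \<in> forms 1" for h u
  proof -
    obtain \<rho> where \<rho>: "\<rho> \<noteq> 0" "degree \<rho> \<le> D" "homog \<rho> u w D \<in> ?T"
      using homog_in_saturation[OF K u w dim] by blast
    show ?thesis
      by (rule eigenvalue_step[OF T saturation_cancel h \<rho>(1,2) idealD(4)[OF T \<rho>(3)]])
  qed
  \<comment> \<open>The operators commute, so multiplying by further polynomials preserves the
    eigenvector relations already found.\<close>
  obtain a G1 where 1: "G1 * g \<notin> ?T" "(X3 - const3 a * w) * (G1 * g) \<in> ?T"
    using step[OF g X3_forms] by blast
  obtain b G2 where 2: "G2 * (G1 * g) \<notin> ?T" "(Y3 - const3 b * w) * (G2 * (G1 * g)) \<in> ?T"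
    using step[OF 1(1) Y3_forms] by blast
  obtain c G3 where 3: "G3 * (G2 * (G1 * g)) \<notin> ?T" "(Z3 - const3 c * w) * (G3 * (G2 * (G1 * g))) \<in> ?T"
    using step[OF 2(1) Z3_forms] by blast
  define h where "h = G3 * (G2 * (G1 * g))"
  define I where "I = {f. f * h \<in> ?T}"
  have I: "is_ideal I" unfolding I_def by (rule colon_ideal[OF T])
  define p :: "complex^3" where "p = vector [a, b, c]"
  have "X3 - const3 (p $ 1) * w \<in> I"
    using idealD(3)[OF T 1(2), of "G3 * G2"] by (simp add: I_def p_def h_def mult_ac)
  moreover have "Y3 - const3 (p $ 2) * w \<in> I"
    using idealD(3)[OF T 2(2), of "G3"] by (simp add: I_def p_def h_def mult_ac)
  moreover have "Z3 - const3 (p $ 3) * w \<in> I"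
    using 3(2) by (simp add: I_def p_def h_def mult_ac)
  ultimately have cong: "F - const3 (eval3 F p) * w ^ n \<in> I" if "F \<in> forms n" for F n
    using forms_mod_point_ideal[OF I that] by blast
  \<comment> \<open>No power of \<open>w\<close> kills \<open>h\<close> modulo the saturation, so
    scalars can be read off modulo \<open>I\<close>.\<close>
  have unit: "c = 0" if "const3 c * w ^ n \<in> I" for c n
  proof (rule ccontr)
    assume "c \<noteq> 0"
    then have "w ^ n = const3 (inverse c) * (const3 c * w ^ n)"
      by (simp flip: mult.assoc const3_simps(4))
    then have "w ^ n \<in> I" using idealD(3)[OF I that, of "const3 (inverse c)"] by metis
    then have "h \<in> ?T" using saturation_cancel_power by (simp add: I_def)
    then show False using 3(1) by (simp add: h_def)
  qed
  have "const3 (1 - eval3 w p) * w ^ 1 \<in> I" using cong[OF w] by (simp add: algebra_simps)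
  then have "eval3 w p = 1" using unit by fastforce
  moreover have "eval3 F p = 0" if "F \<in> forms n" "F * g \<in> ?T" for F n
  proof -
    have "F * h \<in> ?T" using idealD(3)[OF T that(2), of "G3 * G2 * G1"] by (simp add: h_def mult_ac)
    then have "F \<in> I" by (simp add: I_def)
    from idealD(6)[OF I this cong[OF that(1)]] show ?thesis using unit by simp
  qed
  ultimately show ?thesis by blast
qed

section \<open>Multiplication by a linear form in large degrees\<close>

lemma eventually_constant_decreasing:
  fixes h :: "nat \<Rightarrow> nat"
  assumes "\<And>n. n \<ge> N0 \<Longrightarrow> h (Suc n) \<le> h n"
  shows "\<exists>N\<ge>N0. \<exists>D. \<forall>n\<ge>N. h n = D"
proof -
  define D where "D = (LEAST d. \<exists>n\<ge>N0. h n = d)"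
  have "\<exists>n\<ge>N0. h n = D" unfolding D_def by (rule LeastI[of _ "h N0"]) auto
  then obtain N where N: "N \<ge> N0" "h N = D" by blast
  have "h n = D" if "n \<ge> N" for n
  proof (rule antisym)
    show "h n \<le> D" using that
    proof (induction n rule: dec_induct)
      case (step n)
      then show ?case using assms[of n] N(1) by simp
    qed (simp add: N)
    show "D \<le> h n" unfolding D_def using that N(1) by (intro Least_le exI[of _ n]) auto
  qed
  then show ?thesis using N by blast
qed

lemma Int_forms_subspace: "is_ideal K \<Longrightarrow> PS.subspace (K \<inter> forms n)"
  by (intro PS.subspace_inter ideal_subspace forms_subspace)

text \<open>Surjectivity of multiplication by \<open>w\<close> between consecutive graded pieces of
  the quotient makes their dimensions weakly decreasing, hence eventually constant; from then on the
  surjections are injective.\<close>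

lemma codim_eventually_constant:
  assumes K: "is_ideal K" and w: "w \<in> forms 1" "w \<noteq> 0"
    and surj: "\<And>n F. n \<ge> N0 \<Longrightarrow> F \<in> forms (Suc n) \<Longrightarrow> \<exists>g\<in>forms n. F - w * g \<in> K"
  shows "\<exists>N D. \<forall>n\<ge>N. PS.dim (forms n) = PS.dim (K \<inter> forms n) + D \<and> (\<forall>g\<in>forms n. w * g \<in> K \<longrightarrow> g \<in> K)"
proof -
  define C where "C = (\<lambda>n. {g \<in> forms n. w * g \<in> K})"
  have subC: "PS.subspace (C n)" for n
    using idealD(1,2)[OF K] idealD(3)[OF K, of "w * _"]
    by (auto simp: C_def PS.subspace_def scale3_def distrib_left mult.left_commute[of w]
        intro: forms_add forms_const_mult)
  have finC: "PS.fin_dim (C n)" and finK: "PS.fin_dim (K \<inter> forms n)" for n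
    by (auto intro: PS.fin_dim_subset[OF forms_fin_dim[of n]] simp: C_def)
  have KC: "K \<inter> forms n \<subseteq> C n" for n using idealD(3)[OF K] by (auto simp: C_def)
  have leK: "PS.dim (K \<inter> forms n) \<le> PS.dim (forms n)" for n
    by (rule PS.dim_mono_fin_dim[OF forms_fin_dim]) auto
  have wf: "w * g \<in> forms (Suc n)" if "g \<in> forms n" for g n
    using forms_mult[OF w(1) that] by simp
  \<comment> \<open>Rank and nullity of multiplication by \<open>w\<close> on the quotient, written
    without quotients: \<open>C n\<close> modulo \<open>K\<close> is the kernel, and surjectivity
    says that \<open>K\<close> and the multiples of \<open>w\<close> together give all of the next
    degree.\<close>
  have rec: "PS.dim (forms (Suc n)) + PS.dim (C n) = PS.dim (K \<inter> forms (Suc n)) + PS.dim (forms n)"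
    if n: "n \<ge> N0" for n
  proof -
    let ?W = "(\<lambda>g. w * g) ` forms n"
    have dW: "PS.dim ?W = PS.dim (forms n)"
      using w(2) by (intro PP.dim_image_inj_on linear_mult forms_subspace forms_fin_dim) auto
    have "PS.dim ((\<lambda>g. w * g) ` C n) = PS.dim (C n)"
      using w(2) by (intro PP.dim_image_inj_on linear_mult subC finC) auto
    moreover have "(\<lambda>g. w * g) ` C n = (K \<inter> forms (Suc n)) \<inter> ?W"
      using wf by (auto simp: C_def)
    moreover have "{x + y |x y. x \<in> K \<inter> forms (Suc n) \<and> y \<in> ?W} = forms (Suc n)"
    proof (intro equalityI subsetI)
      fix F assume F: "F \<in> forms (Suc n)"
      then obtain g where g: "g \<in> forms n" "F - w * g \<in> K" using surj[OF n F] by blast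
      then have "F - w * g \<in> K \<inter> forms (Suc n)" using F wf forms_diff by blast
      moreover have "F = (F - w * g) + w * g" by simp
      ultimately show "F \<in> {x + y |x y. x \<in> K \<inter> forms (Suc n) \<and> y \<in> ?W}" using g(1) by blast
    qed (use wf forms_add in auto)
    moreover have "PS.subspace ?W" by (rule PP.linear_subspace_image[OF linear_mult forms_subspace])
    moreover have "PS.fin_dim ?W" by (rule PS.fin_dim_subset[OF forms_fin_dim[of "Suc n"]]) (use wf in auto)
    ultimately show ?thesis
      using PS.dim_sum_Int[OF Int_forms_subspace[OF K] _ finK, of ?W "Suc n"] dW by simp
  qed
  define h where "h = (\<lambda>n. PS.dim (forms n) - PS.dim (K \<inter> forms n))"
  have "h (Suc n) \<le> h n" if "n \<ge> N0" for n
    using rec[OF that] PS.dim_mono_fin_dim[OF finC KC, of n] leK[of n] leK[of "Suc n"] by (simp add: h_def)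
  then obtain N D where N: "N \<ge> N0" "\<And>n. n \<ge> N \<Longrightarrow> h n = D"
    using eventually_constant_decreasing by metis
  have "PS.dim (forms n) = PS.dim (K \<inter> forms n) + D \<and> (\<forall>g\<in>forms n. w * g \<in> K \<longrightarrow> g \<in> K)"
    if "n \<ge> N" for n
  proof
    show "PS.dim (forms n) = PS.dim (K \<inter> forms n) + D" using N(2)[OF that] leK[of n] by (simp add: h_def)
    have "PS.dim (C n) \<le> PS.dim (K \<inter> forms n)"
      using rec[of n] N(1) N(2)[OF that] N(2)[of "Suc n"] that leK[of n] leK[of "Suc n"] by (simp add: h_def)
    then have "K \<inter> forms n = C n"
      using PS.subspace_eq_fin_dim[OF Int_forms_subspace[OF K] subC finC KC] by blast
    then show "\<forall>g\<in>forms n. w * g \<in> K \<longrightarrow> g \<in> K" by (auto simp: C_def)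
  qed
  then show ?thesis by blast
qed

definition hom_ideal :: "poly3 set \<Rightarrow> bool" where
  "hom_ideal J \<longleftrightarrow> is_ideal J \<and> (\<forall>f\<in>J. \<forall>n. hcomp n f \<in> J)"

text \<open>On the line \<open>l = 0\<close> the eigenvector argument is applied with \<open>Z3\<close> as the multiplier; \<open>q\<close> is the
  point where \<open>l\<close> and \<open>Z3\<close> both vanish.\<close>

lemma hyperplane_surjective:
  assumes J: "hom_ideal J" and l: "l = X3 + const3 t * Y3 + const3 s * Z3"
    and zeros: "\<And>v. v \<noteq> 0 \<Longrightarrow> \<forall>n. \<forall>F\<in>J \<inter> forms n. eval3 F v = 0 \<Longrightarrow> eval3 l v \<noteq> 0"
  shows "\<exists>N. \<forall>n\<ge>N. \<forall>F\<in>forms (Suc n). \<exists>g\<in>forms n. F - l * g \<in> J"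
proof -
  have Ji: "is_ideal J" using J by (simp add: hom_ideal_def)
  have lf: "l \<in> forms 1" unfolding l
    by (intro forms_add forms_const_mult X3_forms Y3_forms Z3_forms)
  define K where "K = {a + l * b |a b. a \<in> J}"
  have JK: "J \<subseteq> K"
  proof
    fix a assume "a \<in> J"
    then show "a \<in> K" unfolding K_def by (intro CollectI exI[of _ a] exI[of _ 0]) simp
  qed
  have lK: "l * b \<in> K" for b
    unfolding K_def using idealD(1)[OF Ji] by (intro CollectI exI[of _ 0] exI[of _ b]) simp
  have K: "is_ideal K"
    unfolding is_ideal_def
  proof (intro conjI ballI allI)
    show "0 \<in> K" using JK idealD(1)[OF Ji] by blast
    fix f assume "f \<in> K"
    then obtain a b where f: "f = a + l * b" "a \<in> J" by (auto simp: K_def)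
    show "c * f \<in> K" for c
      unfolding K_def using f idealD(3)[OF Ji]
      by (intro CollectI exI[of _ "c * a"] exI[of _ "c * b"]) (simp add: algebra_simps)
    fix g assume "g \<in> K"
    then obtain a' b' where g: "g = a' + l * b'" "a' \<in> J" by (auto simp: K_def)
    show "f + g \<in> K"
      unfolding K_def using f g idealD(2)[OF Ji]
      by (intro CollectI exI[of _ "a + a'"] exI[of _ "b + b'"]) (simp add: algebra_simps)
  qed
  have Kh: "hcomp n f \<in> K" if fK: "f \<in> K" for n f
  proof -
    obtain a b where f: "f = a + b * l" "a \<in> J" using fK by (auto simp: K_def mult.commute)
    have "hcomp n a \<in> K" using J f(2) JK by (auto simp: hom_ideal_def)
    moreover have "hcomp n (b * l) \<in> K"
      unfolding hcomp_mult[OF lf] using lK[of "hcomp (n - 1) b"] idealD(1)[OF K] by (simp add: mult.commute)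
    ultimately show ?thesis unfolding f(1) hcomp_add using idealD(2)[OF K] by blast
  qed
  define q :: "complex^3" where "q = vector [- t, 1, 0]"
  have "q $ 2 = 1" by (simp add: q_def)
  then have "q \<noteq> 0" by auto
  moreover have "eval3 l q = 0" by (simp add: l q_def)
  ultimately obtain n0 F0 where F0: "F0 \<in> J" "F0 \<in> forms n0" "eval3 F0 q \<noteq> 0"
    using zeros[of q] by blast
  \<comment> \<open>Modulo \<open>K\<close> and \<open>Z3\<close> every form is a multiple of a
    power of \<open>Y3\<close>. The form \<open>F0\<close> of \<open>J\<close>, nonzero at
    \<open>q\<close>, puts \<open>Y3 ^ n0\<close> into this ideal, and with it every form of degree
    at least \<open>n0\<close>.\<close>
  have surjZ: "\<exists>g\<in>forms n. F - Z3 * g \<in> K" if "n \<ge> n0" "F \<in> forms (Suc n)" for n F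
  proof -
    define I where "I = {a + Z3 * b |a b. a \<in> K}"
    have I: "is_ideal I"
      unfolding is_ideal_def
    proof (intro conjI ballI allI)
      show "0 \<in> I" unfolding I_def using idealD(1)[OF K] by (intro CollectI exI[of _ 0]) simp
      fix f assume "f \<in> I"
      then obtain a b where f: "f = a + Z3 * b" "a \<in> K" by (auto simp: I_def)
      show "c * f \<in> I" for c
        unfolding I_def using f idealD(3)[OF K]
        by (intro CollectI exI[of _ "c * a"] exI[of _ "c * b"]) (simp add: algebra_simps)
      fix g assume "g \<in> I"
      then obtain a' b' where g: "g = a' + Z3 * b'" "a' \<in> K" by (auto simp: I_def)
      show "f + g \<in> I"
        unfolding I_def using f g idealD(2)[OF K]
        by (intro CollectI exI[of _ "a + a'"] exI[of _ "b + b'"]) (simp add: algebra_simps)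
    qed
    have KI: "K \<subseteq> I"
    proof
      fix a assume "a \<in> K"
      then show "a \<in> I" unfolding I_def by (intro CollectI exI[of _ a] exI[of _ 0]) simp
    qed
    have ZI: "Z3 * b \<in> I" for b
      unfolding I_def using idealD(1)[OF K] by (intro CollectI exI[of _ 0] exI[of _ b]) simp
    have "X3 - const3 (q $ 1) * Y3 = l * 1 - Z3 * const3 s" by (simp add: l q_def algebra_simps)
    then have 1: "X3 - const3 (q $ 1) * Y3 \<in> I" using idealD(6)[OF I subsetD[OF KI lK] ZI] by metis
    have 2: "Y3 - const3 (q $ 2) * Y3 \<in> I" using idealD(1)[OF I] by (simp add: q_def)
    have 3: "Z3 - const3 (q $ 3) * Y3 \<in> I" using ZI[of 1] by (simp add: q_def)
    note cong = forms_mod_point_ideal[OF I _ 1 2 3]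
    have "F0 - (F0 - const3 (eval3 F0 q) * Y3 ^ n0) \<in> I"
      using idealD(6)[OF I _ cong[OF F0(2)]] F0(1) JK KI by blast
    then have Y: "const3 (eval3 F0 q) * Y3 ^ n0 \<in> I" by simp
    have "const3 (eval3 F q) * Y3 ^ Suc n
        = const3 (eval3 F q * inverse (eval3 F0 q)) * Y3 ^ (Suc n - n0) * (const3 (eval3 F0 q) * Y3 ^ n0)"
    proof -
      have "Y3 ^ Suc n = Y3 ^ (Suc n - n0) * Y3 ^ n0" using that(1) by (simp flip: power_add)
      moreover have "const3 (eval3 F q) = const3 (eval3 F q * inverse (eval3 F0 q)) * const3 (eval3 F0 q)"
        using F0(3) unfolding const3_simps(4)[symmetric] by (simp add: mult.assoc del: const3_simps(4))
      ultimately show ?thesis by (simp only: mult_ac)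
    qed
    then have "const3 (eval3 F q) * Y3 ^ Suc n \<in> I" using idealD(3)[OF I Y] by metis
    from idealD(2)[OF I this cong[OF that(2)]] have "F \<in> I" by simp
    then obtain a b where F: "F = a + b * Z3" "a \<in> K" by (auto simp: I_def mult.commute)
    have "F = hcomp (Suc n) a + Z3 * hcomp n b"
      using hcomp_id[OF that(2)] unfolding F(1) hcomp_add hcomp_mult[OF Z3_forms] by (simp add: mult.commute)
    then have "F - Z3 * hcomp n b = hcomp (Suc n) a" by (simp add: algebra_simps)
    then show ?thesis using Kh[OF F(2)] hcomp_forms by metis
  qed
  have Z0: "Z3 \<noteq> 0" by (simp add: Z3_def)
  obtain N D where N: "\<And>n. n \<ge> N \<Longrightarrow> PS.dim (forms n) = PS.dim (K \<inter> forms n) + D"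
    using codim_eventually_constant[OF K Z3_forms Z0 surjZ] by blast
  \<comment> \<open>Otherwise \<open>J\<close> and \<open>l\<close> would have a common zero with
    last coordinate \<open>1\<close>.\<close>
  have "1 \<in> saturation Z3 K"
  proof (rule ccontr)
    assume "1 \<notin> saturation Z3 K"
    then obtain p where p: "eval3 Z3 p = 1" "\<And>n F. F \<in> forms n \<Longrightarrow> F * 1 \<in> saturation Z3 K \<Longrightarrow> eval3 F p = 0"
      using common_zero[OF K Z3_forms eq_imp_le[OF N[OF le_add1]] \<open>1 \<notin> _\<close>] by blast
    have "eval3 F p = 0" if "F \<in> K" "F \<in> forms n" for F n
      using p(2)[OF that(2)] that(1) saturation_superset by auto
    then have "eval3 l p = 0" "\<forall>n. \<forall>F\<in>J \<inter> forms n. eval3 F p = 0"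
      using lK[of 1] lf JK by auto
    moreover have "p \<noteq> 0" using p(1) by auto
    ultimately show False using zeros by blast
  qed
  then obtain j where j: "Z3 ^ j \<in> K" by (auto simp: saturation_def)
  \<comment> \<open>Repeated division makes \<open>F\<close> a multiple of \<open>Z3 ^ j\<close>
    modulo \<open>K\<close>. Since \<open>Z3 ^ j\<close> lies in \<open>K\<close>, so does
    \<open>F\<close>, and the multiple of \<open>l\<close> in its decomposition gives the required
    \<open>g\<close>.\<close>
  have iter: "\<exists>g\<in>forms n. F - Z3 ^ i * g \<in> K" if n: "n \<ge> n0" and "F \<in> forms (n + i)" for n i F
    using that(2)
  proof (induction i arbitrary: F)
    case 0
    then show ?case using idealD(1)[OF K] by (intro bexI[of _ F]) auto
  next
    case (Suc i)
    then obtain g where g: "g \<in> forms (n + i)" "F - Z3 * g \<in> K" using surjZ[of "n + i" F] n by auto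
    then obtain g' where g': "g' \<in> forms n" "g - Z3 ^ i * g' \<in> K" using Suc.IH by blast
    have "F - Z3 ^ Suc i * g' = (F - Z3 * g) + Z3 * (g - Z3 ^ i * g')" by (simp add: algebra_simps)
    then have "F - Z3 ^ Suc i * g' \<in> K" using idealD(2)[OF K g(2) idealD(3)[OF K g'(2)]] by (simp only:)
    then show ?case using g'(1) by blast
  qed
  show ?thesis
  proof (intro exI[of _ "n0 + j"] allI impI ballI)
    fix n F assume n: "n0 + j \<le> n" and F: "F \<in> forms (Suc n)"
    have "n0 \<le> Suc n - j" "F \<in> forms (Suc n - j + j)" using n F by auto
    then obtain g where "F - Z3 ^ j * g \<in> K" using iter by blast
    from idealD(2)[OF K this idealD(4)[OF K j, of g]] have "F \<in> K" by simp
    then obtain a b where ab: "F = a + b * l" "a \<in> J" by (auto simp: K_def mult.commute)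
    have "F = hcomp (Suc n) a + l * hcomp n b"
      using hcomp_id[OF F] unfolding ab(1) hcomp_add hcomp_mult[OF lf] by (simp add: mult.commute)
    then have "F - l * hcomp n b = hcomp (Suc n) a" by (simp add: algebra_simps)
    then show "\<exists>g\<in>forms n. F - l * g \<in> J" using J ab(2) hcomp_forms unfolding hom_ideal_def by metis
  qed
qed

section \<open>Finiteness of the singular locus\<close>

lemma eval3_altdef:
  "eval3 f v = poly (map_poly (\<lambda>q. poly (map_poly (\<lambda>r. poly r (v $ 1)) q) (v $ 2)) f) (v $ 3)"
  by (simp add: eval3_def subst3_def subst2_def)

lemma exists_nonroot:
  assumes "p \<noteq> (0 :: complex poly)"
  obtains x where "x \<noteq> 0" "poly p x \<noteq> 0"
proof -
  have "finite (insert 0 {x. poly p x = 0})" using poly_roots_finite[OF assms] by simp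
  then have "insert 0 {x. poly p x = 0} \<noteq> UNIV" using infinite_UNIV_char_0 by metis
  then show ?thesis using that by auto
qed

lemma exists_root:
  assumes "degree (p :: complex poly) > 0"
  obtains x where "poly p x = 0"
  using fundamental_theorem_of_algebra[of p] assms constant_degree[of p] by auto

text \<open>The variables before the last one that occurs are fixed so that the leading coefficient
  survives; that variable is then solved for over the complex numbers. The vector is kept nonzero by
  a nonzero first coordinate or, if only the first variable occurs, by coordinates
  \<open>1\<close>.\<close>

lemma nonunit_has_zero:
  fixes c :: poly3
  assumes "c \<noteq> 0" "\<not> is_unit c"
  shows "\<exists>v. v \<noteq> 0 \<and> eval3 c v = 0"
proof -
  let ?e = "\<lambda>x q. map_poly (\<lambda>r. poly r x) q :: complex poly"
  have ce: "coeff (?e x q) n = poly (coeff q n) x" for x q n by (simp add: coeff_map_poly)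
  show ?thesis
  proof (cases "degree c = 0")
    case False
    obtain x where x: "x \<noteq> 0" "poly (lead_coeff (lead_coeff c)) x \<noteq> 0"
      using exists_nonroot[of "lead_coeff (lead_coeff c)"] assms(1) by auto
    then have "?e x (lead_coeff c) \<noteq> 0" using ce by (metis coeff_0)
    then obtain y where y: "poly (?e x (lead_coeff c)) y \<noteq> 0" using exists_nonroot by blast
    define F where "F = map_poly (\<lambda>q. poly (?e x q) y) c"
    have "coeff F (degree c) \<noteq> 0" using y by (simp add: F_def coeff_map_poly)
    then have "degree F > 0" using False le_degree[of F "degree c"] by simp
    then obtain z where "poly F z = 0" by (rule exists_root)
    then have "eval3 c (vector [x, y, z]) = 0" by (simp add: eval3_altdef F_def)
    moreover have "(vector [x, y, z] :: complex^3) $ 1 \<noteq> (0 :: complex^3) $ 1" using x by simp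
    ultimately show ?thesis by metis
  next
    case True
    then obtain q where c: "c = [:q:]" by (rule degree_eq_zeroE)
    show ?thesis
    proof (cases "degree q = 0")
      case False
      obtain x where x: "x \<noteq> 0" "poly (lead_coeff q) x \<noteq> 0"
        using exists_nonroot[of "lead_coeff q"] assms(1) c by auto
      then have "coeff (?e x q) (degree q) \<noteq> 0" using ce by simp
      then have "degree (?e x q) > 0" using False le_degree[of "?e x q" "degree q"] by simp
      then obtain y where "poly (?e x q) y = 0" by (rule exists_root)
      then have "eval3 c (vector [x, y, 1]) = 0" by (simp add: eval3_altdef c map_poly_pCons)
      moreover have "(vector [x, y, 1] :: complex^3) $ 1 \<noteq> (0 :: complex^3) $ 1" using x by simp
      ultimately show ?thesis by metis
    next
      case True
      then obtain r where q: "q = [:r:]" by (rule degree_eq_zeroE)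
      have "degree r \<noteq> 0"
      proof
        assume "degree r = 0"
        then obtain a where "r = [:a:]" by (rule degree_eq_zeroE)
        then show False using assms c q by (auto simp: is_unit_const_poly_iff dvd_field_iff)
      qed
      then obtain x where "poly r x = 0" using exists_root by auto
      then have "eval3 c (vector [x, 1, 1]) = 0" by (simp add: eval3_altdef c q map_poly_pCons)
      moreover have "(vector [x, 1, 1] :: complex^3) $ 2 \<noteq> (0 :: complex^3) $ 2" by simp
      ultimately show ?thesis by metis
    qed
  qed
qed

lemma gradient_at_mult:
  "gradient_at (f * g) v = eval3 g v *s gradient_at f v + eval3 f v *s gradient_at g v"
  by (simp add: gradient_at_def vec_eq_iff forall_3 derivationD(2)[OF derivation_partials(1)]
      derivationD(2)[OF derivation_partials(2)] derivationD(2)[OF derivation_partials(3)] algebra_simps)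

text \<open>On the zeros of a common factor the product rule makes both gradients multiples of the
  gradient of that factor. Such a dependence is what transversality excludes.\<close>

lemma not_coprime_tangent:
  assumes "\<not> coprime g h" "g \<noteq> 0"
  shows "\<exists>v a b. v \<noteq> 0 \<and> eval3 g v = 0 \<and> eval3 h v = 0 \<and> (a \<noteq> 0 \<or> b \<noteq> 0) \<and>
    a *s gradient_at g v + b *s gradient_at h v = 0"
proof -
  obtain c where c: "c dvd g" "c dvd h" "\<not> is_unit c" using assms(1) by (rule not_coprimeE)
  obtain g' h' where gh: "g = c * g'" "h = c * h'" using c by (auto elim!: dvdE)
  have "c \<noteq> 0" using assms(2) gh by auto
  then obtain v where v: "v \<noteq> 0" "eval3 c v = 0" using nonunit_has_zero c(3) by blast
  then have grad: "gradient_at g v = eval3 g' v *s gradient_at c v"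
      "gradient_at h v = eval3 h' v *s gradient_at c v"
    by (simp_all add: gh gradient_at_mult)
  show ?thesis
  proof (cases "eval3 g' v = 0")
    case True
    then have "gradient_at g v = 0" using grad by simp
    moreover have "eval3 g v = 0" "eval3 h v = 0" using v gh by simp_all
    ultimately show ?thesis using v(1) by (intro exI[of _ v] exI[of _ 1] exI[of _ 0]) simp
  next
    case False
    moreover have "eval3 g v = 0" "eval3 h v = 0" using v gh by simp_all
    moreover have "(- eval3 h' v) *s gradient_at g v + eval3 g' v *s gradient_at h v = 0"
      unfolding grad by (simp add: vec_eq_iff)
    ultimately show ?thesis using v(1) by blast
  qed
qed

definition var3 :: "3 \<Rightarrow> poly3" where "var3 i = vector [X3, Y3, Z3] $ i"

lemma var3_forms: "var3 i \<in> forms 1"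
  using exhaust_3[of i] X3_forms Y3_forms Z3_forms by (auto simp: var3_def)

lemma eval3_var3 [simp]: "eval3 (var3 i) v = v $ i"
  using exhaust_3[of i] by (auto simp: var3_def)

text \<open>The form is a 2 by 2 minor with \<open>u\<close> as one row, so it vanishes at
  \<open>u\<close>; as \<open>v\<close> is not a multiple of \<open>u\<close>, some minor is nonzero
  at \<open>v\<close>.\<close>

lemma separating_linear_form:
  assumes "u \<noteq> 0" "\<And>c. v \<noteq> c *s u"
  shows "\<exists>L\<in>forms 1. eval3 L u = 0 \<and> eval3 L v \<noteq> 0"
proof -
  obtain i where i: "u $ i \<noteq> 0" using assms(1) by (auto simp: vec_eq_iff)
  have "v \<noteq> (v $ i / u $ i) *s u" using assms(2) .
  then obtain j where "v $ j \<noteq> v $ i / u $ i * u $ j" by (auto simp: vec_eq_iff)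
  then have "u $ i * v $ j - u $ j * v $ i \<noteq> 0" using i by (auto simp: field_simps)
  then show ?thesis
    by (intro bexI[of _ "const3 (u $ i) * var3 j - const3 (u $ j) * var3 i"])
       (auto intro!: forms_diff forms_const_mult var3_forms[simplified])
qed

text \<open>A weak form of Bezout's theorem: in degree \<open>n\<close> the ideal generated by
  \<open>g\<close> and \<open>h\<close> has codimension \<open>a * b\<close>, while the points of
  \<open>T\<close> impose independent conditions, all of them satisfied by this ideal.\<close>

lemma common_zeros_bound:
  assumes g: "g \<in> forms a" "g \<noteq> 0" and h: "h \<in> forms b" "h \<noteq> 0" and cop: "coprime g h"
    and T: "finite T" "\<And>v. v \<in> T \<Longrightarrow> v \<noteq> 0 \<and> eval3 g v = 0 \<and> eval3 h v = 0"
    and sep: "\<And>u v c. u \<in> T \<Longrightarrow> v \<in> T \<Longrightarrow> u \<noteq> v \<Longrightarrow> v \<noteq> c *s u"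
  shows "card T \<le> a * b"
proof -
  define t where "t = card T"
  \<comment> \<open>This degree leaves room for a product of \<open>t - 1\<close> separating linear
    forms, and for the trivial syzygies, whose cofactor then has degree \<open>t\<close>.\<close>
  define n where "n = a + b + t"
  let ?m = "\<lambda>w e. (\<lambda>f. w * f) ` forms e"
  have mdim: "PS.dim (?m w e) = PS.dim (forms e)" "PS.subspace (?m w e)" if "w \<noteq> 0" for w e
    using that by (auto intro!: PP.dim_image_inj_on PP.linear_subspace_image linear_mult forms_subspace forms_fin_dim)
  have sub: "?m w e \<subseteq> forms n" if "w \<in> forms i" "i + e = n" for w i e
    using that forms_mult by blast
  have fin: "PS.fin_dim S" if "S \<subseteq> forms n" for S
    using PS.fin_dim_subset[OF forms_fin_dim that] .
  have sg: "?m g (b + t) \<subseteq> forms n" and sh: "?m h (a + t) \<subseteq> forms n" and sgh: "?m (g * h) t \<subseteq> forms n"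
    by (rule sub[OF g(1)] sub[OF h(1)] sub[OF forms_mult[OF g(1) h(1)]]; simp add: n_def)+
  \<comment> \<open>By coprimality, \<open>g\<close> and \<open>h\<close> have only the trivial
    syzygies.\<close>
  have int: "?m g (b + t) \<inter> ?m h (a + t) = ?m (g * h) t"
  proof (intro equalityI subsetI)
    fix F assume F: "F \<in> ?m g (b + t) \<inter> ?m h (a + t)"
    then obtain A B where AB: "F = g * A" "A \<in> forms (b + t)" "F = h * B" by blast
    then have "h dvd g * A" by (metis dvd_triv_left)
    moreover have "coprime h g" using cop by (simp add: ac_simps)
    ultimately have "h dvd A" using coprime_dvd_mult_right_iff by blast
    then obtain C where C: "A = C * h" by (metis dvdE mult.commute)
    have "hcomp (b + t) (C * h) = hcomp t C * h" unfolding hcomp_mult[OF h(1)] by simp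
    then have "A = hcomp t C * h" using hcomp_id[OF AB(2)] C by metis
    then show "F \<in> ?m (g * h) t" using AB(1) hcomp_forms by (auto simp: mult_ac)
  next
    fix F assume "F \<in> ?m (g * h) t"
    then obtain C where C: "F = g * h * C" "C \<in> forms t" by blast
    then have "F = g * (h * C)" "F = h * (g * C)" by (simp_all add: mult_ac)
    then show "F \<in> ?m g (b + t) \<inter> ?m h (a + t)" using forms_mult g h C(2) by blast
  qed
  define V where "V = {x + y |x y. x \<in> ?m g (b + t) \<and> y \<in> ?m h (a + t)}"
  have Vsub: "V \<subseteq> forms n" using sg sh unfolding V_def by (blast intro: forms_add)
  have Vss: "PS.subspace V" unfolding V_def by (intro PS.subspace_sums mdim g h)
  have dimV: "PS.dim V + PS.dim (forms t) = PS.dim (forms (b + t)) + PS.dim (forms (a + t))"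
    using PS.dim_sum_Int[OF mdim(2)[OF g(2)] mdim(2)[OF h(2)] fin[OF sg] fin[OF sh]] g h mdim
    unfolding int V_def by simp
  have Vzero: "eval3 F v = 0" if "F \<in> V" "v \<in> T" for F v
    using that T(2) by (auto simp: V_def)
  have "\<exists>P\<in>forms n. eval3 P v \<noteq> 0 \<and> (\<forall>u\<in>T - {v}. eval3 P u = 0)" if v: "v \<in> T" for v
  proof -
    have "\<forall>u\<in>T - {v}. \<exists>L\<in>forms 1. eval3 L u = 0 \<and> eval3 L v \<noteq> 0"
      using separating_linear_form T(2) sep v by (metis DiffD1 DiffD2 singletonI)
    then obtain L where L: "\<And>u. u \<in> T - {v} \<Longrightarrow> L u \<in> forms 1 \<and> eval3 (L u) u = 0 \<and> eval3 (L u) v \<noteq> 0"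
      by metis
    obtain i where i: "v $ i \<noteq> 0" using T(2)[OF v] by (auto simp: vec_eq_iff)
    define P where "P = (\<Prod>u\<in>T - {v}. L u) * var3 i ^ (n - card (T - {v}))"
    have "(\<Prod>u\<in>T - {v}. L u) \<in> forms (\<Sum>u\<in>T - {v}. 1)"
      using T(1) L by (intro forms_prod) auto
    then have "P \<in> forms ((\<Sum>u\<in>T - {v}. 1) + (n - card (T - {v})))"
      unfolding P_def by (intro forms_mult forms_linear_power var3_forms)
    moreover have "card (T - {v}) \<le> n"
      using card_mono[OF T(1), of "T - {v}"] by (auto simp: n_def t_def)
    ultimately have "P \<in> forms n" by simp
    moreover have "eval3 P v \<noteq> 0" using L i T(1) by (simp add: P_def eval3_prod)
    moreover have "eval3 P u = 0" if "u \<in> T - {v}" for u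
      using L[OF that] that T(1) by (auto simp: P_def eval3_prod)
    ultimately show ?thesis by blast
  qed
  then obtain P where P: "\<And>v. v \<in> T \<Longrightarrow> P v \<in> forms n \<and> eval3 (P v) v \<noteq> 0 \<and> (\<forall>u\<in>T - {v}. eval3 (P v) u = 0)"
    by metis
  have inj: "inj_on P T" using P by (metis (no_types, lifting) DiffI inj_onI singletonD)
  have coef: "c v = 0" if V: "(\<Sum>v\<in>T. scale3 (c v) (P v)) \<in> V" and v: "v \<in> T" for c v
  proof -
    have "0 = eval3 (\<Sum>u\<in>T. scale3 (c u) (P u)) v" using Vzero[OF V v] by simp
    also have "\<dots> = (\<Sum>u\<in>T. if u = v then c v * eval3 (P v) v else 0)"
      unfolding eval3_sum using P v by (intro sum.cong) (auto simp: scale3_def)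
    also have "\<dots> = c v * eval3 (P v) v" using T(1) v by simp
    finally show ?thesis using P[OF v] by simp
  qed
  have sumP: "(\<Sum>x\<in>P ` T. scale3 (f x) x) = (\<Sum>v\<in>T. scale3 (f (P v)) (P v))" for f
    using inj by (simp add: sum.reindex)
  have ind: "PS.independent (P ` T)"
  proof (rule PS.independent_if_scalars_zero)
    fix f x assume "(\<Sum>x\<in>P ` T. scale3 (f x) x) = 0" "x \<in> P ` T"
    then show "f x = 0"
      using coef[of "\<lambda>v. f (P v)"] sumP[of f] PS.subspace_0[OF Vss] by auto
  qed (use T(1) in simp)
  have "V \<inter> PS.span (P ` T) = {0}"
  proof (intro equalityI subsetI)
    fix x assume x: "x \<in> V \<inter> PS.span (P ` T)"
    then obtain f where f: "x = (\<Sum>v\<in>P ` T. scale3 (f v) v)"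
      using PS.span_finite[of "P ` T"] T(1) by auto
    then have "f (P v) = 0" if "v \<in> T" for v
      using coef[of "\<lambda>v. f (P v)" v] sumP x that by auto
    then show "x \<in> {0}" using f sumP by (simp add: scale3_def)
  qed (use PS.subspace_0[OF Vss] PS.span_zero in auto)
  then have "PS.dim (PS.span (V \<union> P ` T)) = PS.dim V + t"
    using PS.dim_direct_sum[OF Vss fin[OF Vsub] ind] T(1) inj by (simp add: card_image t_def)
  moreover have "PS.dim (PS.span (V \<union> P ` T)) \<le> PS.dim (forms n)"
    using P Vsub by (intro PS.dim_mono_fin_dim PS.span_minimal forms_fin_dim forms_subspace) auto
  ultimately have "2 * PS.dim V + 2 * t \<le> (n + 1) * (n + 2)" using dim_forms[of n] by simp
  moreover have "2 * PS.dim V + (t + 1) * (t + 2) = (b + t + 1) * (b + t + 2) + (a + t + 1) * (a + t + 2)"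
    using dimV dim_forms[of t] dim_forms[of "b + t"] dim_forms[of "a + t"] by linarith
  \<comment> \<open>The mixed second difference of \<open>(k + 1) * (k + 2)\<close> with steps
    \<open>a\<close> and \<open>b\<close> is \<open>2 * a * b\<close>.\<close>
  ultimately have "t \<le> a * b" by (simp add: n_def algebra_simps)
  then show ?thesis by (simp add: t_def)
qed

section \<open>Homogeneous coordinates and singular points\<close>

lemma rep_P2_nonzero: "rep_P2 p \<noteq> 0"
  using Quotient3_rep_reflp[OF Quotient3_P2, of p] by (simp add: proj_eq_def)

lemma rep_P2_eqI: "rep_P2 q = c *s rep_P2 p \<Longrightarrow> p = q"
  using Quotient3_rel_rep[OF Quotient3_P2, of p q] rep_P2_nonzero[of p] rep_P2_nonzero[of q]
  by (auto simp: proj_eq_def)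

lemma ex_rep_P2:
  assumes "v \<noteq> 0"
  shows "\<exists>p c. c \<noteq> 0 \<and> rep_P2 p = c *s v"
proof -
  have "proj_eq v v" using assms by (auto simp: proj_eq_def intro: exI[of _ 1])
  from Quotient3_rep_abs[OF Quotient3_P2 this] obtain c
    where "c \<noteq> 0" "v = c *s rep_P2 (abs_P2 v)" by (auto simp: proj_eq_def)
  then show ?thesis
    by (intro exI[of _ "abs_P2 v"] exI[of _ "inverse c"]) (metis vector_smult_assoc vector_smult_lid
        left_inverse nonzero_imp_inverse_nonzero)
qed

lemma gradient_at_scale:
  assumes "f \<in> forms n"
  shows "gradient_at f (c *s v) = c ^ (n - 1) *s gradient_at f v"
  by (simp add: gradient_at_def vec_eq_iff forall_3 eval3_scale[OF partials_forms(1)[OF assms]]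
      eval3_scale[OF partials_forms(2)[OF assms]] eval3_scale[OF partials_forms(3)[OF assms]])

lemma SingI:
  assumes "f \<in> forms n" "eval3 f v = 0" "gradient_at f v = 0" "rep_P2 p = c *s v"
  shows "p \<in> Sing f"
  using assms gradient_at_scale[OF assms(1), of c v] eval3_scale[OF assms(1), of c v]
  by (simp add: Sing_def zero_set_def)

text \<open>An ordinary singular point lies on at least two components, and coprime components meet
  in finitely many points. Coprimality follows from transversality, since a common factor would
  produce a singular point with dependent gradients.\<close>

lemma finite_Sing:
  assumes "finite A" "\<And>g. g \<in> A \<Longrightarrow> g \<in> forms (e g) \<and> g \<noteq> 0"
    and ord: "\<And>p. p \<in> Sing (\<Prod>A) \<Longrightarrow> \<exists>r. ordinary_point A r p"
  shows "finite (Sing (\<Prod>A))"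
proof -
  have f: "\<Prod>A \<in> forms (sum e A)" using forms_prod[of A "\<lambda>x. x" e] assms(1,2) by auto
  have cop: "coprime g h" if gh: "g \<in> A" "h \<in> A" "g \<noteq> h" for g h
  proof (rule ccontr)
    assume "\<not> coprime g h"
    then obtain v a b where v: "v \<noteq> 0" "eval3 g v = 0" "eval3 h v = 0" "a \<noteq> 0 \<or> b \<noteq> 0"
        "a *s gradient_at g v + b *s gradient_at h v = 0"
      using not_coprime_tangent assms(2) gh by metis
    obtain p c where p: "c \<noteq> 0" "rep_P2 p = c *s v" using ex_rep_P2[OF v(1)] by blast
    define R where "R = \<Prod>(A - {g} - {h})"
    have "\<Prod>A = g * (h * R)"
      unfolding R_def using gh prod.remove[OF assms(1) gh(1), of "\<lambda>x. x"]
        prod.remove[of "A - {g}" h "\<lambda>x. x"] assms(1) by simp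
    then have "eval3 (\<Prod>A) v = 0" "gradient_at (\<Prod>A) v = 0"
      using v by (simp_all add: gradient_at_mult)
    then have "p \<in> Sing (\<Prod>A)" using SingI[OF f] p by blast
    then obtain r where "ordinary_point A r p" using ord by blast
    moreover have "p \<in> zero_set g" "p \<in> zero_set h"
      using v(2,3) p(2) eval3_scale[of g "e g"] eval3_scale[of h "e h"] assms(2) gh
      by (auto simp: zero_set_def)
    ultimately have "transversal_at p g h" using gh by (auto simp: ordinary_point_def)
    \<comment> \<open>The relation at \<open>v\<close> is carried to \<open>rep_P2 p\<close>; the
      gradient of a form of degree \<open>e\<close> scales with exponent
      \<open>e - 1\<close>.\<close>
    moreover have "(a / c ^ (e g - 1)) *s gradient_at g (rep_P2 p) + (b / c ^ (e h - 1)) *s gradient_at h (rep_P2 p) = 0"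
      using v(5) p(1) assms(2) gh
      by (simp add: p(2) gradient_at_scale[of g "e g"] gradient_at_scale[of h "e h"] vector_smult_assoc)
    ultimately have "a / c ^ (e g - 1) = 0 \<and> b / c ^ (e h - 1) = 0"
      unfolding transversal_at_def by blast
    then show False using v(4) p(1) by simp
  qed
  have fin: "finite (zero_set g \<inter> zero_set h)" if gh: "g \<in> A" "h \<in> A" "g \<noteq> h" for g h
  proof (rule ccontr)
    assume "\<not> finite (zero_set g \<inter> zero_set h)"
    then obtain B where B: "finite B" "card B = Suc (e g * e h)" "B \<subseteq> zero_set g \<inter> zero_set h"
      using infinite_arbitrarily_large by blast
    have inj: "inj_on rep_P2 B" by (rule inj_onI) (metis rep_P2_eqI vector_smult_lid)
    have "card (rep_P2 ` B) \<le> e g * e h"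
    proof (rule common_zeros_bound)
      show "coprime g h" using cop gh by blast
      show "\<And>v. v \<in> rep_P2 ` B \<Longrightarrow> v \<noteq> 0 \<and> eval3 g v = 0 \<and> eval3 h v = 0"
        using B(3) rep_P2_nonzero by (auto simp: zero_set_def)
      fix u v c assume "u \<in> rep_P2 ` B" "v \<in> rep_P2 ` B" and uv: "u \<noteq> v"
      then obtain p q where pq: "u = rep_P2 p" "v = rep_P2 q" by blast
      show "v \<noteq> c *s u" using rep_P2_eqI[of q c p] uv unfolding pq by auto
    qed (use assms(2) gh B(1) in auto)
    then show False using B card_image[OF inj] by simp
  qed
  have "Sing (\<Prod>A) \<subseteq> (\<Union>(g, h)\<in>{(g, h). g \<in> A \<and> h \<in> A \<and> g \<noteq> h}. zero_set g \<inter> zero_set h)"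
  proof
    fix p assume "p \<in> Sing (\<Prod>A)"
    then have "\<not> card {g \<in> A. p \<in> zero_set g} \<le> Suc 0"
      using ord by (fastforce simp: ordinary_point_def)
    then obtain g h where "g \<in> {g \<in> A. p \<in> zero_set g}" "h \<in> {g \<in> A. p \<in> zero_set g}" "g \<noteq> h"
      using card_le_Suc0_iff_eq[of "{g \<in> A. p \<in> zero_set g}"] assms(1) by auto
    then show "p \<in> (\<Union>(g, h)\<in>{(g, h). g \<in> A \<and> h \<in> A \<and> g \<noteq> h}. zero_set g \<inter> zero_set h)" by blast
  qed
  moreover have "finite {(g, h). g \<in> A \<and> h \<in> A \<and> g \<noteq> h}"
    by (rule finite_subset[of _ "A \<times> A"]) (use assms(1) in auto)
  ultimately show ?thesis using fin by (auto intro: finite_subset)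
qed

section \<open>Convergent power series\<close>

lemma nth2_simps [simp]:
  "nth2 0 i j = 0" "nth2 (g + h) i j = nth2 g i j + nth2 h i j" "nth2 (g - h) i j = nth2 g i j - nth2 h i j"
  "nth2 (- g) i j = - nth2 g i j" "nth2 (const2 c * g) i j = c * nth2 g i j"
  "nth2 (const2 c) i j = (if i = 0 \<and> j = 0 then c else 0)"
  by (simp_all add: nth2_def const2_def)

lemma nth2_1 [simp]: "nth2 1 i j = (if i = 0 \<and> j = 0 then 1 else 0)"
  by (simp add: nth2_def)

lemma nth2_sum: "nth2 (sum F A) i j = (\<Sum>a\<in>A. nth2 (F a) i j)"
  by (induction A rule: infinite_finite_induct) auto

lemma nth2_mult: "nth2 (g * h) i j = (\<Sum>b\<le>j. \<Sum>a\<le>i. nth2 g a b * nth2 h (i - a) (j - b))"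
  by (simp add: nth2_def fps_mult_nth fps_sum_nth atLeast0AtMost)

lemma series2_eqI: "(\<And>i j. nth2 g i j = nth2 h i j) \<Longrightarrow> g = h"
  unfolding nth2_def by (intro fps_ext) auto

lemma nth2_x2_power_mult: "nth2 (x2 ^ D * g) i j = (if i < D then 0 else nth2 g (i - D) j)"
  by (simp add: nth2_def x2_def fps_const_power fps_X_power_mult_nth)

lemma nth2_y2_power_mult: "nth2 (y2 ^ D * g) i j = (if j < D then 0 else nth2 g i (j - D))"
  by (simp add: nth2_def y2_def fps_X_power_mult_nth)

lemma nth2_monomial: "nth2 (x2 ^ a * y2 ^ b) i j = (if i = a \<and> j = b then 1 else 0)"
  using nth2_y2_power_mult[of b 1 "i - a" j]
  by (simp add: nth2_x2_power_mult) auto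

text \<open>Convergence on some polydisc amounts to a geometric bound on the coefficients, and
  closure properties are proved for the bound. The radius \<open>1 / (2 * R)\<close> leaves the
  factor \<open>(1 / 2) ^ (i + j)\<close>, whose double sum is at most \<open>4\<close>; the
  converse is \<open>conv_series_bound\<close>.\<close>

lemma conv_seriesI:
  assumes "R > 0" "\<And>i j. norm (nth2 g i j) \<le> C * R ^ (i + j)"
  shows "g \<in> conv_series"
proof -
  define r where "r = 1 / (2 * R)"
  have r: "r > 0" using assms(1) by (simp add: r_def)
  have C: "C \<ge> 0" using order_trans[OF norm_ge_zero assms(2)[of 0 0]] by simp
  let ?f = "\<lambda>(i, j). norm (nth2 g i j) * r ^ i * r ^ j"
  have le: "?f (i, j) \<le> C * ((1 / 2) ^ i * (1 / 2) ^ j)" for i j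
  proof -
    have "?f (i, j) \<le> (C * R ^ (i + j)) * (r ^ i * r ^ j)"
      using mult_right_mono[OF assms(2)[of i j], of "r ^ i * r ^ j"] r by (simp add: mult_ac)
    also have "\<dots> = C * ((R * r) ^ i * (R * r) ^ j)" by (simp add: power_add power_mult_distrib mult_ac)
    also have "R * r = 1 / 2" using assms(1) by (simp add: r_def)
    finally show ?thesis .
  qed
  have geo: "(\<Sum>i\<le>n. (1 / 2 :: real) ^ i) \<le> 2" for n
    using sum_gp_strict[of "1 / 2 :: real" "Suc n"] by (simp add: lessThan_Suc_atMost)
  have "sum ?f F \<le> C * 4" if F: "finite F" for F :: "(nat \<times> nat) set"
  proof -
    define n where "n = Max (insert 0 (fst ` F \<union> snd ` F))"
    have "i \<le> n \<and> j \<le> n" if "(i, j) \<in> F" for i j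
      unfolding n_def using F that by (intro conjI Max_ge) (force simp: image_iff)+
    then have n: "F \<subseteq> {..n} \<times> {..n}" by auto
    have "sum ?f F \<le> sum ?f ({..n} \<times> {..n})"
      using n r by (intro sum_mono2) auto
    also have "\<dots> \<le> (\<Sum>(i, j)\<in>{..n} \<times> {..n}. C * ((1 / 2) ^ i * (1 / 2) ^ j))"
      using le by (intro sum_mono) auto
    also have "\<dots> = C * (\<Sum>(i, j)\<in>{..n} \<times> {..n}. (1 / 2) ^ i * (1 / 2) ^ j)"
      by (simp add: sum_distrib_left case_prod_unfold)
    also have "\<dots> = C * ((\<Sum>i\<le>n. (1 / 2) ^ i) * (\<Sum>j\<le>n. (1 / 2) ^ j))"
      by (simp only: sum_product sum.cartesian_product)
    also have "\<dots> \<le> C * (2 * 2)"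
      using geo C by (intro mult_left_mono mult_mono) (auto intro: sum_nonneg)
    finally show ?thesis by simp
  qed
  then have "?f summable_on UNIV"
    using r by (intro nonneg_bdd_above_summable_on bdd_aboveI[of _ "C * 4"]) auto
  then show ?thesis unfolding conv_series_def using r by blast
qed

lemma conv_series_bound:
  assumes "g \<in> conv_series"
  shows "\<exists>C R. R > 0 \<and> C > 0 \<and> (\<forall>i j. norm (nth2 g i j) \<le> C * R ^ (i + j))"
proof -
  obtain r where r: "r > 0" "(\<lambda>(i, j). norm (nth2 g i j) * r ^ i * r ^ j) summable_on UNIV"
    using assms by (auto simp: conv_series_def)
  let ?f = "\<lambda>(i, j). norm (nth2 g i j) * r ^ i * r ^ j"
  define C where "C = infsum ?f UNIV"
  have C: "?f (i, j) \<le> C" for i j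
    using finite_sum_le_infsum[OF r(2), of "{(i, j)}"] r(1) by (auto simp: C_def)
  have "norm (nth2 g i j) \<le> (C + 1) * (1 / r) ^ (i + j)" for i j
  proof -
    have "norm (nth2 g i j) * r ^ (i + j) \<le> C + 1" using C[of i j] by (simp add: power_add mult.assoc)
    then show ?thesis using r(1) by (simp add: field_simps)
  qed
  moreover have "C \<ge> 0" unfolding C_def using r(1) by (intro infsum_nonneg) auto
  ultimately show ?thesis using r(1)
    by (intro exI[of _ "C + 1"] exI[of _ "1 / r"]) simp
qed

lemma conv_series_common_bound:
  assumes "g \<in> conv_series" "h \<in> conv_series"
  shows "\<exists>C R. R > 0 \<and> C > 0 \<and> (\<forall>i j. norm (nth2 g i j) \<le> C * R ^ (i + j)) \<and>
    (\<forall>i j. norm (nth2 h i j) \<le> C * R ^ (i + j))"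
proof -
  obtain C R where 1: "R > 0" "C > 0" "\<And>i j. norm (nth2 g i j) \<le> C * R ^ (i + j)"
    using conv_series_bound[OF assms(1)] by blast
  obtain C' R' where 2: "R' > 0" "C' > 0" "\<And>i j. norm (nth2 h i j) \<le> C' * R' ^ (i + j)"
    using conv_series_bound[OF assms(2)] by blast
  have le: "C * R ^ n \<le> max C C' * max R R' ^ n" "C' * R' ^ n \<le> max C C' * max R R' ^ n" for n
    using 1(1,2) 2(1,2) by (auto intro!: mult_mono power_mono)
  show ?thesis
  proof (intro exI conjI allI)
    show "max R R' > 0" "max C C' > 0" using 1 by auto
    show "norm (nth2 g i j) \<le> max C C' * max R R' ^ (i + j)" for i j
      by (rule order_trans[OF 1(3) le(1)])
    show "norm (nth2 h i j) \<le> max C C' * max R R' ^ (i + j)" for i j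
      by (rule order_trans[OF 2(3) le(2)])
  qed
qed

lemma conv_add:
  assumes "g \<in> conv_series" "h \<in> conv_series"
  shows "g + h \<in> conv_series"
proof -
  obtain C R where 1: "R > 0" "C > 0" "\<And>i j. norm (nth2 g i j) \<le> C * R ^ (i + j)"
    "\<And>i j. norm (nth2 h i j) \<le> C * R ^ (i + j)"
    using conv_series_common_bound[OF assms] by blast
  show ?thesis
  proof (rule conv_seriesI[OF 1(1)])
    fix i j
    show "norm (nth2 (g + h) i j) \<le> (2 * C) * R ^ (i + j)"
      using 1(3,4)[of i j] norm_triangle_ineq[of "nth2 g i j" "nth2 h i j"] by simp
  qed
qed

lemma conv_mult:
  assumes "g \<in> conv_series" "h \<in> conv_series"
  shows "g * h \<in> conv_series"
proof -
  obtain C R where 1: "R > 0" "C > 0" "\<And>i j. norm (nth2 g i j) \<le> C * R ^ (i + j)"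
    "\<And>i j. norm (nth2 h i j) \<le> C * R ^ (i + j)"
    using conv_series_common_bound[OF assms] by blast
  show ?thesis
  proof (rule conv_seriesI)
    show "2 * R > 0" using 1 by simp
    fix i j
    have "norm (nth2 (g * h) i j) \<le> (\<Sum>b\<le>j. \<Sum>a\<le>i. C * C * R ^ (i + j))"
      unfolding nth2_mult
    proof (intro sum_norm_le)
      fix a b assume ab: "b \<in> {..j}" "a \<in> {..i}"
      have "norm (nth2 g a b * nth2 h (i - a) (j - b)) \<le> (C * R ^ (a + b)) * (C * R ^ (i - a + (j - b)))"
        unfolding norm_mult using 1 by (intro mult_mono) auto
      also have "\<dots> = C * C * R ^ ((a + b) + (i - a + (j - b)))" by (simp add: power_add mult_ac)
      also have "(a + b) + (i - a + (j - b)) = i + j" using ab by auto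
      finally show "norm (nth2 g a b * nth2 h (i - a) (j - b)) \<le> C * C * R ^ (i + j)" .
    qed
    also have "\<dots> = real (Suc j) * (real (Suc i) * (C * C * R ^ (i + j)))" by simp
    \<comment> \<open>The number of summands is absorbed by doubling \<open>R\<close>.\<close>
    also have "\<dots> \<le> 2 ^ j * (2 ^ i * (C * C * R ^ (i + j)))"
    proof (intro mult_mono)
      have "Suc n \<le> 2 ^ n" for n :: nat by (induction n) auto
      then have "real (Suc n) \<le> 2 ^ n" for n by (metis of_nat_le_iff of_nat_numeral of_nat_power)
      then show "real (Suc j) \<le> 2 ^ j" "real (Suc i) \<le> 2 ^ i" by blast+
    qed (use 1 in auto)
    also have "\<dots> = (C * C) * (2 * R) ^ (i + j)" by (simp add: power_add power_mult_distrib mult_ac)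
    finally show "norm (nth2 (g * h) i j) \<le> (C * C) * (2 * R) ^ (i + j)" .
  qed
qed

lemma conv_const [simp]: "const2 c \<in> conv_series"
  by (rule conv_seriesI[of 1 _ "norm c"]) auto

lemma conv_0 [simp]: "0 \<in> conv_series" and conv_1 [simp]: "1 \<in> conv_series"
  by (rule conv_seriesI[of 1 _ 1]; auto)+

lemma conv_x2 [simp]: "x2 \<in> conv_series" and conv_y2 [simp]: "y2 \<in> conv_series"
  using nth2_monomial[of 1 0] nth2_monomial[of 0 1]
  by (auto intro!: conv_seriesI[of 1 _ 1])

lemma conv_uminus: "g \<in> conv_series \<Longrightarrow> - g \<in> conv_series"
  using conv_mult[OF conv_const[of "-1"], of g] ring_homD(5)[OF ring_hom_const2, of 1] ring_homD(2)[OF ring_hom_const2] by simp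

lemma conv_diff: "g \<in> conv_series \<Longrightarrow> h \<in> conv_series \<Longrightarrow> g - h \<in> conv_series"
  using conv_add[OF _ conv_uminus] by fastforce

lemma conv_power: "g \<in> conv_series \<Longrightarrow> g ^ n \<in> conv_series"
  by (induction n) (auto intro: conv_mult)

lemma conv_sum: "(\<And>a. a \<in> A \<Longrightarrow> F a \<in> conv_series) \<Longrightarrow> sum F A \<in> conv_series"
  by (induction A rule: infinite_finite_induct) (auto intro: conv_add)

text \<open>The double sum is at most \<open>1 / (1 - q) ^ 2\<close>, and for
  \<open>q \<le> 1 / 4\<close> this is at most \<open>1 + 4 * q\<close>. Removing the constant term
  leaves the estimate that closes the induction in \<open>conv_inverse\<close>.\<close>

lemma geometric_double_sum:
  assumes "0 \<le> q" "q \<le> (1 / 4 :: real)"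
  shows "(\<Sum>b\<le>j. \<Sum>a\<le>i. q ^ (a + b)) - 1 \<le> 4 * q"
proof -
  have g: "(\<Sum>a\<le>n. q ^ a) \<le> 1 / (1 - q)" for n
  proof -
    have "(\<Sum>a\<le>n. q ^ a) = (1 - q ^ Suc n) / (1 - q)"
      using sum_gp_strict[of q "Suc n"] assms by (simp add: lessThan_Suc_atMost)
    also have "\<dots> \<le> 1 / (1 - q)" using assms by (intro divide_right_mono) auto
    finally show ?thesis .
  qed
  have "(\<Sum>b\<le>j. \<Sum>a\<le>i. q ^ (a + b)) = (\<Sum>b\<le>j. q ^ b) * (\<Sum>a\<le>i. q ^ a)"
    unfolding sum_product by (simp add: power_add mult.commute)
  also have "\<dots> \<le> 1 / (1 - q) * (1 / (1 - q))"
    using g assms by (intro mult_mono) (auto intro: sum_nonneg)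
  also have "\<dots> \<le> 1 + 4 * q"
  proof -
    have "1 \<le> (1 + 4 * q) * ((1 - q) * (1 - q))"
    proof -
      have "(1 + 4 * q) * ((1 - q) * (1 - q)) - 1 = q * (2 - 7 * q + 4 * q * q)" by (simp add: algebra_simps)
      moreover have "2 - 7 * q + 4 * q * q \<ge> 0" using assms mult_nonneg_nonneg[of q q] by simp
      ultimately show ?thesis using assms mult_nonneg_nonneg[of q "2 - 7 * q + 4 * q * q"] by linarith
    qed
    then show ?thesis using assms by (simp add: divide_le_eq)
  qed
  finally show ?thesis by simp
qed

lemma conv_inverse:
  assumes "u \<in> conv_series" "nth2 u 0 0 \<noteq> 0"
  shows "\<exists>v\<in>conv_series. u * v = 1"
proof -
  define v where "v = fps_right_inverse u (inverse (u $ 0))"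
  have "u $ 0 * inverse (u $ 0) = 1"
    using assms(2) by (intro inverse_mult_eq_1') (simp add: nth2_def)
  then have uv: "u * v = 1" unfolding v_def by (rule fps_right_inverse)
  obtain C R where CR: "R > 0" "C > 0" "\<And>i j. norm (nth2 u i j) \<le> C * R ^ (i + j)"
    using conv_series_bound[OF assms(1)] by blast
  define c where "c = norm (nth2 u 0 0)"
  have c: "c > 0" using assms(2) by (simp add: c_def)
  \<comment> \<open>\<open>q\<close> is small enough that the recursion for the coefficients of \<open>v\<close>, read off from \<open>u * v = 1\<close>,
    preserves the bound \<open>V * S ^ (i + j)\<close>.\<close>
  define q where "q = min (1 / 4) (c / (4 * C))"
  have q: "0 < q" "q \<le> 1 / 4" "C * (4 * q) \<le> c"
    using c CR by (auto simp: q_def min_def field_simps)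
  define S where "S = R / q"
  have S: "S > 0" "R = q * S" using q CR by (simp_all add: S_def)
  define V where "V = norm (nth2 v 0 0)"
  have "norm (nth2 v i j) \<le> V * S ^ (i + j)" for i j
  proof (induction "i + j" arbitrary: i j rule: less_induct)
    case less
    show ?case
    proof (cases "i = 0 \<and> j = 0")
      case True
      then show ?thesis by (simp add: V_def)
    next
      case False
      let ?A = "{..j} \<times> {..i}"
      let ?t = "\<lambda>(b, a). nth2 u a b * nth2 v (i - a) (j - b)"
      have "0 = sum ?t ?A"
        using arg_cong[OF uv, of "\<lambda>g. nth2 g i j"] False by (auto simp: nth2_mult sum.cartesian_product)
      also have "\<dots> = ?t (0, 0) + sum ?t (?A - {(0, 0)})" by (subst sum.remove[of _ "(0, 0)"]) auto
      finally have eq: "nth2 u 0 0 * nth2 v i j = - sum ?t (?A - {(0, 0)})"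
        by (simp add: eq_neg_iff_add_eq_0)
      have "c * norm (nth2 v i j) = norm (sum ?t (?A - {(0, 0)}))"
        unfolding c_def norm_mult[symmetric] eq norm_minus_cancel ..
      also have "\<dots> \<le> (\<Sum>(b, a)\<in>?A - {(0, 0)}. C * V * S ^ (i + j) * q ^ (a + b))"
      proof (intro sum_norm_le)
        fix e assume "e \<in> ?A - {(0, 0)}"
        then obtain b a where e: "e = (b, a)" and ab: "b \<le> j" "a \<le> i" "\<not> (b = 0 \<and> a = 0)"
          by (cases e) auto
        then have lt: "i - a + (j - b) < i + j" by auto
        have "norm (nth2 u a b * nth2 v (i - a) (j - b)) \<le> (C * R ^ (a + b)) * (V * S ^ (i - a + (j - b)))"
          unfolding norm_mult using CR less[OF lt] by (intro mult_mono) auto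
        also have "\<dots> = C * V * (S ^ (a + b) * S ^ (i - a + (j - b))) * q ^ (a + b)"
          unfolding S(2) power_mult_distrib by (simp only: mult_ac)
        also have "S ^ (a + b) * S ^ (i - a + (j - b)) = S ^ (i + j)"
          using ab by (simp flip: power_add)
        finally show "norm (?t e) \<le> (case e of (b, a) \<Rightarrow> C * V * S ^ (i + j) * q ^ (a + b))"
          unfolding e by simp
      qed
      also have "\<dots> = C * V * S ^ (i + j) * (\<Sum>(b, a)\<in>?A - {(0, 0)}. q ^ (a + b))"
        by (simp add: sum_distrib_left case_prod_unfold)
      also have "(\<Sum>(b, a)\<in>?A - {(0, 0)}. q ^ (a + b)) = (\<Sum>b\<le>j. \<Sum>a\<le>i. q ^ (a + b)) - 1"
        unfolding sum.cartesian_product by (subst sum_diff) auto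
      also have "C * V * S ^ (i + j) * \<dots> \<le> C * V * S ^ (i + j) * (4 * q)"
        using geometric_double_sum[of q i j] q CR S by (intro mult_left_mono) (auto simp: V_def)
      also have "\<dots> = (C * (4 * q)) * (V * S ^ (i + j))" by simp
      also have "\<dots> \<le> c * (V * S ^ (i + j))"
        using q S by (intro mult_right_mono) (auto simp: V_def)
      finally show ?thesis using c by simp
    qed
  qed
  then have "v \<in> conv_series" using conv_seriesI[OF S(1)] by blast
  then show ?thesis using uv by blast
qed

text \<open>A monomial of total degree at least \<open>2 * D\<close> is divisible by the
  \<open>D\<close>-th power of a variable. Those with \<open>j \<ge> D\<close> go to
  \<open>b\<close>, the others to \<open>a\<close>, and both series inherit a geometric
  bound.\<close>

lemma conv_high_order:
  assumes "g \<in> conv_series" "\<And>i j. i + j < 2 * D \<Longrightarrow> nth2 g i j = 0"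
  shows "\<exists>a\<in>conv_series. \<exists>b\<in>conv_series. g = x2 ^ D * a + y2 ^ D * b"
proof -
  define b where "b = Abs_fps (\<lambda>j. Abs_fps (\<lambda>i. nth2 g i (j + D)))"
  define a where "a = Abs_fps (\<lambda>j. Abs_fps (\<lambda>i. if j < D then nth2 g (i + D) j else 0))"
  have nb: "nth2 b i j = nth2 g i (j + D)" for i j by (simp add: b_def nth2_def)
  have na: "nth2 a i j = (if j < D then nth2 g (i + D) j else 0)" for i j by (simp add: a_def nth2_def)
  obtain C R where CR: "R > 0" "C > 0" "\<And>i j. norm (nth2 g i j) \<le> C * R ^ (i + j)"
    using conv_series_bound[OF assms(1)] by blast
  have "norm (nth2 b i j) \<le> (C * R ^ D) * R ^ (i + j)" "norm (nth2 a i j) \<le> (C * R ^ D) * R ^ (i + j)" for i j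
    using CR(3)[of i "j + D"] CR(3)[of "i + D" j] CR(1,2) by (auto simp: nb na power_add mult_ac)
  then have "a \<in> conv_series" "b \<in> conv_series" using conv_seriesI[OF CR(1)] by blast+
  moreover have "g = x2 ^ D * a + y2 ^ D * b"
    using assms(2) by (intro series2_eqI) (auto simp: nth2_x2_power_mult nth2_y2_power_mult na nb)
  ultimately show ?thesis by blast
qed

definition truncate2 :: "nat \<Rightarrow> series2 \<Rightarrow> series2" where
  "truncate2 N g = (\<Sum>(i, j)\<in>{..<N} \<times> {..<N}. const2 (if i + j < N then nth2 g i j else 0) * (x2 ^ i * y2 ^ j))"

lemma nth2_truncate2: "nth2 (truncate2 N g) i j = (if i + j < N then nth2 g i j else 0)"
proof -
  have "nth2 (truncate2 N g) i j
      = (\<Sum>e\<in>{..<N} \<times> {..<N}. if e = (i, j) then (if i + j < N then nth2 g i j else 0) else 0)"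
    unfolding truncate2_def nth2_sum by (intro sum.cong) (auto simp: nth2_monomial split: if_splits)
  then show ?thesis by simp
qed

lemma conv_truncate2: "truncate2 N g \<in> conv_series"
  unfolding truncate2_def by (auto intro!: conv_sum conv_mult conv_power)

section \<open>Existence and uniqueness of quotient dimensions\<close>

definition scale2 :: "complex \<Rightarrow> series2 \<Rightarrow> series2" where "scale2 c g = const2 c * g"

interpretation SS: vec_space scale2
  by unfold_locales (simp_all add: scale2_def algebra_simps ring_homD[OF ring_hom_const2])

lemma ex1_implies_unique: "\<exists>!x. P x \<Longrightarrow> P a \<Longrightarrow> P b \<Longrightarrow> a = b"
  by blast

text \<open>A possibly infinite basis of \<open>I\<close> is extended within its union with
  \<open>B\<close>; the finitely many new elements represent a basis of the quotient.\<close>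

lemma has_quotient_dim_exists:
  assumes V: "SS.subspace V" and I: "SS.subspace I" and "I \<subseteq> V"
    and B: "finite B" "B \<subseteq> V" "V \<subseteq> SS.span (I \<union> B)"
  shows "\<exists>n. has_quotient_dim V I n"
proof -
  obtain A where A: "A \<subseteq> I" "SS.independent A" "I \<subseteq> SS.span A"
    using SS.maximal_independent_subset[of I] by blast
  have spA: "SS.span A = I" using A I SS.span_minimal by blast
  obtain E where E: "A \<subseteq> E" "E \<subseteq> A \<union> B" "SS.independent E" "A \<union> B \<subseteq> SS.span E"
    using SS.maximal_independent_subset_extend[of A "A \<union> B"] A(2) by blast
  define B' where "B' = E - A"
  have B': "finite B'" "B' \<subseteq> V" "SS.independent B'"
    using E B SS.independent_mono[of E B'] by (auto simp: B'_def intro: finite_subset)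
  have int: "x = 0" if x: "x \<in> I" "x \<in> SS.span B'" for x
  proof -
    have "SS.representation E x = SS.representation A x" "SS.representation E x = SS.representation B' x"
      using x spA E(3) A(2) B'(3) SS.representation_extend[of E x A] SS.representation_extend[of E x B'] E(1)
      by (auto simp: B'_def)
    then have r: "SS.representation E x b = 0" for b
      using SS.representation_ne_zero[of A x b] SS.representation_ne_zero[of B' x b] by (auto simp: B'_def)
    moreover have "x \<in> SS.span E" using x spA SS.span_mono[OF E(1)] by blast
    ultimately show "x = 0"
      using SS.sum_nonzero_representation_eq[OF E(3), of x] by simp
  qed
  have "V \<subseteq> SS.span (I \<union> B')"
  proof -
    have "A \<union> B' = E" using E(1) by (auto simp: B'_def)
    then have "SS.span (I \<union> B') = SS.span E" unfolding SS.span_Un spA[symmetric] SS.span_span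
      by (metis SS.span_Un)
    moreover have "I \<union> B \<subseteq> SS.span E" using E(4) spA SS.span_mono[OF E(1)] by blast
    ultimately show ?thesis using B(3) SS.span_minimal[OF _ SS.subspace_span] by blast
  qed
  then have dec: "\<exists>a y. a \<in> I \<and> y \<in> SS.span B' \<and> v = a + y" if "v \<in> V" for v
    using that unfolding SS.span_Un SS.span_eq_iff[THEN iffD2, OF I] by blast
  obtain b where b: "bij_betw b {..<card B'} B'"
    using ex_bij_betw_nat_finite[OF B'(1)] by (auto simp: atLeast0LessThan)
  define n where "n = card B'"
  have sumb: "(\<Sum>i<n. const2 (c i) * b i) = (\<Sum>x\<in>B'. scale2 (c (inv_into {..<n} b x)) x)" for c
    using b unfolding n_def[symmetric] scale2_def
    by (subst sum.reindex_bij_betw[OF b[unfolded n_def[symmetric]], symmetric])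
       (auto simp: bij_betw_def inv_into_f_f intro!: sum.cong)
  have uniq: "\<exists>!c. (\<forall>i\<ge>n. c i = 0) \<and> v - (\<Sum>i<n. const2 (c i) * b i) \<in> I" if "v \<in> V" for v
  proof -
    obtain a y where ay: "a \<in> I" "y \<in> SS.span B'" "v = a + y" using dec[OF \<open>v \<in> V\<close>] by blast
    obtain u where u: "y = (\<Sum>x\<in>B'. scale2 (u x) x)" using ay(2) SS.span_finite[OF B'(1)] by auto
    \<comment> \<open>The value \<open>0\<close> from \<open>n\<close> on is prescribed by
      \<open>has_quotient_dim\<close>, where it makes the coefficient function unique.\<close>
    define c where "c = (\<lambda>i. if i < n then u (b i) else 0)"
    have "(\<Sum>i<n. const2 (c i) * b i) = (\<Sum>i<n. scale2 (u (b i)) (b i))"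
      by (intro sum.cong) (auto simp: c_def scale2_def)
    also have "\<dots> = y" unfolding u n_def using b by (rule sum.reindex_bij_betw)
    finally have c: "v - (\<Sum>i<n. const2 (c i) * b i) \<in> I" using ay by simp
    show ?thesis
    proof (rule ex1I[of _ c])
      show "(\<forall>i\<ge>n. c i = 0) \<and> v - (\<Sum>i<n. const2 (c i) * b i) \<in> I" using c by (simp add: c_def)
      fix c' assume c': "(\<forall>i\<ge>n. c' i = 0) \<and> v - (\<Sum>i<n. const2 (c' i) * b i) \<in> I"
      let ?d = "\<lambda>i. c i - c' i"
      have eq: "(\<Sum>i<n. const2 (?d i) * b i)
          = (v - (\<Sum>i<n. const2 (c' i) * b i)) - (v - (\<Sum>i<n. const2 (c i) * b i))"
        by (simp add: ring_homD[OF ring_hom_const2] left_diff_distrib sum_subtractf)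
      have "(\<Sum>i<n. const2 (?d i) * b i) \<in> I"
        unfolding eq by (rule SS.subspace_diff[OF I]) (use c c' in simp_all)
      moreover have "(\<Sum>i<n. const2 (?d i) * b i) \<in> SS.span B'"
        unfolding sumb by (intro SS.span_sum SS.span_scale SS.span_base)
      ultimately have "(\<Sum>i<n. const2 (?d i) * b i) = 0" using int by blast
      then have z: "?d (inv_into {..<n} b x) = 0" if "x \<in> B'" for x
        unfolding sumb using SS.independentD[OF B'(3,1) order_refl _ that, of "\<lambda>x. ?d (inv_into {..<n} b x)"]
        by blast
      show "c' = c"
      proof
        fix i
        show "c' i = c i"
        proof (cases "i < n")
          case True
          then have "b i \<in> B'" "inv_into {..<n} b (b i) = i"
            using b unfolding n_def[symmetric] by (auto simp: bij_betw_def inv_into_f_f)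
          then show ?thesis using z[of "b i"] by simp
        qed (use c' in \<open>simp add: c_def\<close>)
      qed
    qed
  qed
  have "\<forall>i<n. b i \<in> V" using b B'(2) unfolding n_def bij_betw_def by auto
  then show ?thesis unfolding has_quotient_dim_def
    by (intro exI[of _ n] exI[of _ b] conjI ballI uniq)
qed

text \<open>The functionals are the coordinates with respect to a basis of the quotient; outside
  \<open>V\<close> nothing is claimed about them.\<close>

lemma has_quotient_dim_functionals:
  assumes V: "SS.subspace V" and I: "SS.subspace I" and n: "has_quotient_dim V I n"
  obtains \<phi> :: "nat \<Rightarrow> series2 \<Rightarrow> complex" where
    "\<And>i x y. x \<in> V \<Longrightarrow> y \<in> V \<Longrightarrow> \<phi> i (x + y) = \<phi> i x + \<phi> i y"
    "\<And>i c x. x \<in> V \<Longrightarrow> \<phi> i (const2 c * x) = c * \<phi> i x"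
    "\<And>x. x \<in> V \<Longrightarrow> \<forall>i<n. \<phi> i x = 0 \<Longrightarrow> x \<in> I"
proof -
  from n[unfolded has_quotient_dim_def] obtain b where b0: "(\<forall>i<n. b i \<in> V) \<and>
      (\<forall>v\<in>V. \<exists>!c. (\<forall>i\<ge>n. c i = 0) \<and> v - (\<Sum>i<n. const2 (c i) * b i) \<in> I)" ..
  have b: "\<And>i. i < n \<Longrightarrow> b i \<in> V"
    "\<And>v. v \<in> V \<Longrightarrow> \<exists>!c. (\<forall>i\<ge>n. c i = 0) \<and> v - (\<Sum>i<n. const2 (c i) * b i) \<in> I"
    using conjunct1[OF b0] bspec[OF conjunct2[OF b0]] by simp_all
  define co where "co = (\<lambda>v. THE c. (\<forall>i\<ge>n. c i = 0) \<and> v - (\<Sum>i<n. const2 (c i) * b i) \<in> I)"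
  have co: "(\<forall>i\<ge>n. co v i = 0) \<and> v - (\<Sum>i<n. const2 (co v i) * b i) \<in> I" if "v \<in> V" for v
    unfolding co_def by (rule theI'[OF b(2)[OF that]])
  have coI: "co v = c" if "v \<in> V" "\<forall>i\<ge>n. c i = 0" "v - (\<Sum>i<n. const2 (c i) * b i) \<in> I" for v c
    unfolding co_def by (rule the1_equality[OF b(2)[OF that(1)]]) (use that in simp)
  show ?thesis
  proof (rule that[of "\<lambda>i v. co v i"])
    fix i x y assume xy: "x \<in> V" "y \<in> V"
    have "x + y - (\<Sum>i<n. const2 (co x i + co y i) * b i)
        = (x - (\<Sum>i<n. const2 (co x i) * b i)) + (y - (\<Sum>i<n. const2 (co y i) * b i))"
      by (simp add: ring_homD[OF ring_hom_const2] distrib_right sum.distrib)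
    also have "\<dots> \<in> I" using co xy SS.subspace_add[OF I] by blast
    finally have "co (x + y) = (\<lambda>i. co x i + co y i)"
      using co xy SS.subspace_add[OF V] by (intro coI) auto
    then show "co (x + y) i = co x i + co y i" by simp
  next
    fix i c x assume x: "x \<in> V"
    have "const2 c * x - (\<Sum>i<n. const2 (c * co x i) * b i) = scale2 c (x - (\<Sum>i<n. const2 (co x i) * b i))"
      by (simp add: ring_homD[OF ring_hom_const2] right_diff_distrib sum_distrib_left scale2_def mult.assoc)
    also have "\<dots> \<in> I" using co x SS.subspace_scale[OF I] by blast
    finally have "co (const2 c * x) = (\<lambda>i. c * co x i)"
      using co x SS.subspace_scale[OF V, of x c] by (intro coI) (auto simp: scale2_def)
    then show "co (const2 c * x) i = c * co x i" by simp
  next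
    fix x assume x: "x \<in> V" "\<forall>i<n. co x i = 0"
    then have "(\<Sum>i<n. const2 (co x i) * b i) = 0" by (simp add: ring_homD[OF ring_hom_const2])
    then show "x \<in> I" using co[OF x(1)] by simp
  qed
qed

text \<open>There are \<open>n'\<close> elements independent modulo \<open>I\<close>, whereas
  \<open>n\<close> functionals vanish simultaneously only on elements of \<open>I\<close>. By
  symmetry the dimension is unique, as the definite description in \<open>tjurina\<close>
  requires.\<close>

lemma has_quotient_dim_le:
  assumes V: "SS.subspace V" and I: "SS.subspace I" and n: "has_quotient_dim V I n"
    and n': "has_quotient_dim V I n'"
  shows "n' \<le> n"
proof -
  from n'[unfolded has_quotient_dim_def] obtain b where b0: "(\<forall>i<n'. b i \<in> V) \<and>
      (\<forall>v\<in>V. \<exists>!c. (\<forall>i\<ge>n'. c i = 0) \<and> v - (\<Sum>i<n'. const2 (c i) * b i) \<in> I)" ..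
  have b: "\<And>i. i < n' \<Longrightarrow> b i \<in> V"
    "\<And>v. v \<in> V \<Longrightarrow> \<exists>!c. (\<forall>i\<ge>n'. c i = 0) \<and> v - (\<Sum>i<n'. const2 (c i) * b i) \<in> I"
    using conjunct1[OF b0] bspec[OF conjunct2[OF b0]] by simp_all
  have ind: "c i = 0" if c: "(\<Sum>i<n'. scale2 (c i) (b i)) \<in> I" and i: "i < n'" for c i
  proof -
    define c' where "c' = (\<lambda>i. if i < n' then c i else 0)"
    have "(\<Sum>i<n'. const2 (c' i) * b i) = (\<Sum>i<n'. scale2 (c i) (b i))"
      by (intro sum.cong) (auto simp: c'_def scale2_def)
    then have "0 - (\<Sum>i<n'. const2 (c' i) * b i) \<in> I" using c SS.subspace_neg[OF I] by simp
    moreover have "0 - (\<Sum>i<n'. const2 0 * b i) \<in> I"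
      using SS.subspace_0[OF I] by (simp add: ring_homD[OF ring_hom_const2])
    ultimately have "c' = (\<lambda>_. 0)"
      using ex1_implies_unique[OF b(2)[OF SS.subspace_0[OF V]], of c' "\<lambda>_. 0"] by (simp add: c'_def)
    then show ?thesis using i unfolding c'_def by metis
  qed
  have inj: "inj_on b {..<n'}"
  proof (rule inj_onI, rule ccontr)
    fix i j assume ij: "i \<in> {..<n'}" "j \<in> {..<n'}" "b i = b j" "i \<noteq> j"
    define c where "c = (\<lambda>k. if k = i then 1 else if k = j then -1 else 0 :: complex)"
    have "(\<Sum>k<n'. scale2 (c k) (b k)) = (\<Sum>k\<in>{i, j}. scale2 (c k) (b k))"
      by (rule sum.mono_neutral_right) (use ij in \<open>auto simp: c_def\<close>)
    also have "\<dots> = 0" using ij by (simp add: c_def)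
    finally show False using ind[of c i] ij SS.subspace_0[OF I] by (simp add: c_def)
  qed
  let ?B = "b ` {..<n'}"
  have sumb: "(\<Sum>x\<in>?B. scale2 (f x) x) = (\<Sum>i<n'. scale2 (f (b i)) (b i))" for f
    using inj by (simp add: sum.reindex)
  have indB: "SS.independent ?B"
  proof (rule SS.independent_if_scalars_zero)
    fix f x assume "(\<Sum>x\<in>?B. scale2 (f x) x) = 0" "x \<in> ?B"
    then show "f x = 0" using ind[of "\<lambda>i. f (b i)"] sumb[of f] SS.subspace_0[OF I] by auto
  qed simp
  obtain \<phi> where \<phi>: "\<And>i x y. x \<in> V \<Longrightarrow> y \<in> V \<Longrightarrow> \<phi> i (x + y) = \<phi> i x + \<phi> i y"
    "\<And>i c x. x \<in> V \<Longrightarrow> \<phi> i (const2 c * x) = c * \<phi> i x"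
    "\<And>x. x \<in> V \<Longrightarrow> \<forall>i<n. \<phi> i x = 0 \<Longrightarrow> x \<in> I"
    using has_quotient_dim_functionals[OF V I n] by metis
  have BV: "SS.span ?B \<subseteq> V" using b(1) V by (intro SS.span_minimal) auto
  have "{x \<in> SS.span ?B. \<forall>i\<in>{..<n}. \<phi> i x = 0} \<subseteq> {0}"
  proof
    fix x assume x: "x \<in> {x \<in> SS.span ?B. \<forall>i\<in>{..<n}. \<phi> i x = 0}"
    then have "x \<in> I" using \<phi>(3) BV by auto
    moreover obtain f where f: "x = (\<Sum>v\<in>?B. scale2 (f v) v)"
      using x SS.span_finite[of ?B] by auto
    ultimately have "f (b i) = 0" if "i < n'" for i
      using ind[of "\<lambda>i. f (b i)" i] sumb[of f] that by auto
    then show "x \<in> {0}" using f sumb[of f] by simp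
  qed
  then have "SS.dim {x \<in> SS.span ?B. \<forall>i\<in>{..<n}. \<phi> i x = 0} = 0"
    using SS.dim_le_card[of _ "{}"] by simp
  moreover have "SS.dim (SS.span ?B)
      \<le> SS.dim {x \<in> SS.span ?B. \<forall>i\<in>{..<n}. \<phi> i x = 0} + card {..<n}"
    by (rule SS.dim_kernel_functionals)
       (use \<phi> BV SS.fin_dim_span in \<open>auto simp: scale2_def subset_iff\<close>)
  ultimately show "n' \<le> n"
    using SS.dim_span_eq_card_independent[OF indB] card_image[OF inj] by simp
qed

section \<open>The local Tjurina algebra\<close>

text \<open>Expansions in linear coordinates adapted to a point: in the application
  \<open>s1\<close> and \<open>s2\<close> vanish there and \<open>s0\<close> does not.\<close>

definition coord_forms :: "poly3 \<Rightarrow> poly3 \<Rightarrow> poly3 \<Rightarrow> nat \<Rightarrow> poly3 set" where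
  "coord_forms s1 s2 s0 n =
     {F. \<exists>c. F = (\<Sum>(i, j, k)\<in>exps n. const3 (c i j k) * (s1 ^ i * s2 ^ j * s0 ^ k))}"

lemma coord_forms_add:
  assumes "F \<in> coord_forms s1 s2 s0 n" "G \<in> coord_forms s1 s2 s0 n"
  shows "F + G \<in> coord_forms s1 s2 s0 n"
proof -
  obtain c d where "F = (\<Sum>(i, j, k)\<in>exps n. const3 (c i j k) * (s1 ^ i * s2 ^ j * s0 ^ k))"
    "G = (\<Sum>(i, j, k)\<in>exps n. const3 (d i j k) * (s1 ^ i * s2 ^ j * s0 ^ k))"
    using assms by (auto simp: coord_forms_def)
  then have "F + G = (\<Sum>(i, j, k)\<in>exps n. const3 (c i j k + d i j k) * (s1 ^ i * s2 ^ j * s0 ^ k))"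
    by (simp add: distrib_right case_prod_unfold sum.distrib)
  then show ?thesis
    unfolding coord_forms_def by (intro CollectI exI[of _ "\<lambda>i j k. c i j k + d i j k"])
qed

lemma coord_forms_monomial:
  assumes "a + b + c = n"
  shows "const3 t * (s1 ^ a * s2 ^ b * s0 ^ c) \<in> coord_forms s1 s2 s0 n"
proof -
  have "(\<Sum>(i, j, k)\<in>exps n. const3 (if (i, j, k) = (a, b, c) then t else 0) * (s1 ^ i * s2 ^ j * s0 ^ k))
      = (\<Sum>e\<in>exps n. if e = (a, b, c) then const3 t * (s1 ^ a * s2 ^ b * s0 ^ c) else 0)"
    by (intro sum.cong) (auto split: if_splits)
  also have "(a, b, c) \<in> exps n" using assms by (simp add: exps_def)
  then have "(\<Sum>e\<in>exps n. if e = (a, b, c) then const3 t * (s1 ^ a * s2 ^ b * s0 ^ c) else 0)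
      = const3 t * (s1 ^ a * s2 ^ b * s0 ^ c)" by simp
  finally have "const3 t * (s1 ^ a * s2 ^ b * s0 ^ c) = (\<Sum>(i, j, k)\<in>exps n.
      const3 (if (i, j, k) = (a, b, c) then t else 0) * (s1 ^ i * s2 ^ j * s0 ^ k))" ..
  then show ?thesis unfolding coord_forms_def
    by (intro CollectI exI[of _ "\<lambda>i j k. if (i, j, k) = (a, b, c) then t else 0"])
qed

lemma coord_forms_0: "0 \<in> coord_forms s1 s2 s0 n"
  unfolding coord_forms_def by (intro CollectI exI[of _ "\<lambda>_ _ _. 0"]) simp

lemma coord_forms_sum:
  "(\<And>a. a \<in> A \<Longrightarrow> F a \<in> coord_forms s1 s2 s0 n) \<Longrightarrow> sum F A \<in> coord_forms s1 s2 s0 n"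
  by (induction A rule: infinite_finite_induct) (auto intro: coord_forms_add coord_forms_0)

lemma coord_forms_mult:
  assumes "F \<in> coord_forms s1 s2 s0 n" "G \<in> coord_forms s1 s2 s0 m"
  shows "F * G \<in> coord_forms s1 s2 s0 (n + m)"
proof -
  obtain c d where F: "F = (\<Sum>(i, j, k)\<in>exps n. const3 (c i j k) * (s1 ^ i * s2 ^ j * s0 ^ k))"
    and G: "G = (\<Sum>(i, j, k)\<in>exps m. const3 (d i j k) * (s1 ^ i * s2 ^ j * s0 ^ k))"
    using assms by (auto simp: coord_forms_def)
  have "const3 s * (s1 ^ i * s2 ^ j * s0 ^ k) * (const3 t * (s1 ^ i' * s2 ^ j' * s0 ^ k')) \<in> coord_forms s1 s2 s0 (n + m)"
    if "i + j + k = n" "i' + j' + k' = m" for s t i j k i' j' k'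
  proof -
    have "const3 s * (s1 ^ i * s2 ^ j * s0 ^ k) * (const3 t * (s1 ^ i' * s2 ^ j' * s0 ^ k'))
        = const3 (s * t) * (s1 ^ (i + i') * s2 ^ (j + j') * s0 ^ (k + k'))"
      by (simp add: power_add mult_ac)
    then show ?thesis using that by (simp only:) (rule coord_forms_monomial, simp)
  qed
  then show ?thesis
    unfolding F G sum_product by (auto intro!: coord_forms_sum simp: exps_def)
qed

lemma coord_forms_1: "1 \<in> coord_forms s1 s2 s0 0"
  using coord_forms_monomial[of 0 0 0 0 1] by simp

lemma coord_forms_power: "F \<in> coord_forms s1 s2 s0 1 \<Longrightarrow> F ^ n \<in> coord_forms s1 s2 s0 n"
  by (induction n) (use coord_forms_mult[of F s1 s2 s0 1] in \<open>auto simp: coord_forms_1\<close>)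

lemma forms_subset_coord_forms:
  assumes "X3 \<in> coord_forms s1 s2 s0 1" "Y3 \<in> coord_forms s1 s2 s0 1" "Z3 \<in> coord_forms s1 s2 s0 1"
  shows "forms n \<subseteq> coord_forms s1 s2 s0 n"
proof
  fix F assume "F \<in> forms n"
  then show "F \<in> coord_forms s1 s2 s0 n"
  proof (induction F rule: forms_induct)
    case (mono c i j k)
    have "const3 c \<in> coord_forms s1 s2 s0 0" using coord_forms_monomial[of 0 0 0 0 c] by simp
    from coord_forms_mult[OF this coord_forms_mult[OF coord_forms_mult[OF coord_forms_power[OF assms(1), of i]
        coord_forms_power[OF assms(2), of j]] coord_forms_power[OF assms(3), of k]]]
    show ?case using mono by (simp add: mono3_def)
  qed (auto intro: coord_forms_add coord_forms_0)
qed

lemma coord_forms_linear: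
  "const3 a * s1 + const3 b * s2 + const3 c * s0 \<in> coord_forms s1 s2 s0 1"
  using coord_forms_monomial[of 1 0 0 1 a s1 s2 s0] coord_forms_monomial[of 0 1 0 1 b s1 s2 s0]
    coord_forms_monomial[of 0 0 1 1 c s1 s2 s0] by (auto intro!: coord_forms_add)

section \<open>Ideals of convergent series and affine charts\<close>

definition conv_ideal3 :: "series2 \<Rightarrow> series2 \<Rightarrow> series2 \<Rightarrow> series2 set" where
  "conv_ideal3 A B C = {a * A + b * B + c * C |a b c. a \<in> conv_series \<and> b \<in> conv_series \<and> c \<in> conv_series}"

lemma conv_ideal3I:
  "a \<in> conv_series \<Longrightarrow> b \<in> conv_series \<Longrightarrow> c \<in> conv_series \<Longrightarrow> a * A + b * B + c * C \<in> conv_ideal3 A B C"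
  by (auto simp: conv_ideal3_def)

lemma conv_ideal3_add:
  assumes "g \<in> conv_ideal3 A B C" "h \<in> conv_ideal3 A B C"
  shows "g + h \<in> conv_ideal3 A B C"
proof -
  obtain a b c a' b' c' where *: "g = a * A + b * B + c * C" "h = a' * A + b' * B + c' * C"
    "a \<in> conv_series" "b \<in> conv_series" "c \<in> conv_series" "a' \<in> conv_series" "b' \<in> conv_series" "c' \<in> conv_series"
    using assms by (auto simp: conv_ideal3_def)
  have "g + h = (a + a') * A + (b + b') * B + (c + c') * C" by (simp add: * algebra_simps)
  then show ?thesis using conv_ideal3I[OF conv_add conv_add conv_add] * by metis
qed

lemma conv_ideal3_mult:
  assumes "g \<in> conv_ideal3 A B C" "s \<in> conv_series"
  shows "s * g \<in> conv_ideal3 A B C"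
proof -
  obtain a b c where *: "g = a * A + b * B + c * C" "a \<in> conv_series" "b \<in> conv_series" "c \<in> conv_series"
    using assms by (auto simp: conv_ideal3_def)
  have "s * g = (s * a) * A + (s * b) * B + (s * c) * C" by (simp add: * algebra_simps)
  then show ?thesis using conv_ideal3I[OF conv_mult conv_mult conv_mult] * assms(2) by metis
qed

lemma conv_ideal3_subspace: "SS.subspace (conv_ideal3 A B C)"
  using conv_ideal3I[of 0 0 0 A B C] by (auto simp: SS.subspace_def scale2_def intro: conv_ideal3_add conv_ideal3_mult)

lemma conv_series_subspace: "SS.subspace conv_series"
  by (auto simp: SS.subspace_def scale2_def intro: conv_add conv_mult)

lemma conv_ideal3_rotate: "conv_ideal3 A B C = conv_ideal3 C A B"
proof -
  have sub: "conv_ideal3 A B C \<subseteq> conv_ideal3 C A B" for A B C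
  proof
    fix g assume "g \<in> conv_ideal3 A B C"
    then obtain a b c where *: "g = a * A + b * B + c * C" "a \<in> conv_series" "b \<in> conv_series" "c \<in> conv_series"
      by (auto simp: conv_ideal3_def)
    then have "g = c * C + a * A + b * B" by simp
    then show "g \<in> conv_ideal3 C A B" using conv_ideal3I[OF *(4,2,3), of C A B] by simp
  qed
  show ?thesis using sub[of A B C] sub[of C A B] sub[of B C A] by blast
qed

lemma conv_ideal3_swap: "conv_ideal3 A B C = conv_ideal3 A C B"
proof -
  have sub: "conv_ideal3 A B C \<subseteq> conv_ideal3 A C B" for B C
  proof
    fix g assume "g \<in> conv_ideal3 A B C"
    then obtain a b c where *: "g = a * A + b * B + c * C" "a \<in> conv_series" "b \<in> conv_series" "c \<in> conv_series"
      by (auto simp: conv_ideal3_def)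
    then have "g = a * A + c * C + b * B" by simp
    then show "g \<in> conv_ideal3 A C B" using conv_ideal3I[OF *(2,4,3), of A C B] by simp
  qed
  show ?thesis using sub[of B C] sub[of C B] by blast
qed

text \<open>The dehomogenised Euler relation expresses \<open>F\<close> by the three partials and,
  conversely, the third partial by \<open>F\<close> and the other two. Thus a Tjurina ideal is
  generated by the dehomogenised partials of the form.\<close>

lemma conv_ideal3_euler:
  assumes "\<alpha> * A + \<beta> * B + C = const2 m * F" "m \<noteq> 0" "\<alpha> \<in> conv_series" "\<beta> \<in> conv_series"
  shows "conv_ideal3 F A B = conv_ideal3 A B C"
proof (intro equalityI subsetI)
  fix g assume "g \<in> conv_ideal3 F A B"
  then obtain a b c where *: "g = a * F + b * A + c * B" "a \<in> conv_series" "b \<in> conv_series" "c \<in> conv_series"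
    by (auto simp: conv_ideal3_def)
  define t where "t = a * const2 (1 / m)"
  have "const2 (1 / m) * const2 m = 1"
    using assms(2) by (simp flip: ring_homD(4)[OF ring_hom_const2] add: ring_homD(2)[OF ring_hom_const2])
  then have "a * F = t * (const2 m * F)" by (simp add: t_def mult.assoc flip: mult.assoc[of "const2 (1 / m)"])
  then have "g = (t * \<alpha> + b) * A + (t * \<beta> + c) * B + t * C"
    unfolding *(1) assms(1)[symmetric] by (simp add: algebra_simps)
  moreover have "t \<in> conv_series" unfolding t_def using * by (intro conv_mult) auto
  ultimately show "g \<in> conv_ideal3 A B C"
    using * assms(3,4) by (simp only:) (intro conv_ideal3I conv_add conv_mult)
next
  fix g assume "g \<in> conv_ideal3 A B C"
  then obtain a b c where *: "g = a * A + b * B + c * C" "a \<in> conv_series" "b \<in> conv_series" "c \<in> conv_series"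
    by (auto simp: conv_ideal3_def)
  have "C = const2 m * F - \<alpha> * A - \<beta> * B" unfolding assms(1)[symmetric] by simp
  then have "g = a * A + b * B + c * (const2 m * F - \<alpha> * A - \<beta> * B)" using *(1) by simp
  then have "g = (c * const2 m) * F + (a - c * \<alpha>) * A + (b - c * \<beta>) * B"
    by (simp add: algebra_simps)
  then show "g \<in> conv_ideal3 F A B"
    using * assms(3,4) by (simp only:) (intro conv_ideal3I conv_diff conv_mult conv_const)
qed

lemma derivation_dx2: "is_derivation dx2"
proof -
  have "dx2 (a + b) = dx2 a + dx2 b" for a b by (rule fps_ext) (simp add: dx2_def)
  moreover have "dx2 (a * b) = dx2 a * b + a * dx2 b" for a b
    by (rule fps_ext) (simp add: dx2_def fps_mult_nth fps_deriv_sum sum.distrib add.commute)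
  ultimately show ?thesis by (simp add: is_derivation_def)
qed

lemma derivation_dy2: "is_derivation dy2"
  by (simp add: is_derivation_def dy2_def algebra_simps)

lemma dx2_dy2_simps [simp]:
  "dx2 (const2 c) = 0" "dx2 x2 = 1" "dx2 y2 = 0" "dx2 1 = 0" "dx2 (g + h) = dx2 g + dx2 h"
  "dy2 (const2 c) = 0" "dy2 x2 = 0" "dy2 y2 = 1" "dy2 1 = 0" "dy2 (g + h) = dy2 g + dy2 h"
proof -
  show "dx2 (g + h) = dx2 g + dx2 h" "dx2 1 = 0" "dy2 (g + h) = dy2 g + dy2 h" "dy2 1 = 0"
    using derivationD[OF derivation_dx2] derivationD[OF derivation_dy2] by auto
qed (auto intro!: fps_ext simp: dx2_def dy2_def const2_def x2_def y2_def fps_X_def)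

text \<open>\<open>\<theta>\<close> dehomogenizes with respect to \<open>s0\<close>, which is the coordinate that \<open>local_equation\<close> sets to \<open>1\<close>;
  \<open>s1\<close> and \<open>s2\<close> become the local coordinates at \<open>p\<close>.\<close>

lemma chart:
  assumes f: "f \<in> forms m" and m: "m > 0"
  shows "\<exists>\<theta> s1 s2 s0. ring_hom_on_UNIV \<theta> \<and> (\<forall>c. \<theta> (const3 c) = const2 c) \<and>
     \<theta> s1 = x2 \<and> \<theta> s2 = y2 \<and> \<theta> s0 = 1 \<and> s1 \<in> forms 1 \<and> s2 \<in> forms 1 \<and> s0 \<in> forms 1 \<and>
     (\<forall>n. forms n \<subseteq> coord_forms s1 s2 s0 n) \<and>
     eval3 s1 (rep_P2 p) = 0 \<and> eval3 s2 (rep_P2 p) = 0 \<and> eval3 s0 (rep_P2 p) \<noteq> 0 \<and>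
     tjurina_ideal (local_equation f p) = conv_ideal3 (\<theta> (dX f)) (\<theta> (dY f)) (\<theta> (dZ f))"
proof -
  define v where "v = rep_P2 p"
  have v0: "v \<noteq> 0" using rep_P2_nonzero by (simp add: v_def)
  have tj: "tjurina_ideal g = conv_ideal3 g (dx2 g) (dy2 g)" for g
    by (simp add: tjurina_ideal_def conv_ideal3_def)
  define \<theta> where "\<theta> \<alpha> \<beta> \<gamma> F = subst3 const2 F \<alpha> \<beta> \<gamma>" for \<alpha> \<beta> \<gamma> F
  note hom = subst3_hom[OF ring_hom_const2, folded \<theta>_def]
  have euler: "\<alpha> * \<theta> \<alpha> \<beta> \<gamma> (dX f) + \<beta> * \<theta> \<alpha> \<beta> \<gamma> (dY f) + \<gamma> * \<theta> \<alpha> \<beta> \<gamma> (dZ f)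
      = const2 (of_nat m) * \<theta> \<alpha> \<beta> \<gamma> f" for \<alpha> \<beta> \<gamma>
    using arg_cong[OF euler_identity[OF f], of "\<theta> \<alpha> \<beta> \<gamma>"]
    by (simp add: ring_homD[OF hom(1)] hom flip: const3_of_nat)
  have dx: "dx2 (\<theta> \<alpha> \<beta> \<gamma> f) = \<theta> \<alpha> \<beta> \<gamma> (dX f) * dx2 \<alpha> + \<theta> \<alpha> \<beta> \<gamma> (dY f) * dx2 \<beta> + \<theta> \<alpha> \<beta> \<gamma> (dZ f) * dx2 \<gamma>"
   and dy: "dy2 (\<theta> \<alpha> \<beta> \<gamma> f) = \<theta> \<alpha> \<beta> \<gamma> (dX f) * dy2 \<alpha> + \<theta> \<alpha> \<beta> \<gamma> (dY f) * dy2 \<beta> + \<theta> \<alpha> \<beta> \<gamma> (dZ f) * dy2 \<gamma>"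
   for \<alpha> \<beta> \<gamma>
    using derivation_comp_poly3[OF derivation_dx2 hom(1), of \<alpha> \<beta> \<gamma> f]
      derivation_comp_poly3[OF derivation_dy2 hom(1), of \<alpha> \<beta> \<gamma> f] by (simp_all add: hom)
  have m0: "of_nat m \<noteq> (0 :: complex)" using m by simp
  have lin: "a \<in> conv_series \<Longrightarrow> const2 c + a \<in> conv_series" for a c by (intro conv_add conv_const)
  \<comment> \<open>The cases follow the choice of chart in \<open>local_equation\<close>. The Euler
    relation brings in the partial belonging to the coordinate set to \<open>1\<close>, so the
    generators have to be reordered in the last two charts.\<close>
  show ?thesis
  proof (cases "v $ 3 = 0")
    case False
    let ?a = "v $ 1 / v $ 3" and ?b = "v $ 2 / v $ 3"
    let ?t = "\<theta> (const2 ?a + x2) (const2 ?b + y2) 1"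
    have le: "local_equation f p = ?t f"
      using False by (simp add: local_equation_def \<theta>_def v_def Let_def)
    have "tjurina_ideal (?t f) = conv_ideal3 (?t (dX f)) (?t (dY f)) (?t (dZ f))"
      unfolding tj dx dy
      using conv_ideal3_euler[OF _ m0 lin lin] euler[of "const2 ?a + x2" "const2 ?b + y2" 1]
      by simp
    moreover have "X3 \<in> coord_forms (X3 - const3 ?a * Z3) (Y3 - const3 ?b * Z3) Z3 1"
      "Y3 \<in> coord_forms (X3 - const3 ?a * Z3) (Y3 - const3 ?b * Z3) Z3 1"
      "Z3 \<in> coord_forms (X3 - const3 ?a * Z3) (Y3 - const3 ?b * Z3) Z3 1"
      using coord_forms_linear[of 1 "X3 - const3 ?a * Z3" 0 "Y3 - const3 ?b * Z3" ?a Z3]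
        coord_forms_linear[of 0 "X3 - const3 ?a * Z3" 1 "Y3 - const3 ?b * Z3" ?b Z3]
        coord_forms_linear[of 0 "X3 - const3 ?a * Z3" 0 "Y3 - const3 ?b * Z3" 1 Z3] by simp_all
    ultimately show ?thesis
      using False unfolding le v_def[symmetric]
      by (intro exI[of _ ?t] exI[of _ "X3 - const3 ?a * Z3"] exI[of _ "Y3 - const3 ?b * Z3"] exI[of _ Z3]
          conjI allI hom(1) forms_subset_coord_forms forms_diff forms_const_mult X3_forms Y3_forms Z3_forms)
        (simp_all add: hom ring_homD[OF hom(1)])
  next
    case v3: True
    show ?thesis
    proof (cases "v $ 2 = 0")
      case False
      let ?a = "v $ 1 / v $ 2"
      let ?t = "\<theta> (const2 ?a + x2) 1 y2"
      have le: "local_equation f p = ?t f"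
        using False v3 by (simp add: local_equation_def \<theta>_def v_def Let_def)
      have "tjurina_ideal (?t f) = conv_ideal3 (?t (dX f)) (?t (dZ f)) (?t (dY f))"
        unfolding tj dx dy
        using conv_ideal3_euler[OF _ m0 lin conv_y2] euler[of "const2 ?a + x2" 1 y2]
        by (simp add: add_ac)
      then have "tjurina_ideal (?t f) = conv_ideal3 (?t (dX f)) (?t (dY f)) (?t (dZ f))"
        using conv_ideal3_swap by simp
      moreover have "X3 \<in> coord_forms (X3 - const3 ?a * Y3) Z3 Y3 1"
        "Y3 \<in> coord_forms (X3 - const3 ?a * Y3) Z3 Y3 1"
        "Z3 \<in> coord_forms (X3 - const3 ?a * Y3) Z3 Y3 1"
        using coord_forms_linear[of 1 "X3 - const3 ?a * Y3" 0 Z3 ?a Y3]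
          coord_forms_linear[of 0 "X3 - const3 ?a * Y3" 0 Z3 1 Y3]
          coord_forms_linear[of 0 "X3 - const3 ?a * Y3" 1 Z3 0 Y3] by simp_all
      ultimately show ?thesis
        using False v3 unfolding le v_def[symmetric]
        by (intro exI[of _ ?t] exI[of _ "X3 - const3 ?a * Y3"] exI[of _ Z3] exI[of _ Y3]
            conjI allI hom(1) forms_subset_coord_forms forms_diff forms_const_mult X3_forms Y3_forms Z3_forms)
          (simp_all add: hom ring_homD[OF hom(1)])
    next
      case v2: True
      have v1: "v $ 1 \<noteq> 0" using v0 v2 v3 by (auto simp: vec_eq_iff forall_3)
      let ?t = "\<theta> 1 x2 y2"
      have le: "local_equation f p = ?t f"
        using v2 v3 by (simp add: local_equation_def \<theta>_def v_def Let_def)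
      have "tjurina_ideal (?t f) = conv_ideal3 (?t (dY f)) (?t (dZ f)) (?t (dX f))"
        unfolding tj dx dy
        using conv_ideal3_euler[OF _ m0 conv_x2 conv_y2] euler[of 1 x2 y2]
        by (simp add: add_ac)
      then have "tjurina_ideal (?t f) = conv_ideal3 (?t (dX f)) (?t (dY f)) (?t (dZ f))"
        unfolding conv_ideal3_rotate[of "?t (dY f)"] .
      moreover have "X3 \<in> coord_forms Y3 Z3 X3 1" "Y3 \<in> coord_forms Y3 Z3 X3 1" "Z3 \<in> coord_forms Y3 Z3 X3 1"
        using coord_forms_linear[of 0 Y3 0 Z3 1 X3] coord_forms_linear[of 1 Y3 0 Z3 0 X3]
          coord_forms_linear[of 0 Y3 1 Z3 0 X3] by simp_all
      ultimately show ?thesis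
        using v1 v2 v3 unfolding le v_def[symmetric]
        by (intro exI[of _ ?t] exI[of _ Y3] exI[of _ Z3] exI[of _ X3]
            conjI allI hom(1) forms_subset_coord_forms X3_forms Y3_forms Z3_forms)
          (simp_all add: hom ring_homD[OF hom(1)])
    qed
  qed
qed

section \<open>From the local to the global Jacobian ideal\<close>

lemma homog_X_power:
  assumes "degree q \<le> e"
  shows "homog ([:0, 1:] ^ k * q) u w (e + k) = u ^ k * homog q u w e"
proof (induction k)
  case (Suc k)
  have "degree ([:0, 1:] ^ k * q) \<le> degree ([:0, 1 :: complex:] ^ k) + degree q" by (rule degree_mult_le)
  also have "\<dots> \<le> e + k" using assms by (simp add: degree_power_eq)
  finally have "homog ([:- 0, 1:] * ([:0, 1:] ^ k * q)) u w (Suc (e + k))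
      = (u - const3 0 * w) * homog ([:0, 1:] ^ k * q) u w (e + k)" by (rule homog_root_factor)
  then show ?case unfolding Suc by (simp add: mult.assoc)
qed simp

text \<open>An annihilating polynomial of \<open>s / w\<close> is a power of the variable times some
  \<open>q\<close> with nonzero constant term. As \<open>s\<close> vanishes at \<open>v\<close>, the
  homogenisation of \<open>q\<close> takes the nonzero value
  \<open>coeff q 0 * eval3 w v ^ e\<close> there; so \<open>s\<close> is nilpotent near
  \<open>v\<close> modulo the ideal.\<close>

lemma power_times_form_in_saturation:
  assumes "is_ideal J" "w \<in> forms 1" "PS.dim (forms (N + D)) \<le> PS.dim (J \<inter> forms (N + D)) + D"
    and s: "s \<in> forms 1" "eval3 s v = 0" and wv: "eval3 w v \<noteq> 0"
  shows "\<exists>k e G. G \<in> forms e \<and> eval3 G v \<noteq> 0 \<and> s ^ k * G \<in> saturation w J"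
proof -
  obtain \<rho> where \<rho>: "\<rho> \<noteq> 0" "degree \<rho> \<le> D" "homog \<rho> s w D \<in> saturation w J"
    using homog_in_saturation[OF assms(1) s(1) assms(2,3)] by blast
  define k where "k = order 0 \<rho>"
  obtain q where q: "\<rho> = [:0, 1:] ^ k * q" "\<not> [:0, 1:] dvd q"
    using order_decomp[OF \<rho>(1), of 0] by (auto simp: k_def)
  have q0: "q \<noteq> 0" "coeff q 0 \<noteq> 0"
    using q \<rho>(1) poly_eq_0_iff_dvd[of q 0] by (auto simp: poly_0_coeff_0)
  have deg: "degree \<rho> = k + degree q"
    using q0 unfolding q(1) by (simp add: degree_mult_eq degree_power_eq)
  define e where "e = D - k"
  have e: "D = e + k" "degree q \<le> e" using deg \<rho>(2) by (auto simp: e_def)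
  have "s ^ k * homog q s w e \<in> saturation w J"
    using \<rho>(3) unfolding q(1) e(1) homog_X_power[OF e(2)] .
  moreover have "homog q s w e \<in> forms e" by (rule homog_forms[OF s(1) assms(2)])
  moreover have "eval3 (homog q s w e) v = (\<Sum>i\<le>e. if i = 0 then coeff q 0 * eval3 w v ^ e else 0)"
    unfolding homog_def eval3_sum by (intro sum.cong) (auto simp: s(2) power_0_left)
  ultimately show ?thesis using q0(2) wv by (intro exI[of _ k] exI[of _ e] exI[of _ "homog q s w e"]) simp
qed

definition jacobian_ideal :: "poly3 \<Rightarrow> poly3 set" where
  "jacobian_ideal f = {a * dX f + b * dY f + c * dZ f |a b c. True}"

lemma jacobian_idealI: "a * dX f + b * dY f + c * dZ f \<in> jacobian_ideal f"
  by (auto simp: jacobian_ideal_def)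

lemma jacobian_ideal_ideal: "is_ideal (jacobian_ideal f)"
  unfolding is_ideal_def
proof (intro conjI ballI allI)
  show "0 \<in> jacobian_ideal f" using jacobian_idealI[of 0 f 0 0] by simp
  fix g assume "g \<in> jacobian_ideal f"
  then obtain a b c where g: "g = a * dX f + b * dY f + c * dZ f" by (auto simp: jacobian_ideal_def)
  show "r * g \<in> jacobian_ideal f" for r
    using jacobian_idealI[of "r * a" f "r * b" "r * c"] by (simp add: g algebra_simps)
  fix h assume "h \<in> jacobian_ideal f"
  then obtain a' b' c' where h: "h = a' * dX f + b' * dY f + c' * dZ f" by (auto simp: jacobian_ideal_def)
  show "g + h \<in> jacobian_ideal f"
    using jacobian_idealI[of "a + a'" f "b + b'" "c + c'"] by (simp add: g h algebra_simps)
qed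

lemma nth2_mult_low_order:
  assumes "\<And>i j. i + j < N \<Longrightarrow> nth2 g i j = 0" "i + j < N"
  shows "nth2 (g * h) i j = 0"
  unfolding nth2_mult using assms by (intro sum.neutral ballI) auto

text \<open>The \<open>\<phi> i\<close> are the coordinates of the germ at \<open>p\<close> in the Tjurina algebra.\<close>

lemma local_functionals:
  assumes f: "f \<in> forms m" "m > 0" and w: "w \<in> forms 1" "eval3 w (rep_P2 p) \<noteq> 0"
    and dim: "PS.dim (forms (N + D)) \<le> PS.dim (jacobian_ideal f \<inter> forms (N + D)) + D"
  shows "\<exists>(\<phi> :: nat \<Rightarrow> poly3 \<Rightarrow> complex) H e N'.
    (\<forall>i x y. \<phi> i (x + y) = \<phi> i x + \<phi> i y) \<and> (\<forall>i c x. \<phi> i (const3 c * x) = c * \<phi> i x) \<and>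
    H \<in> forms e \<and> eval3 H (rep_P2 p) \<noteq> 0 \<and>
    (\<forall>n\<ge>N'. \<forall>g\<in>forms n. (\<forall>i<tjurina f p. \<phi> i g = 0) \<longrightarrow> H * g \<in> jacobian_ideal f)"
proof -
  define J where "J = jacobian_ideal f"
  have J: "is_ideal J" unfolding J_def by (rule jacobian_ideal_ideal)
  define v where "v = rep_P2 p"
  obtain \<theta> s1 s2 s0 where \<theta>: "ring_hom_on_UNIV \<theta>" "\<And>c. \<theta> (const3 c) = const2 c"
      "\<theta> s1 = x2" "\<theta> s2 = y2" "\<theta> s0 = 1"
    and s: "s1 \<in> forms 1" "s2 \<in> forms 1" "s0 \<in> forms 1" "\<And>n. forms n \<subseteq> coord_forms s1 s2 s0 n"
      "eval3 s1 v = 0" "eval3 s2 v = 0" "eval3 s0 v \<noteq> 0"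
    and tj: "tjurina_ideal (local_equation f p) = conv_ideal3 (\<theta> (dX f)) (\<theta> (dY f)) (\<theta> (dZ f))"
    using chart[OF f, of p] unfolding v_def by blast
  note h = ring_homD[OF \<theta>(1)]
  define I where "I = conv_ideal3 (\<theta> (dX f)) (\<theta> (dY f)) (\<theta> (dZ f))"
  \<comment> \<open>Dehomogenisation loses nothing in a fixed degree: the coefficients in
    \<open>s1\<close>, \<open>s2\<close>, \<open>s0\<close> are those of the power series.\<close>
  have expand: "\<exists>c. F = (\<Sum>(i, j, k)\<in>exps n. const3 (c i j k) * (s1 ^ i * s2 ^ j * s0 ^ k)) \<and>
      \<theta> F = (\<Sum>(i, j, k)\<in>exps n. const2 (c i j k) * (x2 ^ i * y2 ^ j)) \<and>
      (\<forall>i j k. i + j + k = n \<longrightarrow> nth2 (\<theta> F) i j = c i j k)" if F: "F \<in> forms n" for F n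
  proof -
    obtain c where c: "F = (\<Sum>(i, j, k)\<in>exps n. const3 (c i j k) * (s1 ^ i * s2 ^ j * s0 ^ k))"
      using subsetD[OF s(4) F] by (auto simp: coord_forms_def)
    have \<theta>F: "\<theta> F = (\<Sum>(i, j, k)\<in>exps n. const2 (c i j k) * (x2 ^ i * y2 ^ j))"
      unfolding c ring_hom_sum[OF \<theta>(1)] by (simp add: case_prod_unfold h \<theta>)
    have "nth2 (\<theta> F) i j = c i j k" if ijk: "i + j + k = n" for i j k
    proof -
      have "nth2 (\<theta> F) i j = (\<Sum>e\<in>exps n. if e = (i, j, k) then c i j k else 0)"
        unfolding \<theta>F nth2_sum using ijk
        by (intro sum.cong) (auto simp: nth2_monomial exps_def split: if_splits)
      moreover have "(i, j, k) \<in> exps n" using ijk by (simp add: exps_def)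
      ultimately show ?thesis by simp
    qed
    then show ?thesis using c \<theta>F by blast
  qed
  have \<theta>conv: "\<theta> F \<in> conv_series" for F
  proof (induction F rule: poly3_mono3_induct)
    case (mono c i j k)
    obtain d where "\<theta> (mono3 i j k) = (\<Sum>(i', j', k')\<in>exps (i + j + k). const2 (d i' j' k') * (x2 ^ i' * y2 ^ j'))"
      using expand[OF mono3_forms[OF refl]] by blast
    then have "\<theta> (mono3 i j k) \<in> conv_series"
      by (auto intro!: conv_sum conv_mult conv_power)
    then show ?case by (simp add: h \<theta> conv_mult)
  qed (simp add: h conv_add)
  have \<theta>J: "\<theta> F \<in> I" if "F \<in> J" for F
    using that \<theta>conv unfolding J_def jacobian_ideal_def I_def by (auto simp: h intro!: conv_ideal3I)
  obtain k1 e1 G1 where G1: "G1 \<in> forms e1" "eval3 G1 v \<noteq> 0" "s1 ^ k1 * G1 \<in> saturation w J"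
    using power_times_form_in_saturation[OF J w(1) _ s(1,5)] dim w(2) unfolding v_def J_def by blast
  obtain k2 e2 G2 where G2: "G2 \<in> forms e2" "eval3 G2 v \<noteq> 0" "s2 ^ k2 * G2 \<in> saturation w J"
    using power_times_form_in_saturation[OF J w(1) _ s(2,6)] dim w(2) unfolding v_def J_def by blast
  obtain j1 where j1: "w ^ j1 * (s1 ^ k1 * G1) \<in> J" using G1(3) by (auto simp: saturation_def)
  obtain j2 where j2: "w ^ j2 * (s2 ^ k2 * G2) \<in> J" using G2(3) by (auto simp: saturation_def)
  \<comment> \<open>A single form, nonzero at \<open>p\<close>, that multiplies both
    \<open>s1 ^ K\<close> and \<open>s2 ^ K\<close> into \<open>J\<close>; the powers of
    \<open>w\<close> undo the two saturations.\<close>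
  define H where "H = w ^ (j1 + j2) * (G1 * G2)"
  define e where "e = j1 + j2 + (e1 + e2)"
  define K where "K = k1 + k2"
  have H: "H \<in> forms e" "eval3 H v \<noteq> 0"
    using forms_mult[OF forms_linear_power[OF w(1)] forms_mult[OF G1(1) G2(1)], of "j1 + j2"] G1(2) G2(2) w(2)
    by (simp_all add: H_def e_def v_def)
  have s1H: "s1 ^ i * H \<in> J" if "K \<le> i" for i
  proof -
    have "i = (i - k1) + k1" using that by (simp add: K_def)
    then have "s1 ^ i * H = (s1 ^ (i - k1) * w ^ j2 * G2) * (w ^ j1 * (s1 ^ k1 * G1))"
      unfolding H_def by (metis (no_types, lifting) mult.assoc mult.commute mult.left_commute power_add)
    then show ?thesis using idealD(3)[OF J j1] by metis
  qed
  have s2H: "s2 ^ i * H \<in> J" if "K \<le> i" for i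
  proof -
    have "i = (i - k2) + k2" using that by (simp add: K_def)
    then have "s2 ^ i * H = (s2 ^ (i - k2) * w ^ j1 * G1) * (w ^ j2 * (s2 ^ k2 * G2))"
      unfolding H_def by (metis (no_types, lifting) mult.assoc mult.commute mult.left_commute power_add)
    then show ?thesis using idealD(3)[OF J j2] by metis
  qed
  obtain c where c: "H = (\<Sum>(i, j, k)\<in>exps e. const3 (c i j k) * (s1 ^ i * s2 ^ j * s0 ^ k))"
      "\<And>i j k. i + j + k = e \<Longrightarrow> nth2 (\<theta> H) i j = c i j k"
    using expand[OF H(1)] by blast
  \<comment> \<open>At \<open>p\<close> only the monomial \<open>s0 ^ e\<close> survives. Its
    coefficient is the constant term of \<open>\<theta> H\<close>, which is therefore a
    unit.\<close>
  have "eval3 H v = (\<Sum>x\<in>exps e. if x = (0, 0, e) then c 0 0 e * eval3 s0 v ^ e else 0)"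
    unfolding c(1) eval3_sum using s(5,6) by (intro sum.cong) (auto simp: power_0_left exps_def split: if_splits)
  moreover have "(0, 0, e) \<in> exps e" by (simp add: exps_def)
  ultimately have "eval3 H v = c 0 0 e * eval3 s0 v ^ e" by simp
  then have "nth2 (\<theta> H) 0 0 \<noteq> 0" using H(2) c(2)[of 0 0 e] by auto
  then obtain u where u: "u \<in> conv_series" "\<theta> H * u = 1" using conv_inverse[OF \<theta>conv] by blast
  have xI: "x2 ^ K \<in> I" and yI: "y2 ^ K \<in> I"
  proof -
    have "x2 ^ K = u * \<theta> (s1 ^ K * H)" "y2 ^ K = u * \<theta> (s2 ^ K * H)"
      using u(2) by (simp_all add: h \<theta> mult_ac)
    then show "x2 ^ K \<in> I" "y2 ^ K \<in> I"
      using conv_ideal3_mult[OF \<theta>J[unfolded I_def] u(1)] s1H[of K] s2H[of K] unfolding I_def by auto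
  qed
  \<comment> \<open>All convergent series of order at least \<open>2 * K\<close> lie in
    \<open>I\<close>, so finitely many monomials span the quotient and its dimension exists.\<close>
  have highI: "g \<in> I" if g: "g \<in> conv_series" "\<And>i j. i + j < 2 * K \<Longrightarrow> nth2 g i j = 0" for g
  proof -
    obtain a b where ab: "a \<in> conv_series" "b \<in> conv_series" "g = a * x2 ^ K + b * y2 ^ K"
      using conv_high_order[OF g] by (metis mult.commute)
    then show ?thesis using xI yI unfolding I_def by (auto intro: conv_ideal3_add conv_ideal3_mult)
  qed
  have subI: "SS.subspace I" unfolding I_def by (rule conv_ideal3_subspace)
  have IV: "I \<subseteq> conv_series"
    unfolding I_def conv_ideal3_def using \<theta>conv by (auto intro!: conv_add conv_mult)
  define B where "B = (\<lambda>(i, j). x2 ^ i * y2 ^ j) ` ({..<2 * K} \<times> {..<2 * K})"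
  have trB: "truncate2 (2 * K) g \<in> SS.span (I \<union> B)" for g
    unfolding truncate2_def scale2_def[symmetric]
  proof (rule SS.span_sum)
    fix e assume e: "e \<in> {..<2 * K} \<times> {..<2 * K}"
    then have "(case e of (i, j) \<Rightarrow> x2 ^ i * y2 ^ j) \<in> I \<union> B" unfolding B_def by blast
    then show "(case e of (i, j) \<Rightarrow> scale2 (if i + j < 2 * K then nth2 g i j else 0) (x2 ^ i * y2 ^ j))
        \<in> SS.span (I \<union> B)"
      by (cases e) (simp add: SS.span_scale SS.span_base)
  qed
  have "conv_series \<subseteq> SS.span (I \<union> B)"
  proof
    fix g assume g: "g \<in> conv_series"
    have "g - truncate2 (2 * K) g \<in> I"
      using g by (intro highI conv_diff conv_truncate2) (auto simp: nth2_truncate2)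
    then have "g - truncate2 (2 * K) g \<in> SS.span (I \<union> B)" by (intro SS.span_base) auto
    from SS.span_add[OF this trB[of g]] show "g \<in> SS.span (I \<union> B)" by simp
  qed
  moreover have "B \<subseteq> conv_series" by (auto simp: B_def intro!: conv_mult conv_power)
  moreover have "finite B" by (simp add: B_def)
  ultimately obtain n0 where n0: "has_quotient_dim conv_series I n0"
    using has_quotient_dim_exists[OF conv_series_subspace subI IV] by blast
  then have "tjurina f p = n0"
    unfolding tjurina_def tj I_def[symmetric]
    using has_quotient_dim_le[OF conv_series_subspace subI]
    by (intro the_equality) (auto intro: antisym)
  then have "has_quotient_dim conv_series I (tjurina f p)" using n0 by simp
  from has_quotient_dim_functionals[OF conv_series_subspace subI this]
  obtain \<psi> :: "nat \<Rightarrow> series2 \<Rightarrow> complex" where \<psi>: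
    "\<And>i x y. x \<in> conv_series \<Longrightarrow> y \<in> conv_series \<Longrightarrow> \<psi> i (x + y) = \<psi> i x + \<psi> i y"
    "\<And>i c x. x \<in> conv_series \<Longrightarrow> \<psi> i (const2 c * x) = c * \<psi> i x"
    "\<And>x. x \<in> conv_series \<Longrightarrow> \<forall>i<tjurina f p. \<psi> i x = 0 \<Longrightarrow> x \<in> I"
    by metis
  have lift: "\<exists>A\<in>forms n. \<theta> A = truncate2 (2 * K) a" if n: "2 * K \<le> n" for a n
  proof -
    define A where "A = (\<Sum>(i, j)\<in>{..<2 * K} \<times> {..<2 * K}.
      const3 (if i + j < 2 * K then nth2 a i j else 0) * (s1 ^ i * s2 ^ j * s0 ^ (n - i - j)))"
    have "\<theta> A = truncate2 (2 * K) a"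
      unfolding A_def truncate2_def ring_hom_sum[OF \<theta>(1)] by (simp add: case_prod_unfold h \<theta>)
    moreover have "s1 ^ i * s2 ^ j * s0 ^ (n - i - j) \<in> forms n" if "i + j < 2 * K" for i j
      using forms_mult[OF forms_mult[OF forms_linear_power[OF s(1), of i] forms_linear_power[OF s(2), of j]]
          forms_linear_power[OF s(3), of "n - i - j"]] that n by simp
    then have "(case x of (i, j) \<Rightarrow> const3 (if i + j < 2 * K then nth2 a i j else 0) *
        (s1 ^ i * s2 ^ j * s0 ^ (n - i - j))) \<in> forms n" for x
      by (cases x) (simp add: forms_const_mult)
    then have "A \<in> forms n" unfolding A_def by (intro forms_sum)
    ultimately show ?thesis by blast
  qed
  have final: "H * g \<in> J"
    if n: "2 * K + (m - 1) \<le> n" and g: "g \<in> forms n" and z: "\<forall>i<tjurina f p. \<psi> i (\<theta> g) = 0" for n g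
  proof -
    have "\<theta> g \<in> I" using \<psi>(3)[OF \<theta>conv z] .
    then obtain a b c where abc: "\<theta> g = a * \<theta> (dX f) + b * \<theta> (dY f) + c * \<theta> (dZ f)"
      "a \<in> conv_series" "b \<in> conv_series" "c \<in> conv_series"
      by (auto simp: I_def conv_ideal3_def)
    let ?n = "n - (m - 1)"
    have le: "2 * K \<le> ?n" "?n + (m - 1) = n" using n by auto
    obtain A B C where ABC: "A \<in> forms ?n" "\<theta> A = truncate2 (2 * K) a" "B \<in> forms ?n" "\<theta> B = truncate2 (2 * K) b"
      "C \<in> forms ?n" "\<theta> C = truncate2 (2 * K) c"
      using lift[OF le(1)] by metis
    \<comment> \<open>Truncating the coefficients leaves a difference \<open>g - j\<close> of order
      at least \<open>2 * K\<close>. Each of its monomials contains \<open>s1 ^ K\<close> or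
      \<open>s2 ^ K\<close>, and \<open>H\<close> multiplies it into \<open>J\<close>.\<close>
    define j where "j = A * dX f + B * dY f + C * dZ f"
    have jJ: "j \<in> J" unfolding J_def j_def by (rule jacobian_idealI)
    have "j \<in> forms (?n + (m - 1))"
      unfolding j_def using ABC(1,3,5) partials_forms[OF f(1)] by (intro forms_add forms_mult)
    then have jf: "j \<in> forms n" unfolding le(2) .
    define G where "G = g - j"
    have "\<theta> G = (a - \<theta> A) * \<theta> (dX f) + (b - \<theta> B) * \<theta> (dY f) + (c - \<theta> C) * \<theta> (dZ f)"
      unfolding G_def j_def by (simp add: h abc(1) algebra_simps)
    then have low: "nth2 (\<theta> G) i i' = 0" if "i + i' < 2 * K" for i i'
      using that nth2_mult_low_order[of "2 * K" "a - \<theta> A"] nth2_mult_low_order[of "2 * K" "b - \<theta> B"]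
        nth2_mult_low_order[of "2 * K" "c - \<theta> C"]
      by (simp add: ABC nth2_truncate2)
    have "G \<in> forms n" unfolding G_def by (rule forms_diff[OF g jf])
    then obtain d where d: "G = (\<Sum>(i, j, k)\<in>exps n. const3 (d i j k) * (s1 ^ i * s2 ^ j * s0 ^ k))"
        "\<And>i j k. i + j + k = n \<Longrightarrow> nth2 (\<theta> G) i j = d i j k"
      using expand by blast
    have summand: "const3 (d i j k) * (s1 ^ i * s2 ^ j * s0 ^ k) * H \<in> J" if ijk: "i + j + k = n" for i j k
    proof -
      consider "i + j < 2 * K" | "K \<le> i" | "K \<le> j" by linarith
      then show ?thesis
      proof cases
        case 1
        then have "d i j k = 0" using low d(2)[OF ijk] by simp
        then show ?thesis using idealD(1)[OF J] by simp
      next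
        case 2
        from idealD(3)[OF J s1H[OF 2], of "const3 (d i j k) * s2 ^ j * s0 ^ k"]
        show ?thesis by (simp add: mult_ac)
      next
        case 3
        from idealD(3)[OF J s2H[OF 3], of "const3 (d i j k) * s1 ^ i * s0 ^ k"]
        show ?thesis by (simp add: mult_ac)
      qed
    qed
    have "G * H \<in> J"
      unfolding d(1) sum_distrib_right using summand by (intro ideal_sum[OF J]) (auto simp: exps_def)
    from idealD(2)[OF J this idealD(4)[OF J jJ, of H]] show ?thesis
      by (simp add: G_def algebra_simps)
  qed
  show ?thesis
    using H final \<psi>(1,2) \<theta>conv unfolding J_def v_def
    by (intro exI[of _ "\<lambda>i g. \<psi> i (\<theta> g)"] exI[of _ H] exI[of _ e] exI[of _ "2 * K + (m - 1)"])
       (simp add: h \<theta>)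
qed

section \<open>Free curves\<close>

definition scale3V :: "complex \<Rightarrow> poly3^3 \<Rightarrow> poly3^3" where "scale3V c r = const3 c *s r"

interpretation PV: vec_space scale3V
  by unfold_locales (simp_all add: scale3V_def vec_eq_iff algebra_simps)

interpretation PVS: vec_space_pair scale3V scale3 ..
interpretation PSV: vec_space_pair scale3 scale3V ..

definition formsV :: "nat \<Rightarrow> (poly3^3) set" where "formsV n = {r. \<forall>i. r $ i \<in> forms n}"

lemma formsV_subspace: "PV.subspace (formsV n)"
  by (auto simp: PV.subspace_def formsV_def scale3V_def intro: forms_add forms_const_mult)

lemma linear_component: "Vector_Spaces.linear scale3V scale3 (\<lambda>r. r $ i)"
  by (simp add: Vector_Spaces.linear_iff PS.vector_space_axioms PV.vector_space_axioms scale3_def scale3V_def)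

lemma linear_smult_vector: "Vector_Spaces.linear scale3 scale3V (\<lambda>c. c *s r)"
  by (simp add: Vector_Spaces.linear_iff PS.vector_space_axioms PV.vector_space_axioms scale3_def
      scale3V_def vec_eq_iff algebra_simps)

lemma formsV_fin_dim: "PV.fin_dim (formsV n)"
proof -
  obtain B where B: "finite B" "forms n \<subseteq> PS.span B" using forms_fin_dim by (auto simp: PS.fin_dim_def)
  define B' where "B' = (\<Union>i::3. (\<lambda>b. b *s axis i (1 :: poly3)) ` B)"
  have "formsV n \<subseteq> PV.span B'"
  proof
    fix r :: "poly3^3" assume r: "r \<in> formsV n"
    have "r $ i *s axis i 1 \<in> PV.span B'" for i
    proof -
      have "r $ i *s axis i 1 \<in> (\<lambda>b. b *s axis i 1) ` PS.span B"
        using r B(2) by (auto simp: formsV_def)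
      also have "\<dots> = PV.span ((\<lambda>b. b *s axis i 1) ` B)"
        using PSV.linear_span_image[OF linear_smult_vector] by simp
      also have "\<dots> \<subseteq> PV.span B'" by (rule PV.span_mono) (auto simp: B'_def)
      finally show ?thesis .
    qed
    then have "(\<Sum>i\<in>UNIV. r $ i *s axis i 1) \<in> PV.span B'" by (intro PV.span_sum)
    also have "(\<Sum>i\<in>UNIV. r $ i *s axis i 1) = r" by (rule basis_expansion)
    finally show "r \<in> PV.span B'" .
  qed
  moreover have "finite B'" using B(1) by (simp add: B'_def)
  ultimately show ?thesis by (auto simp: PV.fin_dim_def)
qed

lemma dim_formsV: "PV.dim (formsV n) = 3 * PS.dim (forms n)"
proof -
  define K1 where "K1 = {r \<in> formsV n. r $ 1 = 0}"
  define K2 where "K2 = {r \<in> K1. r $ 2 = 0}"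
  have sub: "PV.subspace K1" "PV.subspace K2"
    using formsV_subspace[of n] by (auto simp: K1_def K2_def PV.subspace_def scale3V_def)
  have fin: "PV.fin_dim K1" "PV.fin_dim K2"
    by (auto intro!: PV.fin_dim_subset[OF formsV_fin_dim[of n]] simp: K1_def K2_def)
  have wit: "\<exists>r \<in> formsV n. r $ i = a \<and> (\<forall>j. j \<noteq> i \<longrightarrow> r $ j = 0)" if "a \<in> forms n" for a i
    using that by (intro bexI[of _ "axis i a"]) (auto simp: formsV_def axis_def)
  have "(\<lambda>r. r $ 1) ` formsV n = forms n"
    using wit[of _ 1] by (auto simp: formsV_def image_iff)
  moreover have "(\<lambda>r. r $ 2) ` K1 = forms n"
  proof (intro equalityI subsetI)
    fix a assume "a \<in> forms n"
    then obtain r :: "poly3^3" where "r \<in> formsV n" "r $ 2 = a" "\<forall>j. j \<noteq> 2 \<longrightarrow> r $ j = 0" using wit[of a 2] by blast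
    then show "a \<in> (\<lambda>r. r $ 2) ` K1" by (auto simp: K1_def)
  qed (auto simp: K1_def formsV_def)
  moreover have "(\<lambda>r. r $ 3) ` K2 = forms n"
  proof (intro equalityI subsetI)
    fix a assume "a \<in> forms n"
    then obtain r :: "poly3^3" where "r \<in> formsV n" "r $ 3 = a" "\<forall>j. j \<noteq> 3 \<longrightarrow> r $ j = 0" using wit[of a 3] by blast
    then show "a \<in> (\<lambda>r. r $ 3) ` K2" by (auto simp: K1_def K2_def)
  qed (auto simp: K1_def K2_def formsV_def)
  moreover have "{r \<in> K2. r $ 3 = 0} \<subseteq> PV.span {}"
    by (auto simp: K1_def K2_def vec_eq_iff forall_3)
  then have "PV.dim {r \<in> K2. r $ 3 = 0} = 0"
    using PV.dim_le_card[OF _ finite.emptyI] by simp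
  ultimately show ?thesis
    using PVS.dim_rank_nullity(1)[OF linear_component[of 1] formsV_subspace[of n] formsV_fin_dim]
      PVS.dim_rank_nullity(1)[OF linear_component[of 2] sub(1) fin(1)]
      PVS.dim_rank_nullity(1)[OF linear_component[of 3] sub(2) fin(2)]
    unfolding K1_def[symmetric] K2_def[symmetric] by simp
qed

text \<open>The dimension count for the graded pieces of \<open>0 \<rightarrow> AR f \<rightarrow> S\<^sup>3 \<rightarrow> J \<rightarrow> 0\<close>.\<close>

lemma free_dim_formula:
  assumes f: "f \<in> forms m" and free: "free_curve f"
  shows "\<exists>e1 e2. \<forall>n\<ge>max e1 e2. 3 * PS.dim (forms n)
    = PS.dim (jacobian_ideal f \<inter> forms (n + (m - 1))) + PS.dim (forms (n - e1)) + PS.dim (forms (n - e2))"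
proof -
  obtain B :: "(poly3^3) set" where B: "card B = 2" "\<forall>r\<in>B. \<exists>e. \<forall>i. homogeneous e (r $ i)" "S3.independent B" "S3.span B = AR f"
    using free by (auto simp: free_curve_def)
  obtain r1 r2 where r: "B = {r1, r2}" "r1 \<noteq> r2" using B(1) by (auto simp: card_2_iff)
  obtain e1 e2 where e: "\<And>i. r1 $ i \<in> forms e1" "\<And>i. r2 $ i \<in> forms e2"
    using B(2) r by (auto simp: forms_def)
  have AR: "AR f = {a *s r1 + b *s r2 |a b. True}"
    unfolding B(4)[symmetric] r(1) S3.span_insert S3.span_empty by (auto simp: algebra_simps)
  have ind: "a = 0 \<and> b = 0" if "a *s r1 + b *s r2 = 0" for a b
  proof -
    let ?u = "\<lambda>r. if r = r1 then a else b"
    have "(\<Sum>v\<in>B. ?u v *s v) = 0" using that r by simp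
    then have "?u v = 0" if "v \<in> B" for v using S3.independentD[OF B(3) _ order_refl _ that, of ?u] r by simp
    from this[of r1] this[of r2] show ?thesis using r by auto
  qed
  have r0: "a *s r1 = 0 \<Longrightarrow> a = 0" "b *s r2 = 0 \<Longrightarrow> b = 0" for a b
    using ind[of a 0] ind[of 0 b] by auto
  have "3 * PS.dim (forms n)
    = PS.dim (jacobian_ideal f \<inter> forms (n + (m - 1))) + PS.dim (forms (n - e1)) + PS.dim (forms (n - e2))"
    if n: "n \<ge> max e1 e2" for n
  proof -
    define \<Phi> where "\<Phi> = (\<lambda>r. \<Sum>i\<in>UNIV. r $ i * gradient f $ i)"
    have \<Phi>: "\<Phi> r = r $ 1 * dX f + r $ 2 * dY f + r $ 3 * dZ f" for r by (simp add: \<Phi>_def sum_3)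
    have lin: "Vector_Spaces.linear scale3V scale3 \<Phi>"
      by (simp add: Vector_Spaces.linear_iff PS.vector_space_axioms PV.vector_space_axioms \<Phi> scale3_def
          scale3V_def algebra_simps)
    let ?T1 = "(\<lambda>c. c *s r1) ` forms (n - e1)" and ?T2 = "(\<lambda>c. c *s r2) ` forms (n - e2)"
    have T: "PV.subspace ?T1" "PV.subspace ?T2"
      by (rule PSV.linear_subspace_image[OF linear_smult_vector forms_subspace])+
    have dT: "PV.dim ?T1 = PS.dim (forms (n - e1))" "PV.dim ?T2 = PS.dim (forms (n - e2))"
      by (rule PSV.dim_image_inj_on[OF linear_smult_vector forms_subspace forms_fin_dim]; use r0 in blast)+
    have T1V: "?T1 \<subseteq> formsV n"
      using forms_mult[of _ "n - e1" _ e1] e n by (auto simp: formsV_def)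
    have T2V: "?T2 \<subseteq> formsV n"
      using forms_mult[of _ "n - e2" _ e2] e n by (auto simp: formsV_def)
    have int: "?T1 \<inter> ?T2 = {0}"
    proof (intro equalityI subsetI)
      fix x assume "x \<in> ?T1 \<inter> ?T2"
      then obtain a b where ab: "x = a *s r1" "x = b *s r2" by blast
      then have "a *s r1 + (- b) *s r2 = 0" by (simp add: vec_eq_iff)
      then show "x \<in> {0}" using ind ab by fastforce
    qed (use PV.subspace_0[OF T(1)] PV.subspace_0[OF T(2)] in simp)
    have "{r \<in> formsV n. \<Phi> r = 0} = {x + y |x y. x \<in> ?T1 \<and> y \<in> ?T2}"
    proof (intro equalityI subsetI)
      fix r assume "r \<in> {r \<in> formsV n. \<Phi> r = 0}"
      then have rV: "r \<in> formsV n" and "r \<in> AR f" by (auto simp: AR_def \<Phi>_def)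
      then obtain a b where ab: "r = a *s r1 + b *s r2" using AR by blast
      \<comment> \<open>As \<open>r\<close> is homogeneous of degree \<open>n\<close>, the
        coefficients can be cut down to the complementary degrees.\<close>
      have "r = hcomp (n - e1) a *s r1 + hcomp (n - e2) b *s r2"
      proof (rule vec_eq_iff[THEN iffD2], rule allI)
        fix i
        have "r $ i = hcomp n (r $ i)" using rV hcomp_id by (simp add: formsV_def)
        also have "\<dots> = hcomp (n - e1) a * r1 $ i + hcomp (n - e2) b * r2 $ i"
          using n by (simp add: ab hcomp_add hcomp_mult[OF e(1)] hcomp_mult[OF e(2)])
        finally show "r $ i = (hcomp (n - e1) a *s r1 + hcomp (n - e2) b *s r2) $ i" by simp
      qed
      then show "r \<in> {x + y |x y. x \<in> ?T1 \<and> y \<in> ?T2}" using hcomp_forms by blast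
    next
      fix r assume "r \<in> {x + y |x y. x \<in> ?T1 \<and> y \<in> ?T2}"
      then obtain a b where ab: "r = a *s r1 + b *s r2" "a *s r1 \<in> ?T1" "b *s r2 \<in> ?T2" by blast
      then have "r \<in> AR f" using AR by blast
      moreover have "r \<in> formsV n"
        using PV.subspace_add[OF formsV_subspace] T1V T2V ab by blast
      ultimately show "r \<in> {r \<in> formsV n. \<Phi> r = 0}" by (simp add: AR_def \<Phi>_def)
    qed
    moreover have "PV.dim {x + y |x y. x \<in> ?T1 \<and> y \<in> ?T2} + PV.dim (?T1 \<inter> ?T2) = PV.dim ?T1 + PV.dim ?T2"
      by (rule PV.dim_sum_Int[OF T PV.fin_dim_subset[OF formsV_fin_dim T1V] PV.fin_dim_subset[OF formsV_fin_dim T2V]])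
    moreover have "PV.dim {0} = 0" using PV.dim_le_card[of "{0}" "{}"] by simp
    ultimately have ker: "PV.dim {r \<in> formsV n. \<Phi> r = 0} = PS.dim (forms (n - e1)) + PS.dim (forms (n - e2))"
      using dT int by simp
    have "\<Phi> ` formsV n = jacobian_ideal f \<inter> forms (n + (m - 1))"
    proof (intro equalityI subsetI)
      fix F assume "F \<in> \<Phi> ` formsV n"
      then obtain r where r: "r \<in> formsV n" "F = \<Phi> r" by blast
      then show "F \<in> jacobian_ideal f \<inter> forms (n + (m - 1))"
        using partials_forms[OF f] jacobian_idealI[of "r $ 1" f]
        unfolding \<Phi> formsV_def by (auto intro!: forms_add forms_mult)
    next
      fix F assume F: "F \<in> jacobian_ideal f \<inter> forms (n + (m - 1))"
      then obtain a b c where abc: "F = a * dX f + b * dY f + c * dZ f" by (auto simp: jacobian_ideal_def)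
      have "F = hcomp (n + (m - 1)) F" using F hcomp_id by simp
      also have "\<dots> = hcomp n a * dX f + hcomp n b * dY f + hcomp n c * dZ f"
        unfolding abc hcomp_add hcomp_mult[OF partials_forms(1)[OF f]] hcomp_mult[OF partials_forms(2)[OF f]]
          hcomp_mult[OF partials_forms(3)[OF f]] by simp
      also have "\<dots> = \<Phi> (vector [hcomp n a, hcomp n b, hcomp n c])" by (simp add: \<Phi>)
      finally have "F = \<Phi> (vector [hcomp n a, hcomp n b, hcomp n c])" .
      moreover have "vector [hcomp n a, hcomp n b, hcomp n c] \<in> formsV n"
        by (simp add: formsV_def forall_3 hcomp_forms)
      ultimately show "F \<in> \<Phi> ` formsV n" by blast
    qed
    then show ?thesis
      using PVS.dim_rank_nullity(1)[OF lin formsV_subspace formsV_fin_dim, of n] ker dim_formsV[of n] by simp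
  qed
  then show ?thesis by blast
qed

section \<open>The codimension of the Jacobian ideal and the lower bound\<close>

lemma jacobian_hom_ideal:
  assumes "f \<in> forms m"
  shows "hom_ideal (jacobian_ideal f)"
  unfolding hom_ideal_def
proof (intro conjI ballI allI jacobian_ideal_ideal)
  fix F n assume "F \<in> jacobian_ideal f"
  then obtain a b c where F: "F = a * dX f + b * dY f + c * dZ f" by (auto simp: jacobian_ideal_def)
  show "hcomp n F \<in> jacobian_ideal f"
    unfolding F hcomp_add hcomp_mult[OF partials_forms(1)[OF assms]] hcomp_mult[OF partials_forms(2)[OF assms]]
      hcomp_mult[OF partials_forms(3)[OF assms]]
    using idealD(1)[OF jacobian_ideal_ideal] by (simp add: jacobian_idealI)
qed

text \<open>By the Euler relation a common zero of the partials lies on the curve, because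
  \<open>m\<close> is invertible.\<close>

lemma gradient_zero_imp_Sing:
  assumes f: "f \<in> forms m" "m > 0" and v: "v \<noteq> 0"
    and z: "eval3 (dX f) v = 0" "eval3 (dY f) v = 0" "eval3 (dZ f) v = 0"
  shows "\<exists>p\<in>Sing f. \<exists>c. c \<noteq> 0 \<and> rep_P2 p = c *s v"
proof -
  have "of_nat m * eval3 f v = 0"
    using arg_cong[OF euler_identity[OF f(1)], of "\<lambda>F. eval3 F v"] z
    by (simp flip: const3_of_nat)
  then have "eval3 f v = 0" using f(2) by simp
  moreover have "gradient_at f v = 0" by (simp add: gradient_at_def vec_eq_iff forall_3 z)
  moreover obtain p c where p: "c \<noteq> 0" "rep_P2 p = c *s v" using ex_rep_P2[OF v] by blast
  ultimately show ?thesis using SingI[OF f(1)] by blast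
qed

text \<open>For coefficients \<open>(1, t, t ^ 2)\<close> each point excludes only the roots of a
  nonzero polynomial in \<open>t\<close>. The coefficient \<open>1\<close> of \<open>X3\<close> is
  the normal form used in \<open>hyperplane_surjective\<close>.\<close>

lemma avoiding_line:
  assumes "finite E" "\<And>v. v \<in> E \<Longrightarrow> v \<noteq> 0"
  shows "\<exists>t. \<forall>v\<in>E. eval3 (X3 + const3 t * Y3 + const3 (t ^ 2) * Z3) v \<noteq> 0"
proof -
  define P where "P = (\<lambda>v :: complex^3. [:v $ 1, v $ 2, v $ 3:])"
  have "P v \<noteq> 0" if "v \<in> E" for v
    using assms(2)[OF that] by (auto simp: P_def vec_eq_iff forall_3)
  then have "finite (\<Union>v\<in>E. {t. poly (P v) t = 0})" using assms(1) poly_roots_finite by blast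
  then have "(\<Union>v\<in>E. {t. poly (P v) t = 0}) \<noteq> UNIV" using infinite_UNIV_char_0 by metis
  then obtain t where t: "\<And>v. v \<in> E \<Longrightarrow> poly (P v) t \<noteq> 0" by blast
  have "eval3 (X3 + const3 t * Y3 + const3 (t ^ 2) * Z3) v = poly (P v) t" for v
    by (simp add: P_def algebra_simps power2_eq_square)
  then show ?thesis using t by metis
qed

lemma codim_jacobian_le_total_tjurina:
  assumes f: "f \<in> forms m" "m > 0" and fin: "finite (Sing f)"
  shows "\<exists>N D. (\<forall>n\<ge>N. PS.dim (forms n) = PS.dim (jacobian_ideal f \<inter> forms n) + D) \<and> D \<le> total_tjurina f"
proof -
  let ?J = "jacobian_ideal f"
  note J = jacobian_ideal_ideal[of f]
  have "\<exists>t. \<forall>v\<in>rep_P2 ` Sing f. eval3 (X3 + const3 t * Y3 + const3 (t ^ 2) * Z3) v \<noteq> 0"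
    by (rule avoiding_line) (use fin rep_P2_nonzero in auto)
  then obtain t where t: "\<forall>v\<in>rep_P2 ` Sing f. eval3 (X3 + const3 t * Y3 + const3 (t ^ 2) * Z3) v \<noteq> 0" ..
  define l where "l = X3 + const3 t * Y3 + const3 (t ^ 2) * Z3"
  have lf: "l \<in> forms 1" unfolding l_def by (intro forms_add forms_const_mult X3_forms Y3_forms Z3_forms)
  have lp: "eval3 l (rep_P2 p) \<noteq> 0" if "p \<in> Sing f" for p using t that by (simp add: l_def)
  have "eval3 l (vector [1, 0, 0]) = 1" by (simp add: l_def)
  then have l0: "l \<noteq> 0" by auto
  have dJ: "dX f \<in> ?J" "dY f \<in> ?J" "dZ f \<in> ?J"
    using jacobian_idealI[of 1 f 0 0] jacobian_idealI[of 0 f 1 0] jacobian_idealI[of 0 f 0 1] by simp_all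
  have zeros: "eval3 l v \<noteq> 0" if v: "v \<noteq> 0" "\<forall>n. \<forall>F\<in>?J \<inter> forms n. eval3 F v = 0" for v
  proof -
    have "eval3 (dX f) v = 0" "eval3 (dY f) v = 0" "eval3 (dZ f) v = 0"
      using v(2) dJ partials_forms[OF f(1)] by blast+
    then obtain p c where "p \<in> Sing f" "c \<noteq> 0" "rep_P2 p = c *s v"
      using gradient_zero_imp_Sing[OF f v(1)] by blast
    then show ?thesis using lp eval3_scale[OF lf, of c v] by fastforce
  qed
  obtain N0 where N0: "\<And>n F. n \<ge> N0 \<Longrightarrow> F \<in> forms (Suc n) \<Longrightarrow> \<exists>g\<in>forms n. F - l * g \<in> ?J"
    using hyperplane_surjective[OF jacobian_hom_ideal[OF f(1)] l_def zeros] by blast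
  obtain N D where N: "\<And>n. n \<ge> N \<Longrightarrow> PS.dim (forms n) = PS.dim (?J \<inter> forms n) + D"
    and inj: "\<And>n g. n \<ge> N \<Longrightarrow> g \<in> forms n \<Longrightarrow> l * g \<in> ?J \<Longrightarrow> g \<in> ?J"
    using codim_eventually_constant[OF J lf l0 N0] by blast
  \<comment> \<open>In the stable range injectivity of multiplication by \<open>l\<close> can be
    iterated, so there the saturation adds no forms.\<close>
  have inj_sat: "g \<in> ?J" if "n \<ge> N" "g \<in> forms n" "g \<in> saturation l ?J" for n g
  proof -
    obtain j where "l ^ j * g \<in> ?J" using \<open>g \<in> saturation l ?J\<close> by (auto simp: saturation_def)
    then show ?thesis
    proof (induction j)
      case (Suc j)
      have "l ^ j * g \<in> forms (j + n)" using forms_mult[OF forms_linear_power[OF lf]] that(2) .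
      moreover have "l * (l ^ j * g) \<in> ?J" using Suc.prems by (simp add: mult.assoc)
      ultimately show ?case using inj[of "j + n"] that(1) Suc.IH by auto
    qed simp
  qed
  have dim: "PS.dim (forms (N + D)) \<le> PS.dim (?J \<inter> forms (N + D)) + D" using N[of "N + D"] by simp
  let ?Q = "\<lambda>p \<phi> H e N'. (\<forall>i x y. \<phi> i (x + y) = \<phi> i x + \<phi> i y) \<and> (\<forall>i c x. \<phi> i (const3 c * x) = c * \<phi> i x) \<and>
    H \<in> forms e \<and> eval3 H (rep_P2 p) \<noteq> 0 \<and>
    (\<forall>n\<ge>N'. \<forall>g\<in>forms n. (\<forall>i<tjurina f p. \<phi> i g = 0) \<longrightarrow> H * g \<in> ?J)"
  have "\<forall>p\<in>Sing f. \<exists>(\<phi> :: nat \<Rightarrow> poly3 \<Rightarrow> complex) H e N'. ?Q p \<phi> H e N'"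
    by (intro ballI local_functionals[OF f lf lp dim])
  then obtain \<phi> :: "P2 \<Rightarrow> nat \<Rightarrow> poly3 \<Rightarrow> complex" and H e N'
    where Q: "\<forall>p\<in>Sing f. ?Q p (\<phi> p) (H p) (e p) (N' p)"
    unfolding bchoice_iff by (elim exE) (rule that)
  define n where "n = N + (\<Sum>p\<in>Sing f. N' p)"
  have nN: "n \<ge> N" by (simp add: n_def)
  have nN': "N' p \<le> n" if "p \<in> Sing f" for p
    using member_le_sum[OF that, of N'] fin by (simp add: n_def)
  \<comment> \<open>One condition for each singular point and each coordinate of its Tjurina
    algebra.\<close>
  define I where "I = Sigma (Sing f) (\<lambda>p. {..<tjurina f p})"
  let ?\<phi> = "\<lambda>(p, i). \<phi> p i"
  have "PS.dim (forms n) \<le> PS.dim {x \<in> forms n. \<forall>e\<in>I. ?\<phi> e x = 0} + card I"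
    by (rule PS.dim_kernel_functionals[OF forms_subspace forms_fin_dim])
       (use Q fin in \<open>auto simp: I_def scale3_def\<close>)
  also have "PS.dim {x \<in> forms n. \<forall>e\<in>I. ?\<phi> e x = 0} \<le> PS.dim (?J \<inter> forms n)"
  proof (rule PS.dim_mono_fin_dim)
    show "PS.fin_dim (?J \<inter> forms n)" by (rule PS.fin_dim_subset[OF forms_fin_dim[of n]]) auto
    show "{x \<in> forms n. \<forall>e\<in>I. ?\<phi> e x = 0} \<subseteq> ?J \<inter> forms n"
    proof
      fix x assume x: "x \<in> {x \<in> forms n. \<forall>e\<in>I. ?\<phi> e x = 0}"
      then have z: "\<forall>i<tjurina f p. \<phi> p i x = 0" if "p \<in> Sing f" for p
        using that by (auto simp: I_def)
      have Hx: "H p * x \<in> ?J" if "p \<in> Sing f" for p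
        using bspec[OF Q that] nN'[OF that] x z[OF that] by blast
      \<comment> \<open>Otherwise all forms multiplying \<open>x\<close> into \<open>J\<close>
        vanish at some \<open>v\<close>. The partials are among them, so \<open>v\<close> represents
        a singular point \<open>p\<close>; but \<open>H p\<close> is among them too and does not
        vanish there.\<close>
      have "x \<in> saturation l ?J"
      proof (rule ccontr)
        assume "x \<notin> saturation l ?J"
        then obtain v where v: "eval3 l v = 1" "\<forall>n. \<forall>F\<in>forms n. F * x \<in> saturation l ?J \<longrightarrow> eval3 F v = 0"
          using common_zero[OF J lf dim] by blast
        have vz: "eval3 F v = 0" if "F \<in> forms k" "F * x \<in> ?J" for F k
          using v(2) that subsetD[OF saturation_superset] by blast
        have "eval3 (dX f) v = 0" "eval3 (dY f) v = 0" "eval3 (dZ f) v = 0"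
          using vz partials_forms[OF f(1)] idealD(4)[OF J] dJ by blast+
        moreover have "v \<noteq> 0" using v(1) eval3_scale[OF lf, of 0 v] by auto
        ultimately obtain p c where p: "p \<in> Sing f" "rep_P2 p = c *s v"
          using gradient_zero_imp_Sing[OF f] by blast
        have Hf: "H p \<in> forms (e p)" "eval3 (H p) (rep_P2 p) \<noteq> 0" using bspec[OF Q p(1)] by simp_all
        have "eval3 (H p) v = 0" using vz[OF Hf(1) Hx[OF p(1)]] .
        then show False using Hf(2) eval3_scale[OF Hf(1), of c v] p(2) by simp
      qed
      then show "x \<in> ?J \<inter> forms n" using inj_sat[OF nN] x by blast
    qed
  qed
  finally have "D \<le> card I" using N[OF nN] by simp
  also have "card I = total_tjurina f" using fin by (simp add: I_def total_tjurina_def)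
  finally show ?thesis using N by blast
qed

text \<open>For large \<open>n\<close> the free resolution and the constant codimension
  \<open>D\<close> give an identity of quadratic polynomials in \<open>n\<close>: its linear part
  determines \<open>e1 + e2\<close>, its constant part \<open>D\<close>.\<close>

lemma free_total_tjurina_ge:
  assumes f: "f \<in> forms m" "m > 0" and fin: "finite (Sing f)" and free: "free_curve f"
  shows "real (total_tjurina f) \<ge> 3 / 4 * (real m - 1) ^ 2"
proof -
  obtain e1 e2 where e: "\<And>n. n \<ge> max e1 e2 \<Longrightarrow> 3 * PS.dim (forms n)
    = PS.dim (jacobian_ideal f \<inter> forms (n + (m - 1))) + PS.dim (forms (n - e1)) + PS.dim (forms (n - e2))"
    using free_dim_formula[OF f(1) free] by blast
  obtain N D where N: "\<And>n. n \<ge> N \<Longrightarrow> PS.dim (forms n) = PS.dim (jacobian_ideal f \<inter> forms n) + D"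
    and D: "D \<le> total_tjurina f"
    using codim_jacobian_le_total_tjurina[OF f fin] by blast
  define M where "M = real (m - 1)"
  have rdim: "real (PS.dim (forms k)) = (real k + 1) * (real k + 2) / 2" for k
    using arg_cong[OF dim_forms[of k], of real] by (simp add: algebra_simps)
  have eq: "(x + M + 1) * (x + M + 2) + (x - e1 + 1) * (x - e1 + 2) + (x - e2 + 1) * (x - e2 + 2)
      = 3 * (x + 1) * (x + 2) + 2 * D" if "n \<ge> N + e1 + e2" "x = real n" for n x
  proof -
    have "3 * PS.dim (forms n) + D = PS.dim (forms (n + (m - 1))) + PS.dim (forms (n - e1)) + PS.dim (forms (n - e2))"
      using e[of n] N[of "n + (m - 1)"] that(1) by simp
    then have "3 * real (PS.dim (forms n)) + D
        = real (PS.dim (forms (n + (m - 1)))) + real (PS.dim (forms (n - e1))) + real (PS.dim (forms (n - e2)))"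
      by (metis of_nat_add of_nat_mult of_nat_numeral)
    moreover have r: "real (n - e1) = x - e1" "real (n - e2) = x - e2" "real (n + (m - 1)) = x + M"
      using that by (simp_all add: M_def)
    ultimately show ?thesis unfolding rdim r that(2)[symmetric] by (simp add: field_simps)
  qed
  define x where "x = real (N + e1 + e2)"
  have 1: "(x + M + 1) * (x + M + 2) + (x - e1 + 1) * (x - e1 + 2) + (x - e2 + 1) * (x - e2 + 2)
      = 3 * (x + 1) * (x + 2) + 2 * D"
    by (rule eq[OF order_refl x_def])
  have 2: "((x + 1) + M + 1) * ((x + 1) + M + 2) + ((x + 1) - e1 + 1) * ((x + 1) - e1 + 2) + ((x + 1) - e2 + 1) * ((x + 1) - e2 + 2)
      = 3 * ((x + 1) + 1) * ((x + 1) + 2) + 2 * D"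
    by (rule eq[of "Suc (N + e1 + e2)"]) (simp_all add: x_def)
  \<comment> \<open>The difference of the identities in two consecutive degrees isolates the linear
    part.\<close>
  have M: "M = real e1 + real e2" using 1 2 by (simp add: algebra_simps)
  have "real D = M ^ 2 - real e1 * real e2"
    using 1 unfolding M by (simp add: algebra_simps power2_eq_square)
  moreover have "4 * (real e1 * real e2) \<le> M ^ 2"
    using zero_le_power2[of "real e1 - real e2"] unfolding M by (simp add: algebra_simps power2_eq_square)
  ultimately have "real D \<ge> 3 / 4 * M ^ 2" by simp
  moreover have "M = real m - 1" using f(2) by (simp add: M_def of_nat_diff)
  ultimately show ?thesis using D by simp
qed

text \<open>The empty arrangement has equation \<open>1\<close>, and for it the claimed bound would
  read \<open>0 \<ge> 3 / 4\<close>. All partials vanish, so every vector is a syzygy, and the count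
  in a single degree already contradicts a basis of two elements.\<close>

lemma not_free_1: "\<not> free_curve 1"
proof
  assume "free_curve 1"
  then obtain e1 e2 where e: "\<And>n. n \<ge> max e1 e2 \<Longrightarrow> 3 * PS.dim (forms n)
    = PS.dim (jacobian_ideal 1 \<inter> forms (n + (0 - 1))) + PS.dim (forms (n - e1)) + PS.dim (forms (n - e2))"
    using free_dim_formula[OF forms_1] by blast
  have "dX 1 = 0" "dY 1 = 0" "dZ 1 = 0"
    using derivationD(4)[OF derivation_partials(1)] derivationD(4)[OF derivation_partials(2)]
      derivationD(4)[OF derivation_partials(3)] by auto
  then have "jacobian_ideal 1 = {0}" by (auto simp: jacobian_ideal_def)
  then have 0: "PS.dim (jacobian_ideal 1 \<inter> forms k) = 0" for k
    using PS.dim_le_card[of "jacobian_ideal 1 \<inter> forms k" "{}"] by auto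
  have mono: "2 * PS.dim (forms (n - k)) \<le> 2 * PS.dim (forms n)" for n k
    unfolding dim_forms by (intro mult_le_mono) auto
  define n where "n = max e1 e2"
  show False using e[of n] 0 mono[of n e1] mono[of n e2] dim_forms[of n] by (simp add: n_def)
qed

lemma arrangement_forms:
  assumes "arrangement d k L Q"
  shows "finite (L \<union> Q)" "\<exists>e. (\<forall>g\<in>L \<union> Q. g \<in> forms (e g) \<and> g \<noteq> 0) \<and> sum e (L \<union> Q) = d + 2 * k"
proof -
  note a = assms[unfolded arrangement_def line_form_def smooth_conic_form_def]
  show fin: "finite (L \<union> Q)" using a by blast
  have L: "g \<in> forms 1" "g \<noteq> 0" if "g \<in> L" for g using a that by (auto simp: forms_def)
  have Q: "g \<in> forms 2" "g \<noteq> 0" if "g \<in> Q" for g using a that by (auto simp: forms_def)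
  \<comment> \<open>Lines and conics differ in degree, so no equation is counted twice.\<close>
  have disj: "L \<inter> Q = {}"
    using L Q forms_degree_unique[of _ 1 2] by fastforce
  define e :: "poly3 \<Rightarrow> nat" where "e = (\<lambda>g. if g \<in> L then 1 else 2)"
  have "sum e (L \<union> Q) = sum e L + sum e Q" using a disj by (intro sum.union_disjoint) auto
  also have "sum e L = d" using a by (simp add: e_def)
  also have "sum e Q = (\<Sum>g\<in>Q. 2)" using disj by (intro sum.cong) (auto simp: e_def)
  also have "\<dots> = 2 * k" using a by simp
  finally have "sum e (L \<union> Q) = d + 2 * k" .
  moreover have "g \<in> forms (e g) \<and> g \<noteq> 0" if "g \<in> L \<union> Q" for g
    using that L Q by (auto simp: e_def)
  ultimately show "\<exists>e. (\<forall>g\<in>L \<union> Q. g \<in> forms (e g) \<and> g \<noteq> 0) \<and> sum e (L \<union> Q) = d + 2 * k" by blast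
qed

lemma arrangement_bound:
  assumes arr: "arrangement d k L Q" and free: "free_curve (\<Prod>(L \<union> Q))"
    and ord: "only_ordinary_quasi_homogeneous (L \<union> Q)"
  shows "real (total_tjurina (\<Prod>(L \<union> Q)))
    \<ge> 3 * real k * (real k - 1) + 3 * real k * real d + 3 * (real d - 1) ^ 2 / 4"
proof -
  obtain e where e: "\<And>g. g \<in> L \<union> Q \<Longrightarrow> g \<in> forms (e g) \<and> g \<noteq> 0" "sum e (L \<union> Q) = d + 2 * k"
    using arrangement_forms(2)[OF arr] by blast
  have fin: "finite (L \<union> Q)" by (rule arrangement_forms(1)[OF arr])
  have f: "\<Prod>(L \<union> Q) \<in> forms (d + 2 * k)"
    using forms_prod[OF fin, of "\<lambda>x. x" e] e by simp
  have "d + 2 * k > 0"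
  proof (rule ccontr)
    assume "\<not> d + 2 * k > 0"
    then have "L \<union> Q = {}" using arr by (auto simp: arrangement_def)
    then show False using free not_free_1 by simp
  qed
  moreover have "finite (Sing (\<Prod>(L \<union> Q)))"
    using finite_Sing[OF fin e(1)] ord unfolding only_ordinary_quasi_homogeneous_def by blast
  ultimately have ge: "real (total_tjurina (\<Prod>(L \<union> Q))) \<ge> 3 / 4 * (real (d + 2 * k) - 1) ^ 2"
    by (intro free_total_tjurina_ge[OF f _ _ free])
  have eq: "3 / 4 * (real (d + 2 * k) - 1) ^ 2
      = 3 * real k * (real k - 1) + 3 * real k * real d + 3 * (real d - 1) ^ 2 / 4"
    by (simp add: field_simps power2_eq_square)
  show ?thesis using ge unfolding eq .
qed

section \<open>Sharpness\<close>

lemma Sing_X3: "Sing X3 = {}"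
proof -
  have "gradient_at X3 v $ 1 = 1" for v by (simp add: gradient_at_def)
  then have "gradient_at X3 v \<noteq> 0" for v by (metis zero_index zero_neq_one)
  then show ?thesis by (auto simp: Sing_def)
qed

text \<open>The gradient is \<open>(1, 0, 0)\<close>, so the syzygies are the vectors with vanishing
  first component; the last two unit vectors form a basis in degree \<open>0\<close>.\<close>

lemma free_X3: "free_curve X3"
proof -
  let ?B = "{axis 2 1, axis 3 1} :: (poly3^3) set"
  have AR: "AR X3 = {r. r $ 1 = 0}" by (simp add: AR_def sum_3)
  have ne: "axis 2 1 \<noteq> (axis 3 1 :: poly3^3)" by (simp add: axis_eq_axis)
  have "S3.independent ?B"
    unfolding S3.independent_explicit_module
  proof (intro allI impI)
    fix t u v assume t: "finite t" "t \<subseteq> ?B" "(\<Sum>v\<in>t. u v *s v) = 0" "v \<in> t"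
    obtain k where k: "v = axis k 1" using t by blast
    have "0 = (\<Sum>x\<in>t. u x *s x) $ k" using t(3) by simp
    also have "\<dots> = (\<Sum>x\<in>t. if x = v then u v else 0)"
      unfolding sum_component
    proof (intro sum.cong refl)
      fix x assume "x \<in> t"
      then obtain j where x: "x = axis j 1" using t(2) by blast
      have "axis j (1 :: poly3) $ k = (if j = k then 1 else 0)" by (simp add: axis_def)
      then show "(u x *s x) $ k = (if x = v then u v else 0)" by (simp add: x k axis_eq_axis)
    qed
    also have "\<dots> = u v" using t by simp
    finally show "u v = 0" by simp
  qed
  moreover have "S3.span ?B = AR X3"
  proof (intro equalityI S3.span_minimal subsetI)
    show "S3.subspace (AR X3)" by (auto simp: AR S3.subspace_def)
    fix r assume "r \<in> AR X3"
    then have "r = r $ 2 *s axis 2 1 + r $ 3 *s axis 3 1"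
      by (simp add: AR vec_eq_iff forall_3 axis_def)
    moreover have "r $ 2 *s axis 2 1 + r $ 3 *s axis 3 1 \<in> S3.span ?B"
      by (intro S3.span_add S3.span_scale S3.span_base) auto
    ultimately show "r \<in> S3.span ?B" by simp
  qed (auto simp: AR axis_def)
  moreover have "\<forall>r\<in>?B. \<exists>e. \<forall>i. homogeneous e (r $ i)"
    using forms_1 forms_0 by (intro ballI exI[of _ 0]) (auto simp: axis_def forms_def)
  ultimately show ?thesis using ne unfolding free_curve_def by (intro exI[of _ ?B]) auto
qed

lemma single_line_sharp:
  "arrangement 1 0 {X3} {} \<and> free_curve (\<Prod>({X3} \<union> {})) \<and> only_ordinary_quasi_homogeneous ({X3} \<union> {}) \<and>
    total_tjurina (\<Prod>({X3} \<union> {})) = 0"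
proof -
  have "X3 \<noteq> 0" by (simp add: X3_def)
  then show ?thesis
    using X3_forms Sing_X3 free_X3
    by (simp add: arrangement_def line_form_def forms_def only_ordinary_quasi_homogeneous_def total_tjurina_def)
qed

theorem theorem4p1:
  shows "(\<forall>(d::nat) (k::nat) (L::poly3 set) (Q::poly3 set).
            arrangement d k L Q \<and> free_curve (\<Prod>(L \<union> Q)) \<and>
            only_ordinary_quasi_homogeneous (L \<union> Q) \<longrightarrow>
              real (total_tjurina (\<Prod>(L \<union> Q)))
                \<ge> 3 * real k * (real k - 1) + 3 * real k * real d + 3 * (real d - 1)^2 / 4)
       \<and> (\<exists>(d::nat) (k::nat) (L::poly3 set) (Q::poly3 set).
            arrangement d k L Q \<and> free_curve (\<Prod>(L \<union> Q)) \<and>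
            only_ordinary_quasi_homogeneous (L \<union> Q) \<and>
              real (total_tjurina (\<Prod>(L \<union> Q)))
                = 3 * real k * (real k - 1) + 3 * real k * real d + 3 * (real d - 1)^2 / 4)"
proof (intro conjI allI impI)
  fix d k L Q
  assume "arrangement d k L Q \<and> free_curve (\<Prod>(L \<union> Q)) \<and> only_ordinary_quasi_homogeneous (L \<union> Q)"
  then show "real (total_tjurina (\<Prod>(L \<union> Q)))
      \<ge> 3 * real k * (real k - 1) + 3 * real k * real d + 3 * (real d - 1) ^ 2 / 4"
    using arrangement_bound by blast
next
  show "\<exists>d k L Q. arrangement d k L Q \<and> free_curve (\<Prod>(L \<union> Q)) \<and> only_ordinary_quasi_homogeneous (L \<union> Q) \<and>
      real (total_tjurina (\<Prod>(L \<union> Q)))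
        = 3 * real k * (real k - 1) + 3 * real k * real d + 3 * (real d - 1) ^ 2 / 4"
    using single_line_sharp by (intro exI[of _ 1] exI[of _ 0] exI[of _ "{X3}"] exI[of _ "{}"]) simp
qed

end
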